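(* Let $\mathcal I=\{1,\dots,N\}$, let $r(t)$ be a continuous-time Markov chain on $\mathcal I$ with generator matrix $[q_{ij}]\in\mathbb R^{N\times N}$, and for each $i\in\mathcal I$ let $A(i)\in\mathbb R^{n\times n}$, $B(i)\in\mathbb R^{n\times m}$, $C(i)\in\mathbb R^{p\times n}$, $D(i)\in\mathbb R^{p\times p}$, $K(i)\in\mathbb R^{m\times p}$ be given. Put $A_{cl}(i)=A(i)+B(i)K(i)C(i)$ and $W(i)=B(i)K(i)D(i)$, and consider the closed-loop stochastic system $$dx(t)=A_{cl}(i)\,x(t)\,dt+W(i)\,dw(t),\qquad i=r(t),$$ where $w$ is a standard $p$-dimensional Wiener process. If there exist symmetric positive definite matrices $P(i)\in\mathbb R^{n\times n}$, $i\in\mathcal I$, such that $$A_{cl}(i)^TP(i)+P(i)A_{cl}(i)+\sum_{j=1}^N q_{ij}P(j)<0\qquad\text{for all } i\in\mathcal I,$$ then the origin of the closed-loop system is ultimately bounded stable (UBS) in mean square.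
   Context: Generator matrix: $q_{ij}\ge 0$ for $j\neq i$, $q_{ii}=-\sum_{j\ne i}q_{ij}$, and $\Pr(r(t+h)=j\mid r(t)=i)=q_{ij}h+o(h)$ for $j\ne i$, and $=1+q_{ii}h+o(h)$ for $j=i$. The Wiener process $w$ and the Markov chain $r$ are independent. The system starts at time $t_0$ from a deterministic initial condition $x(t_0)=x_0\in\mathbb R^n$, $r(t_0)=r_0\in\mathcal I$. For a symmetric matrix, $M>0$ (resp. $M<0$) means positive (resp. negative) definite. UBS in mean square: there exists $M>0$ such that $\mathbb E[x(t)^Tx(t)]\le M$ as $t\to\infty$, i.e. $\limsup_{t\to\infty}\mathbb E[x(t)^Tx(t)]\le M$ for the solution from every initial condition $(x_0,r_0)$. The closed loop arises from the system $\dot x=A(i)x+B(i)u$, $y=C(i)x+D(i)\omega$, $i=r(t)$, with $\omega$ a standard Gaussian white noise ($dw=\omega\,dt$), under the output feedback $u=K(i)y$. *)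

theory Defs
  imports "HOL-Probability.Probability" "HOL-Library.Landau_Symbols"
begin

subsection \<open>Definite symmetric matrices\<close>

definition pos_def :: "real ^ 'n ^ 'n \<Rightarrow> bool" where
  "pos_def M \<longleftrightarrow> transpose M = M \<and> (\<forall>v. v \<noteq> 0 \<longrightarrow> v \<bullet> (M *v v) > 0)"

definition neg_def :: "real ^ 'n ^ 'n \<Rightarrow> bool" where
  "neg_def M \<longleftrightarrow> transpose M = M \<and> (\<forall>v. v \<noteq> 0 \<longrightarrow> v \<bullet> (M *v v) < 0)"

subsection \<open>The Wiener process\<close>

text \<open>The \<open>\<sigma>\<close>-algebra generated by the variables \<open>X u\<close>, \<open>u \<in> T\<close>, with values in \<open>N\<close>.\<close>

definition process_events ::
  "'a measure \<Rightarrow> 'b measure \<Rightarrow> real set \<Rightarrow> (real \<Rightarrow> 'a \<Rightarrow> 'b) \<Rightarrow> 'a set set" where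
  "process_events \<Omega> N T X =
     sets (vimage_algebra (space \<Omega>) (\<lambda>\<omega>. \<lambda>u\<in>T. X u \<omega>) (PiM T (\<lambda>_. N)))"

text \<open>The density in the third clause is that of the normal law with mean zero and covariance
  \<open>(t - s)\<close> times the identity.\<close>

definition wiener_process :: "'a measure \<Rightarrow> (real \<Rightarrow> 'a \<Rightarrow> real ^ 'p) \<Rightarrow> bool" where
  "wiener_process \<Omega> w \<longleftrightarrow>
     (\<forall>t\<ge>0. w t \<in> borel_measurable \<Omega>) \<and>
     (AE \<omega> in \<Omega>. w 0 \<omega> = 0) \<and>
     (\<forall>s t. 0 \<le> s \<and> s < t \<longrightarrow>
        distributed \<Omega> lborel (\<lambda>\<omega>. w t \<omega> - w s \<omega>)
          (\<lambda>v. ennreal (\<Prod>k\<in>UNIV. normal_density 0 (sqrt (t - s)) (v $ k)))) \<and>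
     (\<forall>s t. 0 \<le> s \<and> s < t \<longrightarrow>
        prob_space.indep_set \<Omega>
          (sets (vimage_algebra (space \<Omega>) (\<lambda>\<omega>. w t \<omega> - w s \<omega>) borel))
          (process_events \<Omega> borel {0..s} w)) \<and>
     (AE \<omega> in \<Omega>. continuous_on {0..} (\<lambda>t. w t \<omega>))"

subsection \<open>Continuous-time Markov chains\<close>

definition generator_matrix :: "real ^ 'i ^ 'i \<Rightarrow> bool" where
  "generator_matrix q \<longleftrightarrow>
     (\<forall>i j. j \<noteq> i \<longrightarrow> q $ i $ j \<ge> 0) \<and>
     (\<forall>i. q $ i $ i = - (\<Sum>j\<in>UNIV - {i}. q $ i $ j))"

text \<open>The function \<open>p\<close> expresses that transition probabilities depend on the elapsed time only.
  Without it, that is with an error term \<open>o(h)\<close> depending on \<open>t\<close>, a chain with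
  additional jumps at deterministic times would not be excluded. Conditioning on null events is
  avoided because \<^const>\<open>cond_prob\<close> is zero there. The paths are right-continuous step functions
  with finitely many jumps in bounded time.\<close>

definition markov_chain ::
  "'a measure \<Rightarrow> real \<Rightarrow> 'i \<Rightarrow> real ^ 'i ^ 'i \<Rightarrow> (real \<Rightarrow> 'a \<Rightarrow> 'i::finite) \<Rightarrow> bool" where
  "markov_chain \<Omega> t0 r0 q r \<longleftrightarrow>
     (\<forall>t\<ge>t0. r t \<in> measurable \<Omega> (count_space UNIV)) \<and>
     (AE \<omega> in \<Omega>. r t0 \<omega> = r0) \<and>
     (AE \<omega> in \<Omega>. (\<forall>t\<ge>t0. \<forall>\<^sub>F u in at_right t. r u \<omega> = r t \<omega>) \<and>
                 (\<forall>t>t0. \<exists>i. \<forall>\<^sub>F u in at_left t. r u \<omega> = i)) \<and>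
     (\<forall>s t i j S \<sigma>. t0 \<le> s \<and> s < t \<and> finite S \<and> S \<subseteq> {t0..<s} \<and>
        \<P>(\<omega> in \<Omega>. r s \<omega> = i \<and> (\<forall>u\<in>S. r u \<omega> = \<sigma> u)) > 0 \<longrightarrow>
        \<P>(\<omega> in \<Omega>. r t \<omega> = j \<bar> r s \<omega> = i \<and> (\<forall>u\<in>S. r u \<omega> = \<sigma> u)) =
        \<P>(\<omega> in \<Omega>. r t \<omega> = j \<bar> r s \<omega> = i)) \<and>
     (\<exists>p. (\<forall>t h i j. t0 \<le> t \<and> 0 < h \<and> \<P>(\<omega> in \<Omega>. r t \<omega> = i) > 0 \<longrightarrow>
             \<P>(\<omega> in \<Omega>. r (t + h) \<omega> = j \<bar> r t \<omega> = i) = p i j h) \<and>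
          (\<forall>i j. (\<lambda>h. p i j h - ((if j = i then 1 else 0) + q $ i $ j * h))
             \<in> o[at_right 0](\<lambda>h. h)))"

definition independent_processes ::
  "'a measure \<Rightarrow> real \<Rightarrow> (real \<Rightarrow> 'a \<Rightarrow> real ^ 'p) \<Rightarrow> (real \<Rightarrow> 'a \<Rightarrow> 'i) \<Rightarrow> bool" where
  "independent_processes \<Omega> t0 w r \<longleftrightarrow>
     prob_space.indep_set \<Omega>
       (process_events \<Omega> borel {0..} w)
       (process_events \<Omega> (count_space UNIV) {t0..} r)"

text \<open>The natural filtration of the pair \<open>(w, r)\<close>, augmented by the null sets.\<close>

definition history ::
  "'a measure \<Rightarrow> real \<Rightarrow> (real \<Rightarrow> 'a \<Rightarrow> real ^ 'p) \<Rightarrow> (real \<Rightarrow> 'a \<Rightarrow> 'i) \<Rightarrow> real \<Rightarrow> 'a measure" where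
  "history \<Omega> t0 w r t = sigma (space \<Omega>)
     ({w u -` B \<inter> space \<Omega> | u B. 0 \<le> u \<and> u \<le> t \<and> B \<in> sets borel} \<union>
      {r u -` {i} \<inter> space \<Omega> | u i. t0 \<le> u \<and> u \<le> t} \<union>
      null_sets \<Omega>)"

subsection \<open>The Ito integral\<close>

text \<open>A simple process on \<open>[a, b]\<close> is given by times \<open>\<tau> 0 \<le> \<dots> \<le> \<tau> m\<close> and bounded matrix-valued
  variables \<open>\<xi> k\<close>, the value of the process on \<open>[\<tau> k, \<tau> (k + 1))\<close>, that are known at
  time \<open>\<tau> k\<close>.\<close>

definition simple_process ::
  "'a measure \<Rightarrow> (real \<Rightarrow> 'a measure) \<Rightarrow> real \<Rightarrow> real \<Rightarrow>
   nat \<Rightarrow> (nat \<Rightarrow> real) \<Rightarrow> (nat \<Rightarrow> 'a \<Rightarrow> real ^ 'p ^ 'n) \<Rightarrow> bool" where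
  "simple_process \<Omega> F a b m \<tau> \<xi> \<longleftrightarrow>
     \<tau> 0 = a \<and> \<tau> m = b \<and> (\<forall>k<m. \<tau> k \<le> \<tau> (Suc k)) \<and>
     (\<forall>k<m. \<xi> k \<in> borel_measurable (F (\<tau> k)) \<and> bounded (\<xi> k ` space \<Omega>))"

definition simple_value ::
  "nat \<Rightarrow> (nat \<Rightarrow> real) \<Rightarrow> (nat \<Rightarrow> 'a \<Rightarrow> real ^ 'p ^ 'n) \<Rightarrow> real \<Rightarrow> 'a \<Rightarrow> real ^ 'p ^ 'n" where
  "simple_value m \<tau> \<xi> s \<omega> = (\<Sum>k<m. indicator {\<tau> k..<\<tau> (Suc k)} s *\<^sub>R \<xi> k \<omega>)"

definition simple_integral_wrt ::
  "(real \<Rightarrow> 'a \<Rightarrow> real ^ 'p) \<Rightarrow> nat \<Rightarrow> (nat \<Rightarrow> real) \<Rightarrow>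
   (nat \<Rightarrow> 'a \<Rightarrow> real ^ 'p ^ 'n) \<Rightarrow> 'a \<Rightarrow> real ^ 'n" where
  "simple_integral_wrt w m \<tau> \<xi> \<omega> = (\<Sum>k<m. \<xi> k \<omega> *v (w (\<tau> (Suc k)) \<omega> - w (\<tau> k) \<omega>))"

text \<open>\<open>I\<close> is (a version of) the Ito integral of \<open>g\<close> over \<open>[a, b]\<close> with respect to \<open>w\<close>: the limit
  in mean square of the integrals of simple processes that converge to \<open>g\<close> in mean square. The
  norm of a matrix here is the Frobenius norm.\<close>

definition has_ito_integral ::
  "'a measure \<Rightarrow> (real \<Rightarrow> 'a measure) \<Rightarrow> (real \<Rightarrow> 'a \<Rightarrow> real ^ 'p) \<Rightarrow> real \<Rightarrow> real \<Rightarrow>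
   (real \<Rightarrow> 'a \<Rightarrow> real ^ 'p ^ 'n) \<Rightarrow> ('a \<Rightarrow> real ^ 'n) \<Rightarrow> bool" where
  "has_ito_integral \<Omega> F w a b g I \<longleftrightarrow>
     I \<in> borel_measurable \<Omega> \<and>
     (\<forall>s\<in>{a..b}. g s \<in> borel_measurable (F s)) \<and>
     (\<exists>m \<tau> \<xi>. (\<forall>k::nat. simple_process \<Omega> F a b (m k) (\<tau> k) (\<xi> k)) \<and>
        (\<lambda>k. \<integral>\<^sup>+\<omega>. (\<integral>\<^sup>+s\<in>{a..b}. ennreal ((norm (g s \<omega> - simple_value (m k) (\<tau> k) (\<xi> k) s \<omega>))\<^sup>2) \<partial>lborel) \<partial>\<Omega>)
          \<longlonglongrightarrow> 0 \<and>
        (\<lambda>k. \<integral>\<^sup>+\<omega>. ennreal ((norm (I \<omega> - simple_integral_wrt w (m k) (\<tau> k) (\<xi> k) \<omega>))\<^sup>2) \<partial>\<Omega>)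
          \<longlonglongrightarrow> 0)"

subsection \<open>The switched system and mean-square ultimate boundedness\<close>

text \<open>\<open>x\<close> solves \<open>dx = A(r) x dt + W(r) dw\<close> on \<open>[t0, \<infinity>)\<close> with \<open>x t0 = x0\<close>.\<close>

definition switched_sde_solution ::
  "'a measure \<Rightarrow> (real \<Rightarrow> 'a \<Rightarrow> real ^ 'p) \<Rightarrow> real \<Rightarrow> (real \<Rightarrow> 'a \<Rightarrow> 'i) \<Rightarrow>
   ('i \<Rightarrow> real ^ 'n ^ 'n) \<Rightarrow> ('i \<Rightarrow> real ^ 'p ^ 'n) \<Rightarrow>
   real ^ 'n \<Rightarrow> (real \<Rightarrow> 'a \<Rightarrow> real ^ 'n) \<Rightarrow> bool" where
  "switched_sde_solution \<Omega> w t0 r A W x0 x \<longleftrightarrow>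
     (\<forall>t\<ge>t0. x t \<in> borel_measurable (history \<Omega> t0 w r t)) \<and>
     (AE \<omega> in \<Omega>. continuous_on {t0..} (\<lambda>t. x t \<omega>)) \<and>
     (AE \<omega> in \<Omega>. x t0 \<omega> = x0) \<and>
     (\<forall>t\<ge>t0. \<exists>I.
        has_ito_integral \<Omega> (history \<Omega> t0 w r) w t0 t (\<lambda>s \<omega>. W (r s \<omega>)) I \<and>
        (AE \<omega> in \<Omega>. x t \<omega> = x0 + (LINT s:{t0..t}|lborel. A (r s \<omega>) *v x s \<omega>) + I \<omega>))"

text \<open>The expectation is a nonnegative Lebesgue integral, so the bound includes finiteness of the
  second moment for all sufficiently large times. The bound \<open>M\<close> is uniform in \<open>(x0, r0)\<close>.\<close>

definition ubs_mean_square ::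
  "'a measure \<Rightarrow> (real \<Rightarrow> 'a \<Rightarrow> real ^ 'p) \<Rightarrow> real \<Rightarrow> real ^ 'i ^ 'i \<Rightarrow>
   ('i::finite \<Rightarrow> real ^ 'n ^ 'n) \<Rightarrow> ('i \<Rightarrow> real ^ 'p ^ 'n) \<Rightarrow> bool" where
  "ubs_mean_square \<Omega> w t0 q A W \<longleftrightarrow>
     (\<exists>M::real. M > 0 \<and>
       (\<forall>x0 r0 r x.
          markov_chain \<Omega> t0 r0 q r \<and> independent_processes \<Omega> t0 w r \<and>
          switched_sde_solution \<Omega> w t0 r A W x0 x \<longrightarrow>
          Limsup at_top (\<lambda>t. \<integral>\<^sup>+\<omega>. ennreal (x t \<omega> \<bullet> x t \<omega>) \<partial>\<Omega>) \<le> ennreal M))"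

definition closed_loop_matrix ::
  "('i \<Rightarrow> real ^ 'n ^ 'n) \<Rightarrow> ('i \<Rightarrow> real ^ 'm ^ 'n) \<Rightarrow> ('i \<Rightarrow> real ^ 'p ^ 'm) \<Rightarrow>
   ('i \<Rightarrow> real ^ 'n ^ 'p) \<Rightarrow> 'i \<Rightarrow> real ^ 'n ^ 'n" where
  "closed_loop_matrix A B K C i = A i + B i ** K i ** C i"

definition noise_matrix ::
  "('i \<Rightarrow> real ^ 'm ^ 'n) \<Rightarrow> ('i \<Rightarrow> real ^ 'p ^ 'm) \<Rightarrow> ('i \<Rightarrow> real ^ 'p ^ 'p) \<Rightarrow>
   'i \<Rightarrow> real ^ 'p ^ 'n" where
  "noise_matrix B K D i = B i ** K i ** D i"

end

theory Submission
  imports Defs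
begin

text \<open>The function \<open>V t = E[x\<^sup>T P(r) x]\<close> at time \<open>t\<close> satisfies
  \<open>V (t + h) \<le> (1 - \<kappa> h) V t + h (C + o(1))\<close>, locally uniformly in \<open>t\<close>, with \<open>C\<close> depending on \<open>P\<close>
  and \<open>W\<close> only; iterating over a partition of mesh \<open>h \<rightarrow> 0\<close> gives
  \<open>V T \<le> exp (- \<kappa> (T - t0)) V t0 + C / \<kappa>\<close>. Neither the Ito formula nor the exact Ito correction is
  needed: since only a bound is claimed, the square of the noise increment may be estimated crudely by
  its second moment, which is \<open>O(h)\<close>. What has to be exact is that the term linear in the noise
  increment vanishes, and that term is multiplied by \<open>P(r(t + h))\<close>, which is not known at time
  \<open>t\<close>. It vanishes because the noise increments are independent of the past of the noise together
  with the whole path of the chain. The generator enters through the conditional law of \<open>r(t + h)\<close>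
  given the history, and the drift through \<open>x(t + h) - x(t) = O(h\<^sup>1\<^sup>/\<^sup>2)\<close> in mean square.\<close>

section \<open>Gaussian increments\<close>

text \<open>No integrability of the solution is assumed, so finiteness of \<open>E |x|^2\<close> has
  to come first: Gronwall is applied to each path, and expectations are taken only afterwards. The
  resulting bound \<open>K\<close> depends on the horizon \<open>T\<close>. Hence every error
  containing it must vanish with the mesh while \<open>T\<close> is held fixed, and only a bound for
  the variance rate of the noise may survive in the final constant.

  The history is embedded in two different sigma-algebras: for the noise terms it is enlarged by the
  whole future of the chain, for the transition probabilities by the whole future of the noise.

  Each Ito integral over \<open>[t0, t]\<close> brings its own approximating sequence and is
  determined only up to a null set depending on \<open>t\<close>. Increments are therefore treated
  by an isometry for families of possibly overlapping intervals, which compares two sequences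
  without a common refinement, and the noise of a path is read off from the solution as what is left
  after subtracting initial value and drift.\<close>

lemma
  fixes f :: "'p::finite \<Rightarrow> real \<Rightarrow> real"
  assumes f: "\<And>k. integrable lborel (f k)"
  shows integrable_lborel_vec_prod: "integrable lborel (\<lambda>v::real^'p. \<Prod>k\<in>UNIV. f k (v $ k))"
    and integral_lborel_vec_prod:
      "(LINT v|lborel. (\<Prod>k\<in>UNIV. f k ((v::real^'p) $ k))) = (\<Prod>k\<in>UNIV. LINT u|lborel. f k u)"
proof -
  let ?B = "Basis :: (real^'p) set"
  let ?S = "\<lambda>g::real^'p \<Rightarrow> real. \<Sum>b\<in>?B. g b *\<^sub>R b"
  interpret product_sigma_finite "\<lambda>_::real^'p. lborel :: real measure"
    by standard
  have bij: "bij_betw (\<lambda>k::'p. axis k (1::real)) UNIV ?B"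
    by (auto simp: bij_betw_def inj_on_def axis_eq_axis Basis_vec_def)
  have meas: "(\<lambda>v::real^'p. \<Prod>k\<in>UNIV. f k (v $ k)) \<in> borel_measurable borel"
    using f[THEN borel_measurable_integrable] by measurable
  have inv: "(\<lambda>k::'p. axis k (1::real)) ` UNIV = ?B"
    using bij by (simp add: bij_betw_def)
  define ix where "ix = the_inv (\<lambda>k::'p. axis k (1::real) :: real^'p)"
  have ix: "ix (axis k 1) = k" for k
    unfolding ix_def using bij by (intro the_inv_f_f) (simp add: bij_betw_def)
  have comp: "?S g $ k = g (axis k 1)" for g k
  proof -
    have "?S g $ k = ?S g \<bullet> axis k 1"
      by (simp add: inner_axis)
    also have "\<dots> = g (axis k 1)"
      by (rule inner_sum_left_Basis) (simp add: axis_in_Basis_iff)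
    finally show ?thesis .
  qed
  have prod: "(\<Prod>k\<in>UNIV. h k (axis k 1)) = (\<Prod>b\<in>?B. h (ix b) b)" for h :: "'p \<Rightarrow> real^'p \<Rightarrow> real"
    using prod.reindex_bij_betw[OF bij, of "\<lambda>b. h (ix b) b"] by (simp add: ix)
  have S: "?S \<in> measurable (\<Pi>\<^sub>M b\<in>?B. lborel) borel"
    by measurable
  have eq: "(\<Prod>k\<in>UNIV. f k (?S g $ k)) = (\<Prod>b\<in>?B. f (ix b) (g b))" for g
    unfolding comp using prod[of "\<lambda>k b. f k (g b)"] .
  \<comment> \<open>\<open>lborel\<close> on a Euclidean space is by definition the image of a
    product over \<open>Basis\<close>, here the vectors \<open>axis k 1\<close>. The bijection
    \<open>bij\<close> turns this into a product over coordinates, where Fubini for finite products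
    applies.\<close>
  have L: "(lborel :: (real^'p) measure) = distr (\<Pi>\<^sub>M b\<in>?B. lborel) borel ?S"
    unfolding lborel_def[where 'a="real^'p"] by (simp add: lborel_eq_real)
  show "integrable lborel (\<lambda>v::real^'p. \<Prod>k\<in>UNIV. f k (v $ k))"
    unfolding L by (subst integrable_distr_eq[OF S meas], unfold eq)
      (intro product_integrable_prod f finite_Basis)
  show "(LINT v|lborel. (\<Prod>k\<in>UNIV. f k ((v::real^'p) $ k))) = (\<Prod>k\<in>UNIV. LINT u|lborel. f k u)"
    unfolding L
    apply (subst integral_distr[OF S meas], unfold eq)
    apply (subst product_integral_prod[OF finite_Basis f])
    using prod[of "\<lambda>k b. LINT u|lborel. f k u"] by simp
qed

text \<open>The density in \<open>wiener_process\<close> is a product over the coordinates, so each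
  of these moments factors into moments of a one-dimensional normal law.\<close>

lemma
  fixes w :: "real \<Rightarrow> 'a \<Rightarrow> real^'p"
  assumes w: "wiener_process M w" and st: "0 \<le> s" "s < t"
  shows wiener_increment_integrable: "integrable M (\<lambda>\<omega>. (w t \<omega> - w s \<omega>) $ i)"
    and wiener_increment_mean: "(LINT \<omega>|M. (w t \<omega> - w s \<omega>) $ i) = 0"
    and wiener_increment_mult_integrable:
      "integrable M (\<lambda>\<omega>. (w t \<omega> - w s \<omega>) $ i * (w t \<omega> - w s \<omega>) $ j)"
    and wiener_increment_covariance:
      "(LINT \<omega>|M. (w t \<omega> - w s \<omega>) $ i * (w t \<omega> - w s \<omega>) $ j) = (if i = j then t - s else 0)"
proof -
  define nd where "nd = normal_density 0 (sqrt (t - s))"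
  have sg: "0 < sqrt (t - s)" using st by simp
  have D: "distributed M lborel (\<lambda>\<omega>. w t \<omega> - w s \<omega>) (\<lambda>v. ennreal (\<Prod>k\<in>UNIV. nd (v $ k)))"
    using w st unfolding wiener_process_def nd_def by blast
  have nd0: "0 \<le> (\<Prod>k\<in>UNIV. nd (v $ k))" for v :: "real^'p"
    by (intro prod_nonneg) (simp add: nd_def)
  have i0: "integrable lborel nd" "(LINT u|lborel. nd u) = 1"
    using sg by (simp_all add: nd_def)
  have i1: "integrable lborel (\<lambda>u. nd u * u)" "(LINT u|lborel. nd u * u) = 0"
    using integrable_normal_moment_nz_1[OF sg, of 0] integral_normal_moment_nz_1[OF sg, of 0]
    by (simp_all add: nd_def)
  have i2: "integrable lborel (\<lambda>u. nd u * u * u)" "(LINT u|lborel. nd u * u * u) = t - s"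
    using integrable_normal_moment[OF sg, of 0 2] integral_normal_moment_even[OF sg, of 0 1] st
    by (simp_all add: nd_def power2_eq_square mult.assoc)
  \<comment> \<open>The monomial is distributed over the product by inserting a factor
    \<open>u\<close> at the coordinates \<open>i\<close> and \<open>j\<close> only. For
    \<open>i = j\<close> one factor carries the second moment; for \<open>i \<noteq> j\<close> two
    factors carry vanishing first moments.\<close>
  let ?f = "\<lambda>k u. nd u * (if k = i then u else 1)"
  let ?g = "\<lambda>k u. nd u * (if k = i then u else 1) * (if k = j then u else 1)"
  have f: "integrable lborel (?f k)" for k
    using i0 i1 by (cases "k = i") simp_all
  have g: "integrable lborel (?g k)" for k
    using i0 i1 i2 by (cases "k = i"; cases "k = j") simp_all
  have fe: "(\<Prod>k\<in>UNIV. ?f k (v $ k)) = (\<Prod>k\<in>UNIV. nd (v $ k)) * v $ i" for v :: "real^'p"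
    by (simp add: prod.distrib)
  have ge: "(\<Prod>k\<in>UNIV. ?g k (v $ k)) = (\<Prod>k\<in>UNIV. nd (v $ k)) * (v $ i * v $ j)" for v :: "real^'p"
    by (simp add: prod.distrib)
  show "integrable M (\<lambda>\<omega>. (w t \<omega> - w s \<omega>) $ i)"
    using integrable_lborel_vec_prod[of ?f, OF f]
      distributed_integrable[OF D, of "\<lambda>v. v $ i"] nd0 unfolding fe by simp
  show "integrable M (\<lambda>\<omega>. (w t \<omega> - w s \<omega>) $ i * (w t \<omega> - w s \<omega>) $ j)"
    using integrable_lborel_vec_prod[of ?g, OF g]
      distributed_integrable[OF D, of "\<lambda>v. v $ i * v $ j"] nd0 unfolding ge by simp
  have "(LINT \<omega>|M. (w t \<omega> - w s \<omega>) $ i) = (\<Prod>k\<in>UNIV. LINT u|lborel. ?f k u)"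
    using integral_lborel_vec_prod[of ?f, OF f]
      distributed_integral[OF D, of "\<lambda>v. v $ i"] nd0 unfolding fe by simp
  also have "\<dots> = 0"
    using i1 by (intro prod_zero bexI[of _ i]) simp_all
  finally show "(LINT \<omega>|M. (w t \<omega> - w s \<omega>) $ i) = 0" .
  have "(LINT \<omega>|M. (w t \<omega> - w s \<omega>) $ i * (w t \<omega> - w s \<omega>) $ j) = (\<Prod>k\<in>UNIV. LINT u|lborel. ?g k u)"
    using integral_lborel_vec_prod[of ?g, OF g]
      distributed_integral[OF D, of "\<lambda>v. v $ i * v $ j"] nd0 unfolding ge by simp
  also have "\<dots> = (if i = j then t - s else 0)"
  proof (cases "i = j")
    case True
    then have "(LINT u|lborel. ?g k u) = (if k = i then t - s else 1)" for k
      using i0 i2 by simp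
    then show ?thesis using True by simp
  next
    case False
    then show ?thesis
      using i1 by (simp add: prod_zero_iff) (intro exI[of _ i], simp)
  qed
  finally show "(LINT \<omega>|M. (w t \<omega> - w s \<omega>) $ i * (w t \<omega> - w s \<omega>) $ j) = (if i = j then t - s else 0)" .
qed

text \<open>Dynkin's argument: the sets on which the two integrals agree form a lambda-system, where
  \<open>fg\<close> settles the complements. This lets conditional expectations be identified by
  testing on a pi-system.\<close>

lemma (in prob_space) set_integral_eq_sigma_sets:
  fixes f g :: "'a \<Rightarrow> real"
  assumes G: "G \<subseteq> events" "Int_stable G"
    and f: "integrable M f" and g: "integrable M g" and fg: "integral\<^sup>L M f = integral\<^sup>L M g"
    and eq: "\<And>A. A \<in> G \<Longrightarrow> (LINT x:A|M. f x) = (LINT x:A|M. g x)"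
    and A: "A \<in> sigma_sets (space M) G"
  shows "(LINT x:A|M. f x) = (LINT x:A|M. g x)"
proof -
  have ev: "sigma_sets (space M) G \<subseteq> events"
    using G(1) by (rule sets.sigma_sets_subset)
  have GP: "G \<subseteq> Pow (space M)" using G(1) sets.space_closed by auto
  have cpl: "(LINT x:space M - A|M. h x) = integral\<^sup>L M h - (LINT x:A|M. h x)"
    if A: "A \<in> events" and h: "integrable M h" for A and h :: "'a \<Rightarrow> real"
  proof -
    have "(LINT x:space M - A|M. h x) = (LINT x|M. h x - indicator A x *\<^sub>R h x)"
      unfolding set_lebesgue_integral_def
      by (intro Bochner_Integration.integral_cong) (auto simp: indicator_def)
    also have "\<dots> = integral\<^sup>L M h - (LINT x:A|M. h x)"
      unfolding set_lebesgue_integral_def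
      by (intro Bochner_Integration.integral_diff h integrable_mult_indicator A)
    finally show ?thesis .
  qed
  show ?thesis
    using G(2) GP A
  proof (induction rule: sigma_sets_induct_disjoint)
    case (basic A) then show ?case by (rule eq)
  next
    case empty then show ?case by (simp add: set_lebesgue_integral_def)
  next
    case (compl A)
    then have "A \<in> events" using ev by auto
    then show ?case using compl(2) by (simp add: cpl f g fg)
  next
    case (union A)
    have A: "A i \<in> events" for i using union(2) ev by auto
    have "(LINT x:(\<Union>i. A i)|M. h x) = (\<Sum>i. LINT x:A i|M. h x)" if "integrable M h" for h :: "'a \<Rightarrow> real"
    proof (rule lebesgue_integral_countable_add)
      show "set_integrable M (\<Union>i. A i) h"
        unfolding set_integrable_def using A that by (intro integrable_mult_indicator) auto
    qed (use A union(1) in \<open>auto simp: disjoint_family_on_def\<close>)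
    then show ?case using f g union(3) by simp
  qed
qed

section \<open>Independence and the Markov property\<close>

lemma process_events_measurable:
  assumes "u \<in> T" "\<And>u. u \<in> T \<Longrightarrow> X u \<in> measurable \<Omega> N"
  shows "X u \<in> measurable (vimage_algebra (space \<Omega>) (\<lambda>\<omega>. \<lambda>u\<in>T. X u \<omega>) (PiM T (\<lambda>_. N))) N"
proof -
  have "(\<lambda>\<omega>. \<lambda>u\<in>T. X u \<omega>) \<in> measurable (vimage_algebra (space \<Omega>) (\<lambda>\<omega>. \<lambda>u\<in>T. X u \<omega>) (PiM T (\<lambda>_. N))) (PiM T (\<lambda>_. N))"
    using measurable_space[OF assms(2)] by (intro measurable_vimage_algebra1) (auto simp: space_PiM)
  from measurable_component_singleton[OF assms(1), THEN measurable_compose[OF this]]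
  show ?thesis using assms(1) by simp
qed

lemma process_events_subset:
  assumes "sets F \<subseteq> sets \<Omega>" "space F = space \<Omega>" "\<And>u. u \<in> T \<Longrightarrow> X u \<in> measurable F N"
  shows "process_events \<Omega> N T X \<subseteq> sets F"
  unfolding process_events_def using assms
  by (intro sets_image_in_sets measurable_restrict) auto

lemma process_events_mono:
  assumes "S \<subseteq> T" "\<And>u. u \<in> T \<Longrightarrow> X u \<in> measurable \<Omega> N"
  shows "process_events \<Omega> N S X \<subseteq> process_events \<Omega> N T X"
  unfolding process_events_def using assms
  by (intro sets_image_in_sets measurable_restrict process_events_measurable) auto

lemma process_events_vimage:
  assumes "u \<in> T" "\<And>u. u \<in> T \<Longrightarrow> X u \<in> measurable \<Omega> N" "B \<in> sets N"
  shows "X u -` B \<inter> space \<Omega> \<in> process_events \<Omega> N T X"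
  using measurable_sets[OF process_events_measurable[OF assms(1,2)] assms(3)]
  by (simp add: process_events_def)

lemma process_events_Int:
  "A \<in> process_events \<Omega> N T X \<Longrightarrow> B \<in> process_events \<Omega> N T X \<Longrightarrow> A \<inter> B \<in> process_events \<Omega> N T X"
  unfolding process_events_def by (rule sets.Int)

lemma process_events_space: "space \<Omega> \<in> process_events \<Omega> N T X"
  unfolding process_events_def by (metis sets.top space_vimage_algebra)

text \<open>As \<open>A\<close> is independent of \<open>F\<close>, the conditional expectation of
  its indicator given \<open>F\<close> is the constant \<open>prob A\<close>, and the
  \<open>F\<close>-measurable \<open>f\<close> can be integrated against that constant.\<close>

lemma (in prob_space) set_integral_indep:
  fixes f :: "'a \<Rightarrow> real"
  assumes F: "subalgebra M F" and A: "A \<in> events"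
    and indep: "\<And>D. D \<in> sets F \<Longrightarrow> prob (D \<inter> A) = prob D * prob A"
    and f: "f \<in> borel_measurable F" "integrable M f"
  shows "(LINT x:A|M. f x) = prob A * integral\<^sup>L M f"
proof -
  interpret finite_measure_subalgebra M F
    by standard (rule F)
  have sub: "D \<in> events" if "D \<in> sets F" for D
    using that F by (auto simp: subalgebra_def)
  have "AE x in M. real_cond_exp M F (indicator A) x = prob A"
  proof (rule real_cond_exp_charact)
    fix D assume D: "D \<in> sets F"
    have "(LINT x:D|M. indicator A x) = (LINT x|M. indicator (D \<inter> A) x :: real)"
      by (auto simp: set_lebesgue_integral_def indicator_def intro!: Bochner_Integration.integral_cong)
    also have "\<dots> = prob D * prob A"
      using A D sub indep by simp
    also have "\<dots> = (LINT x:D|M. prob A)"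
      using D sub by (simp add: set_lebesgue_integral_def)
    finally show "(LINT x:D|M. indicator A x) = (LINT x:D|M. prob A)" .
  qed (use A in \<open>auto simp: emeasure_eq_measure\<close>)
  note ae = this
  have int: "integrable M (\<lambda>x. f x * indicator A x)"
    using f A by (intro integrable_mult_indicator[where 'b=real, simplified mult.commute real_scaleR_def]) auto
  have "(LINT x:A|M. f x) = (LINT x|M. f x * indicator A x)"
    by (simp add: set_lebesgue_integral_def mult.commute)
  also have "\<dots> = (LINT x|M. f x * real_cond_exp M F (indicator A) x)"
    using A by (intro real_cond_exp_intg(2)[symmetric] int f(1)) auto
  also have "\<dots> = (LINT x|M. f x * prob A)"
    using f measurable_from_subalg[OF F f(1)] ae
    by (intro integral_cong_AE) auto
  finally show ?thesis by simp
qed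

text \<open>The transition function that \<open>markov_chain\<close> only asserts to exist becomes
  the parameter \<open>p\<close>, so that one and the same \<open>p\<close> can later be expanded at
  zero for all times.\<close>

locale markov_noise = prob_space M for M :: "'a measure" +
  fixes w :: "real \<Rightarrow> 'a \<Rightarrow> real^'p" and t0 :: real
    and r :: "real \<Rightarrow> 'a \<Rightarrow> 'i::finite" and p :: "'i \<Rightarrow> 'i \<Rightarrow> real \<Rightarrow> real"
  assumes wiener: "wiener_process M w" and t0: "0 \<le> t0"
    and r_measurable: "\<And>t. t0 \<le> t \<Longrightarrow> r t \<in> measurable M (count_space UNIV)"
    and indep: "independent_processes M t0 w r"
    and markov: "\<And>s t i j S \<sigma>. t0 \<le> s \<Longrightarrow> s < t \<Longrightarrow> finite S \<Longrightarrow> S \<subseteq> {t0..<s} \<Longrightarrow>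
        \<P>(\<omega> in M. r s \<omega> = i \<and> (\<forall>u\<in>S. r u \<omega> = \<sigma> u)) > 0 \<Longrightarrow>
        \<P>(\<omega> in M. r t \<omega> = j \<bar> r s \<omega> = i \<and> (\<forall>u\<in>S. r u \<omega> = \<sigma> u)) =
        \<P>(\<omega> in M. r t \<omega> = j \<bar> r s \<omega> = i)"
    and transition: "\<And>t h i j. t0 \<le> t \<Longrightarrow> 0 < h \<Longrightarrow> \<P>(\<omega> in M. r t \<omega> = i) > 0 \<Longrightarrow>
        \<P>(\<omega> in M. r (t + h) \<omega> = j \<bar> r t \<omega> = i) = p i j h"
begin

abbreviation noise_events :: "real set \<Rightarrow> 'a set set" where
  "noise_events T \<equiv> process_events M borel T w"

abbreviation mode_events :: "real set \<Rightarrow> 'a set set" where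
  "mode_events T \<equiv> process_events M (count_space UNIV) T r"

lemma w_measurable: "0 \<le> t \<Longrightarrow> w t \<in> borel_measurable M"
  using wiener by (simp add: wiener_process_def)

lemma prob_noise_mode:
  "A \<in> noise_events {0..} \<Longrightarrow> B \<in> mode_events {t0..} \<Longrightarrow> prob (A \<inter> B) = prob A * prob B"
  using indep unfolding independent_processes_def by (rule indep_setD)

lemma noise_events_sub: "T \<subseteq> {0..} \<Longrightarrow> noise_events T \<subseteq> events"
  by (intro process_events_subset) (auto intro: w_measurable)

lemma mode_events_sub: "T \<subseteq> {t0..} \<Longrightarrow> mode_events T \<subseteq> events"
  by (intro process_events_subset) (auto intro: r_measurable)

text \<open>The noise up to time \<open>s\<close> together with the whole path of the chain. Increments of the noise
  after \<open>s\<close> are still independent of it, so all modes can be treated as known in the Ito terms.\<close>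

definition enlarged_gen :: "real \<Rightarrow> 'a set set" where
  "enlarged_gen s = {A \<inter> B | A B. A \<in> noise_events {0..s} \<and> B \<in> mode_events {t0..}} \<union> null_sets M"

definition enlarged :: "real \<Rightarrow> 'a measure" where
  "enlarged s = sigma (space M) (enlarged_gen s)"

lemma enlarged_gen_sub: "enlarged_gen s \<subseteq> events"
proof -
  have "noise_events {0..s} \<subseteq> events" by (rule noise_events_sub) auto
  then show ?thesis
    using mode_events_sub[OF subset_refl] unfolding enlarged_gen_def by blast
qed

lemma enlarged_gen_Pow: "enlarged_gen s \<subseteq> Pow (space M)"
  using enlarged_gen_sub sets.space_closed[of M] by (rule subset_trans)

lemma space_enlarged [simp]: "space (enlarged s) = space M"
  unfolding enlarged_def using enlarged_gen_Pow by (rule space_measure_of)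

lemma sets_enlarged: "sets (enlarged s) = sigma_sets (space M) (enlarged_gen s)"
  unfolding enlarged_def using enlarged_gen_Pow by (rule sets_measure_of)

lemma subalgebra_enlarged: "subalgebra M (enlarged s)"
  using sets.sigma_sets_subset[OF enlarged_gen_sub] by (simp add: subalgebra_def sets_enlarged)

text \<open>Rectangles \<open>A \<inter> B\<close> intersect componentwise, and a null set meets any
  event in a null set. Independence therefore has to be checked on rectangles only.\<close>

lemma Int_stable_enlarged_gen: "Int_stable (enlarged_gen s)"
proof (rule Int_stableI)
  fix a b assume a: "a \<in> enlarged_gen s" and b: "b \<in> enlarged_gen s"
  then have ab: "a \<in> events" "b \<in> events" using enlarged_gen_sub by auto
  show "a \<inter> b \<in> enlarged_gen s"
  proof (cases "a \<in> null_sets M \<or> b \<in> null_sets M")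
    case True
    then have "a \<inter> b \<in> null_sets M"
      using ab null_set_Int1 null_set_Int2 by blast
    then show ?thesis by (simp add: enlarged_gen_def)
  next
    case False
    then obtain A B A' B' where AB: "a = A \<inter> B" "A \<in> noise_events {0..s}" "B \<in> mode_events {t0..}"
      "b = A' \<inter> B'" "A' \<in> noise_events {0..s}" "B' \<in> mode_events {t0..}"
      using a b by (auto simp: enlarged_gen_def)
    from AB have "a \<inter> b = (A \<inter> A') \<inter> (B \<inter> B')" by auto
    then show ?thesis
      unfolding enlarged_gen_def
      using process_events_Int[OF AB(2,5)] process_events_Int[OF AB(3,6)] by blast
  qed
qed

lemma noise_in_enlarged: "A \<in> noise_events {0..s} \<Longrightarrow> A \<in> sets (enlarged s)"
proof -
  assume A: "A \<in> noise_events {0..s}"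
  have "noise_events {0..s} \<subseteq> events" by (rule noise_events_sub) auto
  then have "A = A \<inter> space M" using A sets.sets_into_space[of A M] by blast
  then have "A \<in> enlarged_gen s"
    unfolding enlarged_gen_def using A process_events_space by (intro UnI1 CollectI exI conjI)
  then show ?thesis
    unfolding sets_enlarged by (rule sigma_sets.Basic)
qed

lemma mode_in_enlarged: "B \<in> mode_events {t0..} \<Longrightarrow> B \<in> sets (enlarged s)"
proof -
  assume B: "B \<in> mode_events {t0..}"
  have "B \<in> events" using B mode_events_sub[OF subset_refl] by blast
  then have "B = space M \<inter> B" using sets.sets_into_space[of B M] by blast
  then have "B \<in> enlarged_gen s"
    unfolding enlarged_gen_def using B process_events_space by (intro UnI1 CollectI exI conjI)
  then show ?thesis
    unfolding sets_enlarged by (rule sigma_sets.Basic)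
qed

lemma w_enlarged: "0 \<le> u \<Longrightarrow> u \<le> s \<Longrightarrow> w u \<in> borel_measurable (enlarged s)"
  using noise_in_enlarged[OF process_events_vimage[of u "{0..s}" w M borel]] w_measurable
  by (intro measurableI) auto

lemma r_enlarged: "t0 \<le> u \<Longrightarrow> r u \<in> measurable (enlarged s) (count_space UNIV)"
  using mode_in_enlarged[OF process_events_vimage[of u "{t0..}" r M "count_space UNIV"]] r_measurable
  by (intro measurableI) auto

lemma null_enlarged: "N \<in> null_sets M \<Longrightarrow> N \<in> sets (enlarged s)"
  unfolding sets_enlarged enlarged_gen_def by (intro sigma_sets.Basic UnI2)

text \<open>Kept general in \<open>F\<close> because the history is embedded twice: in
  \<open>enlarged\<close> for the noise and in the sigma-algebra of \<open>past_gen\<close> for the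
  transitions.\<close>

lemma history_gen_sub:
  assumes "\<And>u B. 0 \<le> u \<Longrightarrow> u \<le> t \<Longrightarrow> B \<in> sets borel \<Longrightarrow> w u -` B \<inter> space M \<in> sets F"
    and "\<And>u i. t0 \<le> u \<Longrightarrow> u \<le> t \<Longrightarrow> r u -` {i} \<inter> space M \<in> sets F"
    and "null_sets M \<subseteq> sets F" "space F = space M"
  shows "subalgebra F (history M t0 w r t)"
proof -
  let ?G = "{w u -` B \<inter> space M | u B. 0 \<le> u \<and> u \<le> t \<and> B \<in> sets borel} \<union>
      {r u -` {i} \<inter> space M | u i. t0 \<le> u \<and> u \<le> t} \<union> null_sets M"
  have "null_sets M \<subseteq> Pow (space M)" using sets.space_closed[of M] by blast
  then have G: "?G \<subseteq> Pow (space M)" by blast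
  have "?G \<subseteq> sets F" using assms by auto
  then have "sigma_sets (space F) ?G \<subseteq> sets F" by (rule sets.sigma_sets_subset)
  then show ?thesis
    unfolding history_def subalgebra_def using G assms(4) by (simp add: sets_measure_of space_measure_of)
qed

lemma history_enlarged: "t \<le> s \<Longrightarrow> subalgebra (enlarged s) (history M t0 w r t)"
proof (rule history_gen_sub)
  fix u and B :: "(real^'p) set" assume "t \<le> s" "0 \<le> u" "u \<le> t" "B \<in> sets borel"
  then show "w u -` B \<inter> space M \<in> sets (enlarged s)"
    using measurable_sets[OF w_enlarged[of u s], of B] by simp
next
  fix u i assume "t0 \<le> u"
  then show "r u -` {i} \<inter> space M \<in> sets (enlarged s)"
    using measurable_sets[OF r_enlarged[of u s], of "{i}"] by simp
qed (auto intro: null_enlarged)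

lemma enlarged_mono: "s \<le> t \<Longrightarrow> subalgebra (enlarged t) (enlarged s)"
proof -
  assume st: "s \<le> t"
  have "noise_events {0..s} \<subseteq> noise_events {0..t}"
    using st by (intro process_events_mono) (auto intro: w_measurable)
  then have "enlarged_gen s \<subseteq> enlarged_gen t" by (auto simp: enlarged_gen_def)
  then show ?thesis by (simp add: subalgebra_def sets_enlarged sigma_sets_mono')
qed

text \<open>The increment is independent of the enlarged past by two applications of independence.
  For an increment event \<open>D\<close>, a past noise event \<open>A\<close> and a chain event
  \<open>B\<close>, the set \<open>D \<inter> A\<close> is a noise event, so \<open>B\<close> splits
  off by independence of the two processes; then \<open>D\<close> splits from \<open>A\<close> by
  the Wiener property. Hence the conditional expectation of \<open>h\<close> of the increment is
  constant.\<close>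

lemma increment_integral:
  fixes h :: "real^'p \<Rightarrow> real" and f :: "'a \<Rightarrow> real"
  assumes st: "0 \<le> s" "s < t"
    and h: "h \<in> borel_measurable borel" "integrable M (\<lambda>\<omega>. h (w t \<omega> - w s \<omega>))"
    and f: "f \<in> borel_measurable (enlarged s)" "integrable M (\<lambda>\<omega>. f \<omega> * h (w t \<omega> - w s \<omega>))"
  shows "(LINT \<omega>|M. f \<omega> * h (w t \<omega> - w s \<omega>)) = (LINT \<omega>|M. f \<omega>) * (LINT \<omega>|M. h (w t \<omega> - w s \<omega>))"
proof -
  let ?d = "\<lambda>\<omega>. w t \<omega> - w s \<omega>"
  define F where "F = vimage_algebra (space M) ?d borel"
  have d: "?d \<in> borel_measurable M" using st by (intro borel_measurable_diff w_measurable) auto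
  have F: "subalgebra M F"
    unfolding subalgebra_def F_def using sets_image_in_sets[OF refl d] by simp
  have dF: "?d \<in> borel_measurable F"
    unfolding F_def by (rule measurable_vimage_algebra1) simp
  have Fnoise: "sets F \<subseteq> noise_events {0..}"
    unfolding F_def process_events_def using st w_measurable
    by (intro sets_image_in_sets borel_measurable_diff process_events_measurable) auto
  have ind: "prob (D \<inter> E) = prob D * prob E" if D: "D \<in> sets F" and E: "E \<in> enlarged_gen s" for D E
  proof (cases "E \<in> null_sets M")
    case True
    have "D \<in> events" using D F by (auto simp: subalgebra_def)
    then have "D \<inter> E \<in> null_sets M" using True by (rule null_set_Int1[rotated])
    then show ?thesis using True by (simp add: measure_eq_0_null_sets)
  next
    case False
    then obtain A B where E: "E = A \<inter> B" "A \<in> noise_events {0..s}" "B \<in> mode_events {t0..}"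
      using E by (auto simp: enlarged_gen_def)
    have A: "A \<in> noise_events {0..}"
      using E(2) process_events_mono[of "{0..s}" "{0..}" w M borel] w_measurable by auto
    have DA: "prob (D \<inter> A) = prob D * prob A"
      using wiener st D E(2) unfolding wiener_process_def F_def by (blast intro: indep_setD)
    have "prob (D \<inter> E) = prob ((D \<inter> A) \<inter> B)" by (simp add: E(1) Int_assoc)
    also have "\<dots> = prob (D \<inter> A) * prob B"
      using D Fnoise A E(3) by (intro prob_noise_mode process_events_Int) auto
    also have "\<dots> = prob D * prob E"
      unfolding E(1) using DA prob_noise_mode[OF A E(3)] by simp
    finally show ?thesis .
  qed
  interpret finite_measure_subalgebra M "enlarged s"
    by standard (rule subalgebra_enlarged)
  let ?c = "LINT \<omega>|M. h (?d \<omega>)"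
  have hF: "(\<lambda>\<omega>. h (?d \<omega>)) \<in> borel_measurable F"
    using dF h(1) by (rule measurable_compose)
  have hM: "(\<lambda>\<omega>. h (?d \<omega>)) \<in> borel_measurable M"
    using d h(1) by (rule measurable_compose)
  have "AE \<omega> in M. real_cond_exp M (enlarged s) (\<lambda>\<omega>. h (?d \<omega>)) \<omega> = ?c"
  proof (rule real_cond_exp_charact)
    fix A assume "A \<in> sets (enlarged s)"
    then have A: "A \<in> sigma_sets (space M) (enlarged_gen s)" by (simp add: sets_enlarged)
    show "(LINT \<omega>:A|M. h (?d \<omega>)) = (LINT \<omega>:A|M. ?c)"
    proof (rule set_integral_eq_sigma_sets[OF enlarged_gen_sub Int_stable_enlarged_gen h(2) _ _ _ A])
      fix E assume E: "E \<in> enlarged_gen s"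
      then have "E \<in> events" using enlarged_gen_sub by auto
      then show "(LINT \<omega>:E|M. h (?d \<omega>)) = (LINT \<omega>:E|M. ?c)"
        using set_integral_indep[OF F _ ind[OF _ E] hF h(2)]
        by (simp add: set_lebesgue_integral_def)
    qed (simp_all add: prob_space)
  qed (use h in auto)
  note ae = this
  have "(LINT \<omega>|M. f \<omega> * h (?d \<omega>)) = (LINT \<omega>|M. f \<omega> * real_cond_exp M (enlarged s) (\<lambda>\<omega>. h (?d \<omega>)) \<omega>)"
    by (rule real_cond_exp_intg(2)[symmetric, OF f(2,1) hM])
  also have "\<dots> = (LINT \<omega>|M. f \<omega> * ?c)"
    using f measurable_from_subalg[OF subalgebra_enlarged f(1)] ae
    by (intro integral_cong_AE) auto
  finally show ?thesis by simp
qed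

text \<open>The mirror image of \<open>enlarged_gen\<close>: here the noise is known for all times
  and the chain only up to \<open>t\<close>. The chain enters through cylinders that prescribe
  finitely many states because the Markov clause of \<open>markov_chain\<close> conditions on
  exactly such events.\<close>

definition past_gen :: "real \<Rightarrow> 'a set set" where
  "past_gen t = {A \<inter> {\<omega>\<in>space M. \<forall>u\<in>S. r u \<omega> = \<sigma> u} | A S \<sigma>.
      A \<in> noise_events {0..} \<and> finite S \<and> S \<subseteq> {t0..t}} \<union> null_sets M"

lemma cylinder_mode: "finite S \<Longrightarrow> S \<subseteq> {t0..} \<Longrightarrow> {\<omega>\<in>space M. \<forall>u\<in>S. r u \<omega> = \<sigma> u} \<in> mode_events {t0..}"
proof (induction S rule: finite_induct)
  case empty then show ?case using process_events_space by simp
next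
  case (insert v S)
  have "{\<omega>\<in>space M. \<forall>u\<in>insert v S. r u \<omega> = \<sigma> u} =
      (r v -` {\<sigma> v} \<inter> space M) \<inter> {\<omega>\<in>space M. \<forall>u\<in>S. r u \<omega> = \<sigma> u}" by auto
  also have "\<dots> \<in> mode_events {t0..}"
    using insert by (intro process_events_Int process_events_vimage r_measurable) auto
  finally show ?case .
qed

lemma past_gen_sub: "past_gen t \<subseteq> events"
proof -
  have "A \<inter> {\<omega>\<in>space M. \<forall>u\<in>S. r u \<omega> = \<sigma> u} \<in> events"
    if "A \<in> noise_events {0..}" "finite S" "S \<subseteq> {t0..t}" for A S \<sigma>
  proof -
    have "{\<omega>\<in>space M. \<forall>u\<in>S. r u \<omega> = \<sigma> u} \<in> mode_events {t0..}"
      using that by (intro cylinder_mode) auto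
    then show ?thesis using that(1) noise_events_sub[of "{0..}"] mode_events_sub[of "{t0..}"] by blast
  qed
  then show ?thesis by (auto simp: past_gen_def)
qed

lemma Int_stable_past_gen: "Int_stable (past_gen t)"
proof (rule Int_stableI)
  fix a b assume a: "a \<in> past_gen t" and b: "b \<in> past_gen t"
  then have ab: "a \<in> events" "b \<in> events" using past_gen_sub by auto
  show "a \<inter> b \<in> past_gen t"
  proof (cases "a \<in> null_sets M \<or> b \<in> null_sets M")
    case True
    then have "a \<inter> b \<in> null_sets M"
      using ab null_set_Int1 null_set_Int2 by blast
    then show ?thesis by (simp add: past_gen_def)
  next
    case False
    then obtain A S \<sigma> A' S' \<sigma>' where
        a: "a = A \<inter> {\<omega>\<in>space M. \<forall>u\<in>S. r u \<omega> = \<sigma> u}" "A \<in> noise_events {0..}" "finite S" "S \<subseteq> {t0..t}"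
      and b: "b = A' \<inter> {\<omega>\<in>space M. \<forall>u\<in>S'. r u \<omega> = \<sigma>' u}" "A' \<in> noise_events {0..}" "finite S'" "S' \<subseteq> {t0..t}"
      using a b by (auto simp: past_gen_def)
    show ?thesis
    \<comment> \<open>Compatible cylinders combine by merging the prescribed states. Cylinders that
      disagree at a common time are disjoint, and the empty set belongs to the generator as a null
      set.\<close>
    proof (cases "\<forall>u\<in>S\<inter>S'. \<sigma> u = \<sigma>' u")
      case True
      let ?\<tau> = "\<lambda>u. if u \<in> S then \<sigma> u else \<sigma>' u"
      have "a \<inter> b = (A \<inter> A') \<inter> {\<omega>\<in>space M. \<forall>u\<in>S \<union> S'. r u \<omega> = ?\<tau> u}"
        unfolding a(1) b(1) using True by (auto split: if_splits)
      then show ?thesis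
        unfolding past_gen_def using a b process_events_Int[OF a(2) b(2)]
        by (intro UnI1 CollectI exI[of _ "A \<inter> A'"] exI[of _ "S \<union> S'"] exI[of _ ?\<tau>]) auto
    next
      case False
      then have "a \<inter> b = {}" unfolding a(1) b(1) by force
      then show ?thesis by (simp add: past_gen_def)
    qed
  qed
qed

lemma history_past: "subalgebra (sigma (space M) (past_gen t)) (history M t0 w r t)"
proof -
  have P: "past_gen t \<subseteq> Pow (space M)" using past_gen_sub sets.space_closed[of M] by (rule subset_trans)
  show ?thesis
  proof (rule history_gen_sub)
    fix u and B :: "(real^'p) set" assume u: "0 \<le> u" "u \<le> t" and B: "B \<in> sets borel"
    have "w u -` B \<inter> space M = (w u -` B \<inter> space M) \<inter> {\<omega>\<in>space M. \<forall>v\<in>{}. r v \<omega> = undefined}" by auto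
    moreover have "w u -` B \<inter> space M \<in> noise_events {0..}"
      using u B w_measurable by (intro process_events_vimage) auto
    ultimately have "w u -` B \<inter> space M \<in> past_gen t"
      unfolding past_gen_def by (intro UnI1 CollectI exI[of _ "w u -` B \<inter> space M"] exI[of _ "{}"] exI) auto
    then show "w u -` B \<inter> space M \<in> sets (sigma (space M) (past_gen t))" using P by simp
  next
    fix u i assume u: "t0 \<le> u" "u \<le> t"
    have "r u -` {i} \<inter> space M = space M \<inter> {\<omega>\<in>space M. \<forall>v\<in>{u}. r v \<omega> = i}" by auto
    then have "r u -` {i} \<inter> space M \<in> past_gen t"
      unfolding past_gen_def using u process_events_space
      by (intro UnI1 CollectI exI[of _ "space M"] exI[of _ "{u}"] exI[of _ "\<lambda>_. i"]) auto
    then show "r u -` {i} \<inter> space M \<in> sets (sigma (space M) (past_gen t))" using P by simp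
  qed (use P in \<open>auto simp: past_gen_def\<close>)
qed

text \<open>The Markov clause and the transition function, freed from division: in product form the
  identity also covers conditioning events of probability zero.\<close>

lemma prob_cylinder_step:
  assumes t: "t0 \<le> t" "0 < h" and S: "finite S" "S \<subseteq> {t0..t}"
  shows "\<P>(\<omega> in M. r (t + h) \<omega> = j \<and> r t \<omega> = i \<and> (\<forall>u\<in>S. r u \<omega> = \<sigma> u)) =
    p i j h * \<P>(\<omega> in M. r t \<omega> = i \<and> (\<forall>u\<in>S. r u \<omega> = \<sigma> u))"
proof (cases "\<P>(\<omega> in M. r t \<omega> = i \<and> (\<forall>u\<in>S. r u \<omega> = \<sigma> u)) = 0")
  \<comment> \<open>Here both sides vanish by monotonicity; no conditional probability is
    evaluated.\<close>
  case True
  have cyl: "{\<omega>\<in>space M. r t \<omega> = i \<and> (\<forall>u\<in>S. r u \<omega> = \<sigma> u)} \<in> events"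
  proof -
    have "{\<omega>\<in>space M. r t \<omega> = i \<and> (\<forall>u\<in>S. r u \<omega> = \<sigma> u)} =
       (r t -` {i} \<inter> space M) \<inter> {\<omega>\<in>space M. (\<forall>u\<in>S. r u \<omega> = \<sigma> u)}" by auto
    also have "\<dots> \<in> mode_events {t0..}"
      using t S by (intro process_events_Int process_events_vimage cylinder_mode r_measurable) auto
    finally show ?thesis using mode_events_sub[of "{t0..}"] by auto
  qed
  have "\<P>(\<omega> in M. r (t + h) \<omega> = j \<and> r t \<omega> = i \<and> (\<forall>u\<in>S. r u \<omega> = \<sigma> u)) \<le>
      \<P>(\<omega> in M. r t \<omega> = i \<and> (\<forall>u\<in>S. r u \<omega> = \<sigma> u))"
    using cyl by (intro finite_measure_mono) auto
  then show ?thesis using True by (simp add: measure_le_0_iff)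
next
  case False
  define S' where "S' = S - {t}"
  have eq: "r t \<omega> = i \<and> (\<forall>u\<in>S. r u \<omega> = \<sigma> u) \<longleftrightarrow> r t \<omega> = i \<and> (\<forall>u\<in>S'. r u \<omega> = \<sigma> u)" for \<omega>
  proof (cases "t \<in> S \<and> \<sigma> t \<noteq> i")
    case True
    then have "{\<omega>\<in>space M. r t \<omega> = i \<and> (\<forall>u\<in>S. r u \<omega> = \<sigma> u)} = {}"
      by (auto intro: bexI[of _ t])
    then have "\<P>(\<omega> in M. r t \<omega> = i \<and> (\<forall>u\<in>S. r u \<omega> = \<sigma> u)) = 0"
      by (simp only: measure_empty)
    then show ?thesis using False by contradiction
  qed (auto simp: S'_def)
  have pos: "\<P>(\<omega> in M. r t \<omega> = i \<and> (\<forall>u\<in>S'. r u \<omega> = \<sigma> u)) > 0"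
    using False unfolding eq by (simp add: zero_less_measure_iff)
  have "{\<omega>\<in>space M. r t \<omega> = i} \<in> events"
    using measurable_sets[OF r_measurable[OF t(1)], of "{i}"] by (simp add: vimage_def Int_def conj_commute)
  then have "\<P>(\<omega> in M. r t \<omega> = i \<and> (\<forall>u\<in>S'. r u \<omega> = \<sigma> u)) \<le> \<P>(\<omega> in M. r t \<omega> = i)"
    by (intro finite_measure_mono) auto
  with pos have "\<P>(\<omega> in M. r t \<omega> = i) > 0" by linarith
  moreover have "S' \<subseteq> {t0..<t}" using S by (force simp: S'_def)
  ultimately have "\<P>(\<omega> in M. r (t + h) \<omega> = j \<bar> r t \<omega> = i \<and> (\<forall>u\<in>S'. r u \<omega> = \<sigma> u)) = p i j h"
    using markov[of t "t + h" S' i \<sigma> j] transition[of t h i j] t S pos by (simp add: S'_def)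
  then show ?thesis
    using pos unfolding eq cond_prob_def by (simp add: field_simps)
qed

text \<open>Given the past with the full noise path, the event that the mode is \<open>i\<close> at
  \<open>t\<close> and \<open>j\<close> at \<open>t + h\<close> has conditional probability
  \<open>p i j h\<close> times the indicator of mode \<open>i\<close> at \<open>t\<close>. On a
  generating set \<open>A \<inter> C\<close> the noise event \<open>A\<close> factors out by
  independence, and the cylinder \<open>C\<close> is handled by
  \<open>prob_cylinder_step\<close>.\<close>

lemma transition_integral:
  fixes f :: "'a \<Rightarrow> real"
  assumes t: "t0 \<le> t" "0 < h"
    and f: "f \<in> borel_measurable (history M t0 w r t)" "integrable M f"
  shows "(LINT \<omega>|M. f \<omega> * (indicator {i} (r t \<omega>) * indicator {j} (r (t + h) \<omega>))) =
    p i j h * (LINT \<omega>|M. f \<omega> * indicator {i} (r t \<omega>))"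
proof -
  let ?F = "sigma (space M) (past_gen t)"
  have P: "past_gen t \<subseteq> Pow (space M)" using past_gen_sub sets.space_closed[of M] by (rule subset_trans)
  have F: "subalgebra M ?F"
    using sets.sigma_sets_subset[OF past_gen_sub] P by (simp add: subalgebra_def sets_measure_of space_measure_of)
  interpret finite_measure_subalgebra M ?F
    by standard (rule F)
  have fF: "f \<in> borel_measurable ?F"
    by (rule measurable_from_subalg[OF history_past f(1)])
  have fM: "f \<in> borel_measurable M"
    by (rule measurable_from_subalg[OF F fF])
  have [measurable]: "r t \<in> measurable M (count_space UNIV)" "r (t + h) \<in> measurable M (count_space UNIV)"
    using t by (auto intro: r_measurable)
  have rF: "(\<lambda>\<omega>. indicator {i} (r t \<omega>) :: real) \<in> borel_measurable ?F"
  proof -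
    have "r t -` {i} \<inter> space M = space M \<inter> {\<omega>\<in>space M. \<forall>v\<in>{t}. r v \<omega> = i}" by auto
    then have "r t -` {i} \<inter> space M \<in> past_gen t"
      unfolding past_gen_def using t process_events_space
      by (intro UnI1 CollectI exI[of _ "space M"] exI[of _ "{t}"] exI[of _ "\<lambda>_. i"]) auto
    then have "r t -` {i} \<inter> space M \<in> sets ?F" using P by simp
    then have "(indicator (r t -` {i} \<inter> space M) :: 'a \<Rightarrow> real) \<in> borel_measurable ?F"
      by (rule borel_measurable_indicator)
    then show ?thesis
      by (rule measurable_cong[THEN iffD1, rotated]) (use P in \<open>auto simp: indicator_def space_measure_of\<close>)
  qed
  let ?a = "\<lambda>\<omega>. indicator {i} (r t \<omega>) * indicator {j} (r (t + h) \<omega>) :: real"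
  let ?b = "\<lambda>\<omega>. p i j h * indicator {i} (r t \<omega>)"
  have ia: "integrable M ?a" 
    by (rule integrable_const_bound[where B=1]) (auto simp: indicator_def)
  have ib: "integrable M ?b"
    by (rule integrable_const_bound[where B="\<bar>p i j h\<bar>"]) (auto simp: indicator_def)
  have gen: "(LINT \<omega>:E|M. ?a \<omega>) = (LINT \<omega>:E|M. ?b \<omega>)" if E: "E \<in> past_gen t" for E
  proof (cases "E \<in> null_sets M")
    case True
    have "AE \<omega> in M. \<omega> \<notin> E" using True by (rule AE_not_in)
    then have "AE \<omega> in M. indicator E \<omega> *\<^sub>R ?a \<omega> = indicator E \<omega> *\<^sub>R ?b \<omega>" by eventually_elim simp
    moreover have "E \<in> events" using True by auto
    ultimately show ?thesis
      unfolding set_lebesgue_integral_def by (intro integral_cong_AE) auto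
  next
    case False
    then obtain A S \<sigma> where E: "E = A \<inter> {\<omega>\<in>space M. \<forall>u\<in>S. r u \<omega> = \<sigma> u}" "A \<in> noise_events {0..}"
        and S: "finite S" "S \<subseteq> {t0..t}"
      using E by (auto simp: past_gen_def)
    let ?C = "{\<omega>\<in>space M. r t \<omega> = i \<and> (\<forall>u\<in>S. r u \<omega> = \<sigma> u)}"
    let ?D = "{\<omega>\<in>space M. r (t + h) \<omega> = j \<and> r t \<omega> = i \<and> (\<forall>u\<in>S. r u \<omega> = \<sigma> u)}"
    have "?C = (r t -` {i} \<inter> space M) \<inter> {\<omega>\<in>space M. (\<forall>u\<in>S. r u \<omega> = \<sigma> u)}" by auto
    also have "\<dots> \<in> mode_events {t0..}"
      using t S by (intro process_events_Int process_events_vimage cylinder_mode r_measurable) auto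
    finally have C: "?C \<in> mode_events {t0..}" .
    have "?D = (r (t + h) -` {j} \<inter> space M) \<inter> ?C" by auto
    also have "\<dots> \<in> mode_events {t0..}"
      using t C by (intro process_events_Int process_events_vimage r_measurable) auto
    finally have D: "?D \<in> mode_events {t0..}" .
    have ev: "A \<inter> ?C \<in> events" "A \<inter> ?D \<in> events"
      using E(2) C D noise_events_sub[of "{0..}"] mode_events_sub[of "{t0..}"] by blast+
    have "(LINT \<omega>:E|M. ?a \<omega>) = (LINT \<omega>|M. indicator (A \<inter> ?D) \<omega>)"
      unfolding set_lebesgue_integral_def E(1)
      by (intro Bochner_Integration.integral_cong) (auto simp: indicator_def)
    also have "\<dots> = prob (A \<inter> ?D)" using ev by simp
    also have "\<dots> = prob A * (p i j h * prob ?C)"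
      using prob_noise_mode[OF E(2) D] prob_cylinder_step[OF t S] by simp
    also have "\<dots> = p i j h * prob (A \<inter> ?C)"
      using prob_noise_mode[OF E(2) C] by simp
    also have "\<dots> = (LINT \<omega>|M. p i j h * indicator (A \<inter> ?C) \<omega>)" using ev by simp
    also have "\<dots> = (LINT \<omega>:E|M. ?b \<omega>)"
      unfolding set_lebesgue_integral_def E(1)
      by (intro Bochner_Integration.integral_cong) (auto simp: indicator_def)
    finally show ?thesis .
  qed
  \<comment> \<open>Testing on the whole space yields equality of the total integrals, which the
    Dynkin argument needs for complements.\<close>
  have sp: "space M \<in> past_gen t"
    unfolding past_gen_def using process_events_space
    by (intro UnI1 CollectI exI[of _ "space M"] exI[of _ "{}"] exI) auto
  have "integral\<^sup>L M ?a = integral\<^sup>L M ?b"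
    using gen[OF sp] by (simp only: set_integral_space[OF ia] set_integral_space[OF ib])
  then have "AE \<omega> in M. real_cond_exp M ?F ?a \<omega> = ?b \<omega>"
    using set_integral_eq_sigma_sets[OF past_gen_sub Int_stable_past_gen ia ib _ gen] P rF
    by (intro real_cond_exp_charact ia ib) auto
  note ae = this
  have int: "integrable M (\<lambda>\<omega>. f \<omega> * ?a \<omega>)"
    by (rule Bochner_Integration.integrable_bound[OF f(2)]) (use fM in \<open>auto simp: indicator_def\<close>)
  have "(LINT \<omega>|M. f \<omega> * ?a \<omega>) = (LINT \<omega>|M. f \<omega> * real_cond_exp M ?F ?a \<omega>)"
    by (rule real_cond_exp_intg(2)[symmetric, OF int fF]) measurable
  also have "\<dots> = (LINT \<omega>|M. f \<omega> * ?b \<omega>)"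
    using fM ae by (intro integral_cong_AE) auto
  also have "\<dots> = (LINT \<omega>|M. p i j h * (f \<omega> * indicator {i} (r t \<omega>)))"
    by (intro Bochner_Integration.integral_cong) auto
  finally show ?thesis by simp
qed

end

section \<open>The Ito isometry\<close>

definition sq_integrable :: "'a measure \<Rightarrow> ('a \<Rightarrow> real) \<Rightarrow> bool" where
  "sq_integrable M f \<longleftrightarrow> f \<in> borel_measurable M \<and> integrable M (\<lambda>x. (f x)\<^sup>2)"

lemma sq_integrable_mult:
  assumes "sq_integrable M f" "sq_integrable M g"
  shows "integrable M (\<lambda>x. f x * g x)"
proof (rule Bochner_Integration.integrable_bound)
  show "integrable M (\<lambda>x. (f x)\<^sup>2 + (g x)\<^sup>2)"
    using assms by (simp add: sq_integrable_def)
  have "\<bar>f x * g x\<bar> \<le> (f x)\<^sup>2 + (g x)\<^sup>2" for x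
  proof -
    have "0 \<le> (\<bar>f x\<bar> - \<bar>g x\<bar>)\<^sup>2" by simp
    then have "2 * (\<bar>f x\<bar> * \<bar>g x\<bar>) \<le> (f x)\<^sup>2 + (g x)\<^sup>2" by (simp add: power2_diff)
    moreover have "0 \<le> \<bar>f x\<bar> * \<bar>g x\<bar>" by simp
    ultimately show ?thesis unfolding abs_mult by linarith
  qed
  then show "AE x in M. norm (f x * g x) \<le> norm ((f x)\<^sup>2 + (g x)\<^sup>2)" by simp
qed (use assms in \<open>auto simp: sq_integrable_def\<close>)

lemma sq_integrable_add:
  assumes "sq_integrable M f" "sq_integrable M g"
  shows "sq_integrable M (\<lambda>x. f x + g x)"
proof -
  have "(f x + g x)\<^sup>2 = (f x)\<^sup>2 + (g x)\<^sup>2 + 2 * (f x * g x)" for x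
    by (simp add: power2_sum)
  then show ?thesis
    using assms sq_integrable_mult[OF assms] by (auto simp: sq_integrable_def)
qed

lemma sq_integrable_cmult: "sq_integrable M f \<Longrightarrow> sq_integrable M (\<lambda>x. c * f x)"
  by (auto simp: sq_integrable_def power_mult_distrib)

lemma sq_integrable_0: "sq_integrable M (\<lambda>_. 0)"
  by (simp add: sq_integrable_def)

lemma sq_integrable_sum:
  "(\<And>i. i \<in> I \<Longrightarrow> sq_integrable M (f i)) \<Longrightarrow> sq_integrable M (\<lambda>x. \<Sum>i\<in>I. f i x)"
  by (induction I rule: infinite_finite_induct) (auto simp: sq_integrable_0 intro: sq_integrable_add)

lemma sq_integrable_bound:
  assumes "sq_integrable M g" "f \<in> borel_measurable M" "\<And>x. x \<in> space M \<Longrightarrow> \<bar>f x\<bar> \<le> \<bar>g x\<bar>"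
  shows "sq_integrable M f"
  unfolding sq_integrable_def
proof
  show "integrable M (\<lambda>x. (f x)\<^sup>2)"
    by (rule Bochner_Integration.integrable_bound[of M "\<lambda>x. (g x)\<^sup>2"])
      (use assms in \<open>auto simp: sq_integrable_def abs_le_square_iff\<close>)
qed (rule assms(2))

lemma sq_integrable_bdd_mult:
  assumes "sq_integrable M g" "f \<in> borel_measurable M" "\<And>x. x \<in> space M \<Longrightarrow> \<bar>f x\<bar> \<le> B"
  shows "sq_integrable M (\<lambda>x. f x * g x)"
proof (rule sq_integrable_bound[OF sq_integrable_cmult[OF assms(1), of B]])
  show "\<bar>f x * g x\<bar> \<le> \<bar>B * g x\<bar>" if "x \<in> space M" for x
    using assms(3)[OF that] by (simp add: abs_mult mult_right_mono)
qed (use assms in \<open>auto simp: sq_integrable_def\<close>)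

lemma (in prob_space) sq_integrable_bdd:
  assumes "f \<in> borel_measurable M" "\<And>x. x \<in> space M \<Longrightarrow> \<bar>f x\<bar> \<le> B"
  shows "sq_integrable M f"
  using sq_integrable_bdd_mult[of M "\<lambda>_. 1", OF _ assms] by (simp add: sq_integrable_def)

lemma sq_integrable_nn:
  assumes "f \<in> borel_measurable M" "(\<integral>\<^sup>+x. ennreal ((f x)\<^sup>2) \<partial>M) < \<infinity>"
  shows "sq_integrable M f"
  using assms unfolding sq_integrable_def by (auto intro!: integrableI_bounded simp: top.not_eq_extremum)

text \<open>Young's inequality with a free weight, from the square of
  \<open>e * \<bar>f\<bar> - \<bar>g\<bar>\<close>; it does the work of Cauchy-Schwarz without
  square roots.\<close>

lemma abs_integral_mult_le:
  assumes f: "sq_integrable M f" and g: "sq_integrable M g" and e: "0 < e"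
  shows "\<bar>LINT x|M. f x * g x\<bar> \<le> e * (LINT x|M. (f x)\<^sup>2) + (LINT x|M. (g x)\<^sup>2) / e"
proof -
  have pt: "\<bar>f x * g x\<bar> \<le> e * (f x)\<^sup>2 + (g x)\<^sup>2 / e" for x
  proof -
    have "0 \<le> (e * \<bar>f x\<bar> - \<bar>g x\<bar>)\<^sup>2 / e" using e by simp
    also have "\<dots> = e * (f x)\<^sup>2 + (g x)\<^sup>2 / e - 2 * \<bar>f x * g x\<bar>"
      using e by (simp add: power2_diff abs_mult field_simps power2_eq_square)
    finally show ?thesis by linarith
  qed
  have "\<bar>LINT x|M. f x * g x\<bar> \<le> (LINT x|M. \<bar>f x * g x\<bar>)"
    by (rule integral_abs_bound)
  also have "\<dots> \<le> (LINT x|M. e * (f x)\<^sup>2 + (g x)\<^sup>2 / e)"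
    using f g sq_integrable_mult[OF f g] by (intro integral_mono pt) (auto simp: sq_integrable_def)
  also have "\<dots> = e * (LINT x|M. (f x)\<^sup>2) + (LINT x|M. (g x)\<^sup>2) / e"
    using f g by (simp add: sq_integrable_def)
  finally show ?thesis .
qed

text \<open>Convergence in mean square implies weak convergence. This carries orthogonality from
  simple integrals over to the Ito integral.\<close>

lemma tendsto_integral_mult_0:
  assumes f: "sq_integrable M f" and g: "\<And>k. g k \<in> borel_measurable M"
    and lim: "(\<lambda>k. \<integral>\<^sup>+x. ennreal ((g k x)\<^sup>2) \<partial>M) \<longlonglongrightarrow> 0"
  shows "(\<lambda>k. LINT x|M. f x * g k x) \<longlonglongrightarrow> 0"
proof (rule LIMSEQ_I)
  fix \<epsilon> :: real assume eps: "0 < \<epsilon>"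
  define F where "F = (LINT x|M. (f x)\<^sup>2)"
  have F: "0 \<le> F" by (simp add: F_def)
  \<comment> \<open>The weight makes the first term of Young's inequality smaller than
    \<open>\<epsilon> / 2\<close>; \<open>F + 1\<close> instead of \<open>F\<close> avoids a
    division by zero when \<open>f\<close> vanishes almost everywhere.\<close>
  define e where "e = \<epsilon> / (2 * (F + 1))"
  have F1: "0 < F + 1" using F by linarith
  have e: "0 < e" unfolding e_def using eps F1 by (intro divide_pos_pos mult_pos_pos) simp_all
  have eF: "e * F < \<epsilon> / 2"
  proof -
    have "e * F < e * (F + 1)" using e by simp
    also have "\<dots> = \<epsilon> / 2" using F by (simp add: e_def field_simps)
    finally show ?thesis .
  qed
  have "0 < ennreal (e * \<epsilon> / 2)" using e eps by simp
  from order_tendstoD(2)[OF lim this] obtain N where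
    N: "\<And>k. k \<ge> N \<Longrightarrow> (\<integral>\<^sup>+x. ennreal ((g k x)\<^sup>2) \<partial>M) < ennreal (e * \<epsilon> / 2)"
    by (auto simp: eventually_sequentially)
  show "\<exists>N. \<forall>k\<ge>N. norm ((LINT x|M. f x * g k x) - 0) < \<epsilon>"
  proof (intro exI[of _ N] allI impI)
    fix k assume "N \<le> k"
    note Nk = N[OF this]
    \<comment> \<open>Square integrability of \<open>g k\<close> is available only from the index
      \<open>N\<close> on, where the nonnegative integral is known to be finite.\<close>
    have G: "sq_integrable M (g k)"
      using Nk by (intro sq_integrable_nn g) (metis ennreal_less_top infinity_ennreal_def less_trans)
    have "ennreal (LINT x|M. (g k x)\<^sup>2) < ennreal (e * \<epsilon> / 2)"
      using Nk G by (subst (asm) nn_integral_eq_integral) (auto simp: sq_integrable_def)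
    then have "(LINT x|M. (g k x)\<^sup>2) < e * \<epsilon> / 2"
      by (simp add: ennreal_less_iff)
    then have "(LINT x|M. (g k x)\<^sup>2) / e < \<epsilon> / 2"
      using e by (simp add: field_simps)
    then show "norm ((LINT x|M. f x * g k x) - 0) < \<epsilon>"
      using abs_integral_mult_le[OF f G e] eF
      unfolding F_def real_norm_def diff_0_right by linarith
  qed
qed

section \<open>Wiener increments against factors from the enlarged past\<close>

context markov_noise begin

lemma sq_integrable_w: "0 \<le> a \<Longrightarrow> a \<le> b \<Longrightarrow> sq_integrable M (\<lambda>\<omega>. (w b \<omega> - w a \<omega>) $ i)"
proof (cases "a = b")
  case False
  moreover assume "0 \<le> a" "a \<le> b"
  ultimately show ?thesis
    using wiener_increment_mult_integrable[OF wiener, of a b i i]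
      wiener_increment_integrable[OF wiener, of a b i]
    by (auto simp: sq_integrable_def power2_eq_square)
qed (simp add: sq_integrable_0)

text \<open>\<open>F\<close> may involve the chain at times after \<open>a\<close>: being measurable
  for the enlarged past is enough for independence of the increment, which has mean zero.\<close>

lemma increment_orthogonal:
  assumes ab: "0 \<le> a" "a \<le> b" and F: "sq_integrable M F" "F \<in> borel_measurable (enlarged a)"
  shows "(LINT \<omega>|M. F \<omega> * (w b \<omega> - w a \<omega>) $ i) = 0"
proof (cases "a = b")
  case False
  then have ab': "a < b" using ab by simp
  have "(LINT \<omega>|M. F \<omega> * (w b \<omega> - w a \<omega>) $ i) = (LINT \<omega>|M. F \<omega>) * (LINT \<omega>|M. (w b \<omega> - w a \<omega>) $ i)"
    using sq_integrable_mult[OF F(1) sq_integrable_w[OF ab]]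
    by (intro increment_integral[OF ab(1) ab', of "\<lambda>v. v $ i"] wiener_increment_integrable[OF wiener] ab' ab F) auto
  then show ?thesis
    using wiener_increment_mean[OF wiener ab(1) ab', of i] by simp
qed simp

lemma increment_isometry_diag:
  assumes ab: "0 \<le> a" "a \<le> b" and H: "H \<in> borel_measurable (enlarged a)" "\<And>\<omega>. \<omega> \<in> space M \<Longrightarrow> \<bar>H \<omega>\<bar> \<le> B"
  shows "(LINT \<omega>|M. H \<omega> * ((w b \<omega> - w a \<omega>) $ i * (w b \<omega> - w a \<omega>) $ j)) =
    (LINT \<omega>|M. H \<omega>) * (if i = j then b - a else 0)"
proof (cases "a = b")
  case False
  then have ab': "a < b" using ab by simp
  have HM: "H \<in> borel_measurable M" by (rule measurable_from_subalg[OF subalgebra_enlarged H(1)])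
  have "integrable M (\<lambda>\<omega>. H \<omega> * (w b \<omega> - w a \<omega>) $ i * (w b \<omega> - w a \<omega>) $ j)"
    by (intro sq_integrable_mult sq_integrable_bdd_mult[OF _ HM H(2)] sq_integrable_w ab)
  then have "(LINT \<omega>|M. H \<omega> * ((w b \<omega> - w a \<omega>) $ i * (w b \<omega> - w a \<omega>) $ j)) =
      (LINT \<omega>|M. H \<omega>) * (LINT \<omega>|M. (w b \<omega> - w a \<omega>) $ i * (w b \<omega> - w a \<omega>) $ j)"
    by (intro increment_integral[OF ab(1) ab', of "\<lambda>v. v $ i * v $ j"]
      wiener_increment_mult_integrable[OF wiener] ab' ab H) (auto simp: mult.assoc)
  then show ?thesis
    using wiener_increment_covariance[OF wiener ab(1) ab', of i j] by simp
qed simp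

text \<open>Cutting both intervals at \<open>c\<close> and at the smaller right endpoint leaves one
  common piece. All products of increments over disjoint pieces vanish, because the earlier one
  belongs to the enlarged past of the later one.\<close>

lemma increment_isometry_ordered:
  assumes ab: "0 \<le> a" "a \<le> b" and cd: "a \<le> c" "c \<le> d"
    and f: "f \<in> borel_measurable (enlarged a)" "\<And>\<omega>. \<omega> \<in> space M \<Longrightarrow> \<bar>f \<omega>\<bar> \<le> Bf"
    and g: "g \<in> borel_measurable (enlarged c)" "\<And>\<omega>. \<omega> \<in> space M \<Longrightarrow> \<bar>g \<omega>\<bar> \<le> Bg"
  shows "(LINT \<omega>|M. (f \<omega> * (w b \<omega> - w a \<omega>) $ i) * (g \<omega> * (w d \<omega> - w c \<omega>) $ j)) =
    (LINT \<omega>|M. f \<omega> * g \<omega>) * (if i = j then measure lborel ({a..<b} \<inter> {c..<d}) else 0)"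
proof -
  have sub: "h \<in> borel_measurable M" if "h \<in> borel_measurable (enlarged u)" for h :: "'a \<Rightarrow> real" and u
    by (rule measurable_from_subalg[OF subalgebra_enlarged that])
  have up: "h \<in> borel_measurable (enlarged v)" if "h \<in> borel_measurable (enlarged u)" "u \<le> v"
    for h :: "'a \<Rightarrow> real" and u v
    by (rule measurable_from_subalg[OF enlarged_mono that(1)]) (rule that(2))
  have wc: "(\<lambda>\<omega>. (w v \<omega> - w u \<omega>) $ k) \<in> borel_measurable (enlarged s)" if "0 \<le> u" "u \<le> s" "0 \<le> v" "v \<le> s" for u v s k
    using w_enlarged[of u s] w_enlarged[of v s] that
    by (intro measurable_compose[where g="\<lambda>v. v $ k", OF borel_measurable_diff]) auto
  have sq: "sq_integrable M (\<lambda>\<omega>. h \<omega> * (w v \<omega> - w u \<omega>) $ k)"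
    if "h \<in> borel_measurable M" "\<And>\<omega>. \<omega> \<in> space M \<Longrightarrow> \<bar>h \<omega>\<bar> \<le> B" "0 \<le> u" "u \<le> v" for h B u v k
    by (intro sq_integrable_bdd_mult[OF _ that(1,2)] sq_integrable_w that(3,4))
  have fg: "(\<lambda>\<omega>. f \<omega> * g \<omega>) \<in> borel_measurable (enlarged c)"
    "\<And>\<omega>. \<omega> \<in> space M \<Longrightarrow> \<bar>f \<omega> * g \<omega>\<bar> \<le> Bf * Bg"
    using up[OF f(1) cd(1)] g f(2) by (auto simp: abs_mult intro!: mult_mono)
      (meson abs_ge_zero order_trans)
  \<comment> \<open>The factor \<open>g\<close> is known only at time \<open>c\<close>, but it can
    be absorbed with \<open>f\<close> and the earlier increment into one factor from the enlarged
    past at \<open>c\<close>.\<close>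
  have disj: "(LINT \<omega>|M. (f \<omega> * (w u \<omega> - w a \<omega>) $ i) * (g \<omega> * (w d \<omega> - w c \<omega>) $ j)) = 0" if "a \<le> u" "u \<le> c" for u
  proof -
    have "sq_integrable M (\<lambda>\<omega>. (f \<omega> * g \<omega>) * (w u \<omega> - w a \<omega>) $ i)"
      using sub[OF fg(1)] fg(2) ab that by (intro sq) auto
    moreover have "(\<lambda>\<omega>. (f \<omega> * g \<omega>) * (w u \<omega> - w a \<omega>) $ i) \<in> borel_measurable (enlarged c)"
      using ab that cd by (intro borel_measurable_times[OF fg(1)] wc) auto
    ultimately have "(LINT \<omega>|M. (f \<omega> * g \<omega>) * (w u \<omega> - w a \<omega>) $ i * (w d \<omega> - w c \<omega>) $ j) = 0"
      using ab cd by (intro increment_orthogonal) auto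
    then show ?thesis by (simp add: ac_simps)
  qed
  show ?thesis
  proof (cases "b \<le> c")
    case True
    then have empty: "{a..<b} \<inter> {c..<d} = {}" by auto
    show ?thesis unfolding empty using disj[OF ab(2) True] by (simp only: measure_empty if_cancel mult_zero_right)
  next
    case False
    then have cb: "c \<le> b" by simp
    define m where "m = min b d"
    have m: "c \<le> m" "m \<le> b" "m \<le> d" using cb cd by (auto simp: m_def)
    have "{a..<b} \<inter> {c..<d} = {c..<m}" using cd by (auto simp: m_def)
    then have len: "measure lborel ({a..<b} \<inter> {c..<d}) = m - c" using m by simp
    let ?D = "\<lambda>u v k \<omega>. (w v \<omega> - w u \<omega>) $ k"
    let ?h = "\<lambda>\<omega>. f \<omega> * g \<omega>"
    have hM: "?h \<in> borel_measurable M" by (rule sub[OF fg(1)])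
    have c0: "0 \<le> c" using ab cd by simp
    have int: "integrable M (\<lambda>\<omega>. ?h \<omega> * ?D u v k \<omega> * ?D u' v' k' \<omega>)"
      if "0 \<le> u" "u \<le> v" "0 \<le> u'" "u' \<le> v'" for u v k u' v' k'
      by (intro sq_integrable_mult sq[OF hM fg(2)] sq_integrable_w that) auto
    have 0: "(LINT \<omega>|M. ?h \<omega> * ?D c m i \<omega> * ?D m d j \<omega>) = 0" "(LINT \<omega>|M. ?h \<omega> * ?D c m j \<omega> * ?D m b i \<omega>) = 0"
      by (intro increment_orthogonal sq[OF hM fg(2)] borel_measurable_times up[OF fg(1)] wc; use m c0 in simp)+
    have diag: "(LINT \<omega>|M. ?h \<omega> * ?D c m i \<omega> * ?D c m j \<omega>) = integral\<^sup>L M ?h * (if i = j then m - c else 0)"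
      using increment_isometry_diag[OF c0 m(1) fg, of i j] by (simp add: mult.assoc)
    \<comment> \<open>Since \<open>m\<close> is the minimum of \<open>b\<close> and
      \<open>d\<close>, one of the two leftover increments is over an interval of length zero. This
      removes the only product of two increments that start together at \<open>m\<close>.\<close>
    have zero: "?D m b i \<omega> * ?D m d j \<omega> = 0" for \<omega>
      using cb by (cases "b \<le> d") (auto simp: m_def)
    have "(LINT \<omega>|M. (f \<omega> * ?D a b i \<omega>) * (g \<omega> * ?D c d j \<omega>)) =
       (LINT \<omega>|M. (f \<omega> * ?D a c i \<omega>) * (g \<omega> * ?D c d j \<omega>) + ?h \<omega> * ?D c m i \<omega> * ?D c m j \<omega>
          + ?h \<omega> * ?D c m i \<omega> * ?D m d j \<omega> + ?h \<omega> * ?D c m j \<omega> * ?D m b i \<omega>)"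
    proof (intro Bochner_Integration.integral_cong refl)
      fix \<omega>
      have "(f \<omega> * ?D a b i \<omega>) * (g \<omega> * ?D c d j \<omega>) = (f \<omega> * ?D a c i \<omega>) * (g \<omega> * ?D c d j \<omega>) + ?h \<omega> * ?D c m i \<omega> * ?D c m j \<omega>
          + ?h \<omega> * ?D c m i \<omega> * ?D m d j \<omega> + ?h \<omega> * ?D c m j \<omega> * ?D m b i \<omega> + ?h \<omega> * (?D m b i \<omega> * ?D m d j \<omega>)"
        by (simp add: algebra_simps)
      then show "(f \<omega> * ?D a b i \<omega>) * (g \<omega> * ?D c d j \<omega>) = (f \<omega> * ?D a c i \<omega>) * (g \<omega> * ?D c d j \<omega>) + ?h \<omega> * ?D c m i \<omega> * ?D c m j \<omega>
          + ?h \<omega> * ?D c m i \<omega> * ?D m d j \<omega> + ?h \<omega> * ?D c m j \<omega> * ?D m b i \<omega>"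
        unfolding zero by simp
    qed
    also have "\<dots> = (LINT \<omega>|M. (f \<omega> * ?D a c i \<omega>) * (g \<omega> * ?D c d j \<omega>)) + (LINT \<omega>|M. ?h \<omega> * ?D c m i \<omega> * ?D c m j \<omega>)
          + (LINT \<omega>|M. ?h \<omega> * ?D c m i \<omega> * ?D m d j \<omega>) + (LINT \<omega>|M. ?h \<omega> * ?D c m j \<omega> * ?D m b i \<omega>)"
    proof -
      have 1: "integrable M (\<lambda>\<omega>. (f \<omega> * ?D a c i \<omega>) * (g \<omega> * ?D c d j \<omega>))"
        using ab cd by (intro sq_integrable_mult sq[OF sub[OF f(1)] f(2)] sq[OF sub[OF g(1)] g(2)]) auto
      show ?thesis
        using 1 int[of c m c m i j] int[of c m m d i j] int[of c m m b j i] c0 m by simp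
    qed
    finally show ?thesis
      unfolding len using disj[of c] cd 0 diag by simp
  qed
qed

lemma increment_isometry:
  assumes ab: "0 \<le> a" "a \<le> b" and cd: "0 \<le> c" "c \<le> d"
    and f: "f \<in> borel_measurable (enlarged a)" "\<And>\<omega>. \<omega> \<in> space M \<Longrightarrow> \<bar>f \<omega>\<bar> \<le> Bf"
    and g: "g \<in> borel_measurable (enlarged c)" "\<And>\<omega>. \<omega> \<in> space M \<Longrightarrow> \<bar>g \<omega>\<bar> \<le> Bg"
  shows "(LINT \<omega>|M. (f \<omega> * (w b \<omega> - w a \<omega>) $ i) * (g \<omega> * (w d \<omega> - w c \<omega>) $ j)) =
    (LINT \<omega>|M. f \<omega> * g \<omega>) * (if i = j then measure lborel ({a..<b} \<inter> {c..<d}) else 0)"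
proof (cases "a \<le> c")
  case True
  then show ?thesis using increment_isometry_ordered[OF ab _ cd(2) f g] by simp
next
  case False
  then show ?thesis using increment_isometry_ordered[OF cd _ ab(2) g f, of j i]
    by (auto simp: mult.commute Int_commute)
qed

end

section \<open>The isometry for finite families of intervals\<close>

context markov_noise begin

text \<open>The intervals need not be disjoint or ordered. The class is therefore closed under
  putting two families side by side, so that differences of simple processes on unrelated partitions
  belong to it. Coefficients may depend on the whole chain path.\<close>

definition elementary :: "'k set \<Rightarrow> ('k \<Rightarrow> real) \<Rightarrow> ('k \<Rightarrow> real) \<Rightarrow> ('k \<Rightarrow> 'a \<Rightarrow> real^'p^'n) \<Rightarrow> bool" where
  "elementary K a b X \<longleftrightarrow> finite K \<and> (\<forall>k\<in>K. 0 \<le> a k \<and> a k \<le> b k \<and>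
     X k \<in> borel_measurable (enlarged (a k)) \<and> bounded (X k ` space M))"

lemma elementary_component:
  fixes X :: "'k \<Rightarrow> 'a \<Rightarrow> real^'p^'n"
  assumes el: "elementary K a b X" and k: "k \<in> K"
  shows "(\<lambda>\<omega>. X k \<omega> $ n $ i) \<in> borel_measurable (enlarged (a k))"
    and "(\<lambda>\<omega>. X k \<omega> $ n $ i) \<in> borel_measurable M"
    and "\<exists>B. \<forall>\<omega>\<in>space M. \<forall>n i. \<bar>X k \<omega> $ n $ i\<bar> \<le> B"
proof -
  have X: "X k \<in> borel_measurable (enlarged (a k))" and "bounded (X k ` space M)"
    using el k by (auto simp: elementary_def)
  then obtain B where B: "\<And>\<omega>. \<omega> \<in> space M \<Longrightarrow> norm (X k \<omega>) \<le> B"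
    by (auto simp: bounded_iff)
  show 1: "(\<lambda>\<omega>. X k \<omega> $ n $ i) \<in> borel_measurable (enlarged (a k))"
    by (rule measurable_compose[OF X])
      (intro borel_measurable_continuous_onI continuous_intros)
  show "(\<lambda>\<omega>. X k \<omega> $ n $ i) \<in> borel_measurable M"
    by (rule measurable_from_subalg[OF subalgebra_enlarged 1])
  have "\<bar>X k \<omega> $ n $ i\<bar> \<le> B" if "\<omega> \<in> space M" for n i \<omega>
  proof -
    have "\<bar>X k \<omega> $ n $ i\<bar> \<le> norm (X k \<omega> $ n)" by (rule component_le_norm_cart)
    also have "\<dots> \<le> norm (X k \<omega>)" by (rule Finite_Cartesian_Product.norm_nth_le)
    finally show ?thesis using B[OF that] by simp
  qed
  then show "\<exists>B. \<forall>\<omega>\<in>space M. \<forall>n i. \<bar>X k \<omega> $ n $ i\<bar> \<le> B" by blast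
qed

text \<open>Both sides expand into the double sum over \<open>k\<close> and \<open>l\<close> of
  \<open>E[X k \<bullet> X l]\<close> times the length of the overlap of the two intervals: on the
  left by \<open>increment_isometry\<close>, on the right by integrating products of
  indicators.\<close>

lemma elementary_isometry:
  fixes X :: "'k \<Rightarrow> 'a \<Rightarrow> real^'p^'n"
  assumes el: "elementary K a b X"
  shows "(\<integral>\<^sup>+\<omega>. ennreal ((norm (\<Sum>k\<in>K. X k \<omega> *v (w (b k) \<omega> - w (a k) \<omega>)))\<^sup>2) \<partial>M) =
    (\<integral>\<^sup>+\<omega>. (\<integral>\<^sup>+s. ennreal ((norm (\<Sum>k\<in>K. indicator {a k..<b k} s *\<^sub>R X k \<omega>))\<^sup>2) \<partial>lborel) \<partial>M)"
proof -
  define L where "L k l = measure lborel ({a k..<b k} \<inter> {a l..<b l})" for k l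
  \<comment> \<open>\<open>V \<omega>\<close> is the time integral on the right for a fixed outcome;
    on the left only its expectation appears.\<close>
  define V where "V \<omega> = (\<Sum>k\<in>K. \<Sum>l\<in>K. (X k \<omega> \<bullet> X l \<omega>) * L k l)" for \<omega>
  define Y where "Y k n i \<omega> = X k \<omega> $ n $ i * (w (b k) \<omega> - w (a k) \<omega>) $ i" for k n i \<omega>
  have fin: "finite K" using el by (simp add: elementary_def)
  have K: "0 \<le> a k" "a k \<le> b k" "X k \<in> borel_measurable (enlarged (a k))" if "k \<in> K" for k
    using el that by (auto simp: elementary_def)
  note Xc = elementary_component(1)[OF el] and XcM = elementary_component(2)[OF el]
  from elementary_component(3)[OF el] obtain B where
    Bc: "\<bar>X k \<omega> $ n $ i\<bar> \<le> B k" if "k \<in> K" "\<omega> \<in> space M" for k n i \<omega>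
    by metis
  have Ysq: "sq_integrable M (Y k n i)" if "k \<in> K" for k n i
    unfolding Y_def using that K[OF that] by (intro sq_integrable_bdd_mult[OF _ XcM Bc] sq_integrable_w) auto
  have YY: "(LINT \<omega>|M. Y k n i \<omega> * Y l n j \<omega>) =
      (LINT \<omega>|M. X k \<omega> $ n $ i * X l \<omega> $ n $ j) * (if i = j then L k l else 0)" if "k \<in> K" "l \<in> K" for k l n i j
    unfolding Y_def L_def using that K(1,2)
    by (intro increment_isometry[OF _ _ _ _ Xc Bc Xc Bc]) auto
  have Xint: "integrable M (\<lambda>\<omega>. X k \<omega> $ n $ i * X l \<omega> $ n $ j)" if "k \<in> K" "l \<in> K" for k l n i j
    using that by (intro sq_integrable_mult sq_integrable_bdd[OF XcM Bc]) auto
  have Xin: "integrable M (\<lambda>\<omega>. X k \<omega> \<bullet> X l \<omega>)"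
    "(LINT \<omega>|M. X k \<omega> \<bullet> X l \<omega>) = (\<Sum>n\<in>UNIV. \<Sum>i\<in>UNIV. (LINT \<omega>|M. X k \<omega> $ n $ i * X l \<omega> $ n $ i))"
    if "k \<in> K" "l \<in> K" for k l
    unfolding inner_vec_def inner_real_def using Xint[OF that] by simp_all
  have Vint: "integrable M V" "integral\<^sup>L M V = (\<Sum>k\<in>K. \<Sum>l\<in>K. (LINT \<omega>|M. X k \<omega> \<bullet> X l \<omega>) * L k l)"
    unfolding V_def using Xin by simp_all
  have sq: "(norm (\<Sum>k\<in>K. X k \<omega> *v (w (b k) \<omega> - w (a k) \<omega>)))\<^sup>2 =
      (\<Sum>n\<in>UNIV. \<Sum>k\<in>K. \<Sum>i\<in>UNIV. \<Sum>l\<in>K. \<Sum>j\<in>UNIV. Y k n i \<omega> * Y l n j \<omega>)" for \<omega>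
  proof -
    have "(\<Sum>k\<in>K. X k \<omega> *v (w (b k) \<omega> - w (a k) \<omega>)) $ n = (\<Sum>k\<in>K. \<Sum>i\<in>UNIV. Y k n i \<omega>)" for n
      by (simp add: matrix_vector_mult_def Y_def)
    then show ?thesis
      unfolding power2_norm_eq_inner inner_vec_def inner_real_def
      by (simp add: sum_distrib_left sum_distrib_right) (simp add: mult.commute)
  qed
  have int: "integrable M (\<lambda>\<omega>. \<Sum>n\<in>UNIV. \<Sum>k\<in>K. \<Sum>i\<in>UNIV. \<Sum>l\<in>K. \<Sum>j\<in>UNIV. Y k n i \<omega> * Y l n j \<omega>)"
    by (intro Bochner_Integration.integrable_sum sq_integrable_mult Ysq)
  have "(LINT \<omega>|M. (\<Sum>n\<in>UNIV. \<Sum>k\<in>K. \<Sum>i\<in>UNIV. \<Sum>l\<in>K. \<Sum>j\<in>UNIV. Y k n i \<omega> * Y l n j \<omega>)) =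
      (\<Sum>n\<in>UNIV. \<Sum>k\<in>K. \<Sum>i\<in>UNIV. \<Sum>l\<in>K. \<Sum>j\<in>UNIV. (LINT \<omega>|M. Y k n i \<omega> * Y l n j \<omega>))"
    by (simp add: sq_integrable_mult Ysq Bochner_Integration.integrable_sum)
  also have "\<dots> = (\<Sum>n\<in>UNIV. \<Sum>k\<in>K. \<Sum>i\<in>UNIV. \<Sum>l\<in>K. (LINT \<omega>|M. X k \<omega> $ n $ i * X l \<omega> $ n $ i) * L k l)"
    by (intro sum.cong refl) (simp add: YY if_distrib[of "\<lambda>x. _ * x"] cong: if_cong)
  also have "\<dots> = (\<Sum>k\<in>K. \<Sum>n\<in>UNIV. \<Sum>l\<in>K. \<Sum>i\<in>UNIV. (LINT \<omega>|M. X k \<omega> $ n $ i * X l \<omega> $ n $ i) * L k l)"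
    by (subst sum.swap, intro sum.cong refl, rule sum.swap)
  also have "\<dots> = (\<Sum>k\<in>K. \<Sum>l\<in>K. \<Sum>n\<in>UNIV. \<Sum>i\<in>UNIV. (LINT \<omega>|M. X k \<omega> $ n $ i * X l \<omega> $ n $ i) * L k l)"
    by (intro sum.cong refl, rule sum.swap)
  also have "\<dots> = integral\<^sup>L M V"
    unfolding Vint(2) by (intro sum.cong refl) (simp add: Xin sum_distrib_right)
  finally have left: "(\<integral>\<^sup>+\<omega>. ennreal ((norm (\<Sum>k\<in>K. X k \<omega> *v (w (b k) \<omega> - w (a k) \<omega>)))\<^sup>2) \<partial>M) = ennreal (integral\<^sup>L M V)"
    using int unfolding sq[symmetric] by (subst nn_integral_eq_integral) auto
  have path: "(\<integral>\<^sup>+s. ennreal ((norm (\<Sum>k\<in>K. indicator {a k..<b k} s *\<^sub>R X k \<omega>))\<^sup>2) \<partial>lborel) = ennreal (V \<omega>)"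
    "0 \<le> V \<omega>" for \<omega>
  proof -
    let ?e = "\<lambda>s. (norm (\<Sum>k\<in>K. indicator {a k..<b k} s *\<^sub>R X k \<omega>))\<^sup>2"
    have e: "?e s = (\<Sum>k\<in>K. \<Sum>l\<in>K. (X k \<omega> \<bullet> X l \<omega>) * indicator ({a k..<b k} \<inter> {a l..<b l}) s)" for s
      unfolding power2_norm_eq_inner inner_sum_left
      unfolding inner_sum_right by (intro sum.cong refl) (auto simp: indicator_def)
    have fm: "emeasure lborel ({a k..<b k} \<inter> {a l..<b l}) < \<top>" for k l
    proof -
      have "{a k..<b k} \<inter> {a l..<b l} \<subseteq> {a k..b k}" by auto
      then have "bounded ({a k..<b k} \<inter> {a l..<b l})"
        by (rule bounded_subset[OF bounded_closed_interval])
      from emeasure_bounded_finite[OF this] show ?thesis by simp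
    qed
    have "has_bochner_integral lborel ?e (V \<omega>)"
      unfolding e V_def L_def
      by (intro has_bochner_integral_sum has_bochner_integral_mult_right has_bochner_integral_real_indicator) (auto simp: fm simp del: Int_atLeastLessThan)
    then have i: "integrable lborel ?e" and v: "integral\<^sup>L lborel ?e = V \<omega>"
      by (auto simp: has_bochner_integral_iff)
    show "0 \<le> V \<omega>" unfolding v[symmetric] by simp
    show "(\<integral>\<^sup>+s. ennreal (?e s) \<partial>lborel) = ennreal (V \<omega>)"
      using i unfolding v[symmetric] by (intro nn_integral_eq_integral) auto
  qed
  show ?thesis
    unfolding left path(1) using Vint(1) path(2) by (subst nn_integral_eq_integral) auto
qed

end

section \<open>Increments of the Ito integral\<close>

lemma power2_le_of_abs_le:
  fixes x y :: real
  assumes "\<bar>x\<bar> \<le> y" shows "x\<^sup>2 \<le> y\<^sup>2"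
  using power_mono[OF assms abs_ge_zero, of 2] by simp

lemma norm_add3_sq:
  fixes x y z :: "'b::real_normed_vector"
  shows "(norm (x + y + z))\<^sup>2 \<le> 3 * ((norm x)\<^sup>2 + (norm y)\<^sup>2 + (norm z)\<^sup>2)"
proof -
  have "(norm (x + y + z))\<^sup>2 \<le> (norm x + norm y + norm z)\<^sup>2"
    by (intro power_mono order_trans[OF norm_triangle_ineq] add_mono norm_triangle_ineq) auto
  also have "\<dots> \<le> 3 * ((norm x)\<^sup>2 + (norm y)\<^sup>2 + (norm z)\<^sup>2)"
  proof -
    have "0 \<le> (norm x - norm y)\<^sup>2 + (norm y - norm z)\<^sup>2 + (norm x - norm z)\<^sup>2" by simp
    then show ?thesis by (simp add: power2_eq_square algebra_simps)
  qed
  finally show ?thesis .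
qed

lemma ennreal_norm_add3_sq:
  fixes x y z :: "'b::real_normed_vector"
  shows "ennreal ((norm (x + y + z))\<^sup>2) \<le>
    3 * (ennreal ((norm x)\<^sup>2) + ennreal ((norm y)\<^sup>2) + ennreal ((norm z)\<^sup>2))"
proof -
  have "ennreal ((norm (x + y + z))\<^sup>2) \<le> ennreal (3 * ((norm x)\<^sup>2 + (norm y)\<^sup>2 + (norm z)\<^sup>2))"
    by (intro ennreal_leI norm_add3_sq)
  also have "\<dots> = 3 * (ennreal ((norm x)\<^sup>2) + ennreal ((norm y)\<^sup>2) + ennreal ((norm z)\<^sup>2))"
    by (subst ennreal_mult) (simp_all add: algebra_simps)
  finally show ?thesis .
qed

lemma tendsto_ennreal_three_times_sum:
  fixes a b c f :: "nat \<Rightarrow> ennreal"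
  assumes "a \<longlonglongrightarrow> A" "b \<longlonglongrightarrow> B" "c \<longlonglongrightarrow> C"
  shows "(\<lambda>k. 3 * (a k + b k + c k)) \<longlonglongrightarrow> 3 * (A + B + C)"
  by (intro ennreal_tendsto_cmult tendsto_add assms) (simp add: less_top)

lemma nn_integral_norm_add3_sq:
  fixes f g h :: "'a \<Rightarrow> 'b::euclidean_space"
  assumes [measurable]: "f \<in> borel_measurable M" "g \<in> borel_measurable M" "h \<in> borel_measurable M"
  shows "(\<integral>\<^sup>+x. ennreal ((norm (f x + g x + h x))\<^sup>2) \<partial>M) \<le>
    3 * ((\<integral>\<^sup>+x. ennreal ((norm (f x))\<^sup>2) \<partial>M) + (\<integral>\<^sup>+x. ennreal ((norm (g x))\<^sup>2) \<partial>M) +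
      (\<integral>\<^sup>+x. ennreal ((norm (h x))\<^sup>2) \<partial>M))"
proof -
  have "(\<integral>\<^sup>+x. ennreal ((norm (f x + g x + h x))\<^sup>2) \<partial>M) \<le>
      (\<integral>\<^sup>+x. 3 * (ennreal ((norm (f x))\<^sup>2) + ennreal ((norm (g x))\<^sup>2) + ennreal ((norm (h x))\<^sup>2)) \<partial>M)"
    by (intro nn_integral_mono ennreal_norm_add3_sq)
  then show ?thesis by (simp add: nn_integral_cmult nn_integral_add)
qed

lemma vec_borel_measurable:
  fixes f :: "'a \<Rightarrow> real^'n"
  assumes "\<And>l. (\<lambda>\<omega>. f \<omega> $ l) \<in> borel_measurable M"
  shows "f \<in> borel_measurable M"
proof (subst borel_measurable_euclidean_space, intro ballI)
  fix b :: "real^'n" assume "b \<in> Basis"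
  then obtain l where "b = axis l 1" by (auto simp: Basis_vec_def)
  then show "(\<lambda>\<omega>. f \<omega> \<bullet> b) \<in> borel_measurable M" using assms[of l] by (simp add: inner_axis)
qed

lemma nn_integral_path_measurable:
  assumes "(\<lambda>(\<omega>, s). f s \<omega>) \<in> borel_measurable (M \<Otimes>\<^sub>M lborel)"
  shows "(\<lambda>\<omega>. \<integral>\<^sup>+s. f s \<omega> \<partial>lborel) \<in> borel_measurable M"
  using lborel.borel_measurable_nn_integral_fst[OF assms] by simp

lemma measurable_path:
  assumes "(\<lambda>(\<omega>, s). f s \<omega>) \<in> borel_measurable (M \<Otimes>\<^sub>M lborel)" "\<omega> \<in> space M"
  shows "(\<lambda>s. f s \<omega>) \<in> borel_measurable lborel"
  using measurable_compose[OF measurable_Pair1'[OF assms(2)] assms(1)] by simp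

lemma nn_integral2_add3_sq:
  fixes f g h :: "real \<Rightarrow> 'a \<Rightarrow> 'b::euclidean_space"
  assumes f: "(\<lambda>(\<omega>, s). f s \<omega>) \<in> borel_measurable (M \<Otimes>\<^sub>M lborel)"
    and g: "(\<lambda>(\<omega>, s). g s \<omega>) \<in> borel_measurable (M \<Otimes>\<^sub>M lborel)"
    and h: "(\<lambda>(\<omega>, s). h s \<omega>) \<in> borel_measurable (M \<Otimes>\<^sub>M lborel)"
  shows "(\<integral>\<^sup>+\<omega>. (\<integral>\<^sup>+s. ennreal ((norm (f s \<omega> + g s \<omega> + h s \<omega>))\<^sup>2) \<partial>lborel) \<partial>M) \<le>
    3 * ((\<integral>\<^sup>+\<omega>. (\<integral>\<^sup>+s. ennreal ((norm (f s \<omega>))\<^sup>2) \<partial>lborel) \<partial>M) +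
      (\<integral>\<^sup>+\<omega>. (\<integral>\<^sup>+s. ennreal ((norm (g s \<omega>))\<^sup>2) \<partial>lborel) \<partial>M) +
      (\<integral>\<^sup>+\<omega>. (\<integral>\<^sup>+s. ennreal ((norm (h s \<omega>))\<^sup>2) \<partial>lborel) \<partial>M))"
proof -
  let ?I = "\<lambda>f \<omega>. \<integral>\<^sup>+s. ennreal ((norm (f s \<omega> :: 'b))\<^sup>2) \<partial>lborel"
  have m: "?I f \<in> borel_measurable M" if "(\<lambda>(\<omega>, s). f s \<omega>) \<in> borel_measurable (M \<Otimes>\<^sub>M lborel)" for f
  proof (rule nn_integral_path_measurable)
    show "(\<lambda>(\<omega>, s). ennreal ((norm (f s \<omega>))\<^sup>2)) \<in> borel_measurable (M \<Otimes>\<^sub>M lborel)"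
      using that unfolding split_beta' by measurable
  qed
  have "(\<integral>\<^sup>+\<omega>. (\<integral>\<^sup>+s. ennreal ((norm (f s \<omega> + g s \<omega> + h s \<omega>))\<^sup>2) \<partial>lborel) \<partial>M) \<le>
      (\<integral>\<^sup>+\<omega>. 3 * (?I f \<omega> + ?I g \<omega> + ?I h \<omega>) \<partial>M)"
    by (intro nn_integral_mono nn_integral_norm_add3_sq measurable_path[OF f] measurable_path[OF g] measurable_path[OF h])
  also have "\<dots> = 3 * ((\<integral>\<^sup>+\<omega>. ?I f \<omega> \<partial>M) + (\<integral>\<^sup>+\<omega>. ?I g \<omega> \<partial>M) + (\<integral>\<^sup>+\<omega>. ?I h \<omega> \<partial>M))"
    using m[OF f] m[OF g] m[OF h] by (simp add: nn_integral_cmult nn_integral_add)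
  finally show ?thesis .
qed

section \<open>Simple processes with different partitions\<close>

context markov_noise begin

definition sum_integral :: "'k set \<Rightarrow> ('k \<Rightarrow> real) \<Rightarrow> ('k \<Rightarrow> real) \<Rightarrow> ('k \<Rightarrow> 'a \<Rightarrow> real^'p^'n) \<Rightarrow> 'a \<Rightarrow> real^'n" where
  "sum_integral K a b X \<omega> = (\<Sum>k\<in>K. X k \<omega> *v (w (b k) \<omega> - w (a k) \<omega>))"

definition sum_value :: "'k set \<Rightarrow> ('k \<Rightarrow> real) \<Rightarrow> ('k \<Rightarrow> real) \<Rightarrow> ('k \<Rightarrow> 'a \<Rightarrow> real^'p^'n) \<Rightarrow> real \<Rightarrow> 'a \<Rightarrow> real^'p^'n" where
  "sum_value K a b X s \<omega> = (\<Sum>k\<in>K. indicator {a k..<b k} s *\<^sub>R X k \<omega>)"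

text \<open>The difference is again an elementary family, indexed by the disjoint sum of the index
  sets and with the second coefficients negated.\<close>

lemma elementary_isometry_diff:
  fixes X :: "'k \<Rightarrow> 'a \<Rightarrow> real^'p^'n" and X' :: "'l \<Rightarrow> 'a \<Rightarrow> real^'p^'n"
  assumes el: "elementary K a b X" and el': "elementary K' a' b' X'"
  shows "(\<integral>\<^sup>+\<omega>. ennreal ((norm (sum_integral K a b X \<omega> - sum_integral K' a' b' X' \<omega>))\<^sup>2) \<partial>M) =
    (\<integral>\<^sup>+\<omega>. (\<integral>\<^sup>+s. ennreal ((norm (sum_value K a b X s \<omega> - sum_value K' a' b' X' s \<omega>))\<^sup>2) \<partial>lborel) \<partial>M)"
proof -
  let ?a = "case_sum a a'" and ?b = "case_sum b b'" and ?X = "case_sum X (\<lambda>k \<omega>. - X' k \<omega>)"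
  have fin: "finite K" "finite K'" using el el' by (simp_all add: elementary_def)
  have "bounded ((\<lambda>\<omega>. - X' k \<omega>) ` space M)" if "k \<in> K'" for k
    using el' that by (auto simp: elementary_def bounded_iff)
  then have E: "elementary (K <+> K') ?a ?b ?X"
    using el el' unfolding elementary_def by auto
  have 1: "(\<Sum>k\<in>K <+> K'. ?X k \<omega> *v (w (?b k) \<omega> - w (?a k) \<omega>)) =
      sum_integral K a b X \<omega> - sum_integral K' a' b' X' \<omega>" for \<omega>
  proof -
    have neg: "(- A) *v v = - (A *v v)" for A :: "real^'p^'n" and v
      by (simp add: matrix_vector_mult_def vec_eq_iff sum_negf)
    show ?thesis
      using fin by (simp add: sum_integral_def sum.Plus neg sum_negf)
  qed
  have 2: "(\<Sum>k\<in>K <+> K'. indicator {?a k..<?b k} s *\<^sub>R ?X k \<omega>) =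
      sum_value K a b X s \<omega> - sum_value K' a' b' X' s \<omega>" for s \<omega>
    unfolding sum_value_def sum.Plus[OF fin] by (simp only: sum.case comp_def scaleR_minus_right sum_negf diff_conv_add_uminus)
  show ?thesis
    using elementary_isometry[OF E] unfolding 1 2 .
qed

lemma sum_integral_component:
  "sum_integral K a b X \<omega> $ l = (\<Sum>k\<in>K. \<Sum>i\<in>UNIV. X k \<omega> $ l $ i * (w (b k) \<omega> - w (a k) \<omega>) $ i)"
  by (simp add: sum_integral_def matrix_vector_mult_def)

lemma sum_integral_sq_integrable:
  assumes el: "elementary K a b X"
  shows "sq_integrable M (\<lambda>\<omega>. sum_integral K a b X \<omega> $ l)"
  unfolding sum_integral_component
proof (intro sq_integrable_sum)
  fix k i assume k: "k \<in> K"
  obtain B where "\<And>\<omega>. \<omega> \<in> space M \<Longrightarrow> \<bar>X k \<omega> $ l $ i\<bar> \<le> B"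
    using elementary_component(3)[OF el k] by blast
  then show "sq_integrable M (\<lambda>\<omega>. X k \<omega> $ l $ i * (w (b k) \<omega> - w (a k) \<omega>) $ i)"
    using el k elementary_component(2)[OF el k]
    by (intro sq_integrable_bdd_mult sq_integrable_w) (auto simp: elementary_def)
qed

lemma sum_integral_measurable:
  "elementary K a b X \<Longrightarrow> sum_integral K a b X \<in> borel_measurable M"
  using sum_integral_sq_integrable[of K a b X] by (intro vec_borel_measurable) (simp add: sq_integrable_def)

text \<open>Each increment starts at some \<open>a k \<ge> s\<close>, where \<open>F\<close> and the
  bounded coefficient \<open>X k\<close> are both known, so their product is an admissible factor in
  \<open>increment_orthogonal\<close>.\<close>

lemma sum_integral_orthogonal:
  assumes el: "elementary K a b X" and s: "\<And>k. k \<in> K \<Longrightarrow> s \<le> a k"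
    and F: "sq_integrable M F" "F \<in> borel_measurable (enlarged s)"
  shows "(LINT \<omega>|M. F \<omega> * sum_integral K a b X \<omega> $ l) = 0"
proof -
  have FX: "(LINT \<omega>|M. F \<omega> * (X k \<omega> $ l $ i * (w (b k) \<omega> - w (a k) \<omega>) $ i)) = 0"
    "integrable M (\<lambda>\<omega>. F \<omega> * (X k \<omega> $ l $ i * (w (b k) \<omega> - w (a k) \<omega>) $ i))" if k: "k \<in> K" for k i
  proof -
    have ab: "0 \<le> a k" "a k \<le> b k" using el k by (auto simp: elementary_def)
    obtain B where B: "\<And>\<omega>. \<omega> \<in> space M \<Longrightarrow> \<bar>X k \<omega> $ l $ i\<bar> \<le> B"
      using elementary_component(3)[OF el k] by blast
    have sq: "sq_integrable M (\<lambda>\<omega>. X k \<omega> $ l $ i * F \<omega>)"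
      by (rule sq_integrable_bdd_mult[OF F(1) elementary_component(2)[OF el k] B])
    have "F \<in> borel_measurable (enlarged (a k))"
      by (rule measurable_from_subalg[OF enlarged_mono[OF s[OF k]] F(2)])
    then have "(LINT \<omega>|M. (X k \<omega> $ l $ i * F \<omega>) * (w (b k) \<omega> - w (a k) \<omega>) $ i) = 0"
      by (intro increment_orthogonal ab sq borel_measurable_times elementary_component(1)[OF el k])
    then show "(LINT \<omega>|M. F \<omega> * (X k \<omega> $ l $ i * (w (b k) \<omega> - w (a k) \<omega>) $ i)) = 0"
      by (simp add: ac_simps)
    show "integrable M (\<lambda>\<omega>. F \<omega> * (X k \<omega> $ l $ i * (w (b k) \<omega> - w (a k) \<omega>) $ i))"
      using sq_integrable_mult[OF sq sq_integrable_w[OF ab, of i]] by (simp add: ac_simps)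
  qed
  show ?thesis
    unfolding sum_integral_component sum_distrib_left using FX by simp
qed

lemma simple_process_mono:
  assumes "simple_process M F u v m \<tau> \<xi>" "i \<le> j" "j \<le> m"
  shows "\<tau> i \<le> \<tau> j"
  using assms(2,3)
proof (induction j rule: dec_induct)
  case (step j)
  then show ?case using assms(1) unfolding simple_process_def by (metis Suc_le_eq less_imp_le order_trans)
qed simp

lemma simple_process_bounds:
  assumes sp: "simple_process M F u v m \<tau> \<xi>" and j: "j \<le> m"
  shows "u \<le> \<tau> j" "\<tau> j \<le> v"
  using simple_process_mono[OF sp, of 0 j] simple_process_mono[OF sp, of j m] sp j
  by (auto simp: simple_process_def)

lemma simple_process_elementary:
  assumes sp: "simple_process M (history M t0 w r) t0 t m \<tau> \<xi>"
  shows "elementary {..<m} \<tau> (\<lambda>j. \<tau> (Suc j)) \<xi>"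
  unfolding elementary_def
proof (intro conjI ballI)
  fix j assume j: "j \<in> {..<m}"
  show "0 \<le> \<tau> j" using simple_process_bounds(1)[OF sp, of j] j t0 by simp
  show "\<tau> j \<le> \<tau> (Suc j)" "bounded (\<xi> j ` space M)" using sp j by (auto simp: simple_process_def)
  have "\<xi> j \<in> borel_measurable (history M t0 w r (\<tau> j))" using sp j by (auto simp: simple_process_def)
  then show "\<xi> j \<in> borel_measurable (enlarged (\<tau> j))"
    by (rule measurable_from_subalg[OF history_enlarged[OF order_refl]])
qed simp

lemma simple_value_eq: "simple_value m \<tau> \<xi> s \<omega> = sum_value {..<m} \<tau> (\<lambda>j. \<tau> (Suc j)) \<xi> s \<omega>"
  by (simp add: simple_value_def sum_value_def)

lemma simple_integral_eq: "simple_integral_wrt w m \<tau> \<xi> = sum_integral {..<m} \<tau> (\<lambda>j. \<tau> (Suc j)) \<xi>"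
  by (simp add: simple_integral_wrt_def sum_integral_def fun_eq_iff)

text \<open>This allows time integrals over \<open>[u, v]\<close> to be written over the whole line.
  The value at \<open>v\<close> itself is zero because the steps are half-open.\<close>

lemma simple_value_outside:
  assumes sp: "simple_process M F u v m \<tau> \<xi>" and s: "s < u \<or> v \<le> s"
  shows "simple_value m \<tau> \<xi> s \<omega> = 0"
proof -
  have "indicator {\<tau> j..<\<tau> (Suc j)} s = (0::real)" if "j < m" for j
    using simple_process_bounds[OF sp, of j] simple_process_bounds[OF sp, of "Suc j"] that s by auto
  then show ?thesis by (simp add: simple_value_def)
qed

lemma sum_value_measurable:
  assumes el: "elementary K a b X"
  shows "(\<lambda>(\<omega>, s). sum_value K a b X s \<omega>) \<in> borel_measurable (M \<Otimes>\<^sub>M lborel)"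
proof -
  have X: "X k \<in> borel_measurable M" if "k \<in> K" for k
    using el that by (auto simp: elementary_def intro: measurable_from_subalg[OF subalgebra_enlarged])
  show ?thesis
    unfolding sum_value_def split_beta'
    by (intro borel_measurable_sum borel_measurable_scaleR measurable_compose[OF measurable_snd]
        measurable_compose[OF measurable_fst X]) auto
qed

text \<open>The witnesses of \<open>has_ito_integral\<close> made explicit, with the integrand cut
  off by an indicator and time running over the whole line. In this form approximations for
  different end times can be subtracted from each other.\<close>

definition ito_approx :: "real \<Rightarrow> (real \<Rightarrow> 'a \<Rightarrow> real^'p^'n) \<Rightarrow> ('a \<Rightarrow> real^'n) \<Rightarrow>
    (nat \<Rightarrow> nat) \<Rightarrow> (nat \<Rightarrow> nat \<Rightarrow> real) \<Rightarrow> (nat \<Rightarrow> nat \<Rightarrow> 'a \<Rightarrow> real^'p^'n) \<Rightarrow> bool" where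
  "ito_approx t g I m \<tau> \<xi> \<longleftrightarrow> I \<in> borel_measurable M \<and>
     (\<forall>k. simple_process M (history M t0 w r) t0 t (m k) (\<tau> k) (\<xi> k)) \<and>
     (\<lambda>k. \<integral>\<^sup>+\<omega>. (\<integral>\<^sup>+s. ennreal ((norm (indicator {t0..t} s *\<^sub>R g s \<omega> - simple_value (m k) (\<tau> k) (\<xi> k) s \<omega>))\<^sup>2) \<partial>lborel) \<partial>M)
       \<longlonglongrightarrow> 0 \<and>
     (\<lambda>k. \<integral>\<^sup>+\<omega>. ennreal ((norm (I \<omega> - simple_integral_wrt w (m k) (\<tau> k) (\<xi> k) \<omega>))\<^sup>2) \<partial>M) \<longlonglongrightarrow> 0"

section \<open>Two Ito integrals of one integrand, over \<open>[t0, t]\<close> and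
  \<open>[t0, s]\<close>, with unrelated approximations\<close>

context
  fixes s t :: real and g :: "real \<Rightarrow> 'a \<Rightarrow> real^'p^'n" and I J :: "'a \<Rightarrow> real^'n" and c :: real
    and m m' :: "nat \<Rightarrow> nat" and \<tau> \<tau>' :: "nat \<Rightarrow> nat \<Rightarrow> real" and \<xi> \<xi>' :: "nat \<Rightarrow> nat \<Rightarrow> 'a \<Rightarrow> real^'p^'n"
  assumes st: "t0 \<le> s" "s \<le> t"
    and g: "(\<lambda>(\<omega>, u). g u \<omega>) \<in> borel_measurable (M \<Otimes>\<^sub>M lborel)" "\<And>u \<omega>. norm (g u \<omega>) \<le> c"
    and I: "ito_approx t g I m \<tau> \<xi>" and J: "ito_approx s g J m' \<tau>' \<xi>'"
begin

private abbreviation "SI k \<equiv> simple_integral_wrt w (m k) (\<tau> k) (\<xi> k)"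
private abbreviation "SJ k \<equiv> simple_integral_wrt w (m' k) (\<tau>' k) (\<xi>' k)"
private abbreviation "VI k \<equiv> simple_value (m k) (\<tau> k) (\<xi> k)"
private abbreviation "VJ k \<equiv> simple_value (m' k) (\<tau>' k) (\<xi>' k)"

private lemma elI: "elementary {..<m k} (\<tau> k) (\<lambda>j. \<tau> k (Suc j)) (\<xi> k)"
  using I by (intro simple_process_elementary[of t]) (simp add: ito_approx_def)

private lemma elJ: "elementary {..<m' k} (\<tau>' k) (\<lambda>j. \<tau>' k (Suc j)) (\<xi>' k)"
  using J by (intro simple_process_elementary[of s]) (simp add: ito_approx_def)

private lemma meas:
  "SI k \<in> borel_measurable M" "SJ k \<in> borel_measurable M" "I \<in> borel_measurable M" "J \<in> borel_measurable M"
  using sum_integral_measurable[OF elI] sum_integral_measurable[OF elJ] I J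
  by (simp_all add: simple_integral_eq ito_approx_def)

private lemma measV:
  "(\<lambda>(\<omega>, u). VI k u \<omega>) \<in> borel_measurable (M \<Otimes>\<^sub>M lborel)"
  "(\<lambda>(\<omega>, u). VJ k u \<omega>) \<in> borel_measurable (M \<Otimes>\<^sub>M lborel)"
  using sum_value_measurable[OF elI[of k]] sum_value_measurable[OF elJ[of k]]
  unfolding simple_value_eq by simp_all

private lemma measg:
  assumes [measurable]: "A \<in> sets borel"
  shows "(\<lambda>(\<omega>, u). indicator A u *\<^sub>R g u \<omega>) \<in> borel_measurable (M \<Otimes>\<^sub>M lborel)"
  using g(1) unfolding split_beta' by measurable

text \<open>Two applications of the three-term inequality, to the values and to the integrals of the simple
  processes, cost the factor 9; no sharp constant is needed later.\<close>

lemma ito_increment_bound: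
  "(\<integral>\<^sup>+\<omega>. ennreal ((norm (I \<omega> - J \<omega>))\<^sup>2) \<partial>M) \<le> ennreal (9 * c\<^sup>2 * (t - s))"
proof -
  let ?N = "\<lambda>f. \<integral>\<^sup>+\<omega>. ennreal ((norm (f \<omega> :: real^'n))\<^sup>2) \<partial>M"
  let ?D = "\<lambda>f. \<integral>\<^sup>+\<omega>. (\<integral>\<^sup>+u. ennreal ((norm (f u \<omega> :: real^'p^'n))\<^sup>2) \<partial>lborel) \<partial>M"
  let ?i = "\<lambda>k u \<omega>. indicator {t0..t} u *\<^sub>R g u \<omega> - VI k u \<omega>"
  let ?j = "\<lambda>k u \<omega>. indicator {t0..s} u *\<^sub>R g u \<omega> - VJ k u \<omega>"
  let ?g = "\<lambda>u \<omega>. indicator {s<..t} u *\<^sub>R g u \<omega>"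
  have G: "?D ?g \<le> ennreal (c\<^sup>2 * (t - s))"
  proof -
    have "(\<integral>\<^sup>+u. ennreal ((norm (?g u \<omega>))\<^sup>2) \<partial>lborel) \<le> ennreal (c\<^sup>2 * (t - s))" for \<omega>
    proof -
      have "(\<integral>\<^sup>+u. ennreal ((norm (?g u \<omega>))\<^sup>2) \<partial>lborel) \<le> (\<integral>\<^sup>+u. ennreal (c\<^sup>2) * indicator {s<..t} u \<partial>lborel)"
        using g(2)[of _ \<omega>] by (intro nn_integral_mono) (auto simp: indicator_def intro!: ennreal_leI power_mono)
      also have "\<dots> = ennreal (c\<^sup>2 * (t - s))"
        using st by (simp add: nn_integral_cmult_indicator ennreal_mult)
      finally show ?thesis .
    qed
    then have "?D ?g \<le> (\<integral>\<^sup>+\<omega>. ennreal (c\<^sup>2 * (t - s)) \<partial>M)" by (intro nn_integral_mono)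
    then show ?thesis by (simp add: emeasure_space_1)
  qed
  have S: "?N (\<lambda>\<omega>. SI k \<omega> - SJ k \<omega>) \<le> 3 * (?D (?i k) + ?D (?j k) + ennreal (c\<^sup>2 * (t - s)))" for k
  proof -
    \<comment> \<open>The first two terms are approximation errors and tend to zero. The third, the
      integrand on \<open>(s, t]\<close>, is the difference of the two cut-offs and gives the bound
      in the limit.\<close>
    have eq: "VI k u \<omega> - VJ k u \<omega> = (VI k u \<omega> - indicator {t0..t} u *\<^sub>R g u \<omega>) + ?j k u \<omega> + ?g u \<omega>" for u \<omega>
      using st by (auto simp: indicator_def)
    have "?N (\<lambda>\<omega>. SI k \<omega> - SJ k \<omega>) = ?D (\<lambda>u \<omega>. VI k u \<omega> - VJ k u \<omega>)"
      using elementary_isometry_diff[OF elI[of k] elJ[of k]]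
      unfolding simple_integral_eq simple_value_eq .
    also have "\<dots> = ?D (\<lambda>u \<omega>. (VI k u \<omega> - indicator {t0..t} u *\<^sub>R g u \<omega>) + ?j k u \<omega> + ?g u \<omega>)"
      unfolding eq ..
    also have "\<dots> \<le> 3 * (?D (\<lambda>u \<omega>. VI k u \<omega> - indicator {t0..t} u *\<^sub>R g u \<omega>) + ?D (?j k) + ?D ?g)"
      using measV[of k] measg[of "{t0..t}"] measg[of "{t0..s}"] measg[of "{s<..t}"]
      by (intro nn_integral2_add3_sq) (auto simp: split_beta')
    also have "\<dots> \<le> 3 * (?D (?i k) + ?D (?j k) + ennreal (c\<^sup>2 * (t - s)))"
      using G by (intro mult_left_mono add_mono) (auto simp: norm_minus_commute)
    finally show ?thesis .
  qed
  let ?b = "\<lambda>k. 3 * (?N (\<lambda>\<omega>. I \<omega> - SI k \<omega>) + 3 * (?D (?i k) + ?D (?j k) + ennreal (c\<^sup>2 * (t - s))) + ?N (\<lambda>\<omega>. J \<omega> - SJ k \<omega>))"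
  have "?N (\<lambda>\<omega>. I \<omega> - J \<omega>) \<le> ?b k" for k
  proof -
    have "?N (\<lambda>\<omega>. I \<omega> - J \<omega>) = ?N (\<lambda>\<omega>. (I \<omega> - SI k \<omega>) + (SI k \<omega> - SJ k \<omega>) + (SJ k \<omega> - J \<omega>))" by simp
    also have "\<dots> \<le> 3 * (?N (\<lambda>\<omega>. I \<omega> - SI k \<omega>) + ?N (\<lambda>\<omega>. SI k \<omega> - SJ k \<omega>) + ?N (\<lambda>\<omega>. SJ k \<omega> - J \<omega>))"
      by (intro nn_integral_norm_add3_sq borel_measurable_diff meas)
    also have "\<dots> \<le> ?b k"
      using S[of k] by (intro mult_left_mono add_mono) (auto simp: norm_minus_commute)
    finally show ?thesis .
  qed
  moreover have "?b \<longlonglongrightarrow> 3 * (0 + 3 * (0 + 0 + ennreal (c\<^sup>2 * (t - s))) + 0)"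
    using I J by (intro tendsto_ennreal_three_times_sum tendsto_const) (simp_all add: ito_approx_def)
  ultimately have "?N (\<lambda>\<omega>. I \<omega> - J \<omega>) \<le> 3 * (0 + 3 * (0 + 0 + ennreal (c\<^sup>2 * (t - s))) + 0)"
    by (intro LIMSEQ_le_const) auto
  also have "\<dots> = 9 * ennreal (c\<^sup>2 * (t - s))" by (simp add: mult.assoc[symmetric])
  also have "\<dots> = ennreal (9 * c\<^sup>2 * (t - s))"
    using st by (simp add: mult.assoc ennreal_mult)
  finally show ?thesis .
qed

lemma ito_increment_sq_integrable: "sq_integrable M (\<lambda>\<omega>. (I \<omega> - J \<omega>) $ l)"
proof (rule sq_integrable_nn)
  have "(\<integral>\<^sup>+\<omega>. ennreal (((I \<omega> - J \<omega>) $ l)\<^sup>2) \<partial>M) \<le> (\<integral>\<^sup>+\<omega>. ennreal ((norm (I \<omega> - J \<omega>))\<^sup>2) \<partial>M)"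
  proof (intro nn_integral_mono ennreal_leI)
    show "((I \<omega> - J \<omega>) $ l)\<^sup>2 \<le> (norm (I \<omega> - J \<omega>))\<^sup>2" for \<omega>
      using component_le_norm_cart[of "I \<omega> - J \<omega>" l] by (rule power2_le_of_abs_le)
  qed
  from le_less_trans[OF order_trans[OF this ito_increment_bound] ennreal_less_top]
  show "(\<integral>\<^sup>+\<omega>. ennreal (((I \<omega> - J \<omega>) $ l)\<^sup>2) \<partial>M) < \<infinity>"
    by simp
  show "(\<lambda>\<omega>. (I \<omega> - J \<omega>) $ l) \<in> borel_measurable M"
    by (rule measurable_compose[where g="\<lambda>v. v $ l", OF borel_measurable_diff[OF meas(3,4)]]) simp
qed

text \<open>The simple integrals approximating \<open>I\<close> are cut at \<open>s\<close>. The
  part \<open>R\<close> after \<open>s\<close> is orthogonal to \<open>F\<close>. The part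
  \<open>T\<close> before \<open>s\<close> and the approximation of \<open>J\<close> have integrands
  that both tend to \<open>g\<close> on \<open>[t0, s)\<close>, so by the isometry their difference
  tends to zero. Thus \<open>I - J\<close> is \<open>R k\<close> plus a remainder that vanishes in
  mean square.\<close>

lemma ito_increment_orthogonal:
  assumes F: "sq_integrable M F" "F \<in> borel_measurable (enlarged s)"
  shows "(LINT \<omega>|M. F \<omega> * (I \<omega> - J \<omega>) $ l) = 0"
proof -
  let ?N = "\<lambda>f. \<integral>\<^sup>+\<omega>. ennreal ((norm (f \<omega> :: real^'n))\<^sup>2) \<partial>M"
  let ?D = "\<lambda>f. \<integral>\<^sup>+\<omega>. (\<integral>\<^sup>+u. ennreal ((norm (f u \<omega> :: real^'p^'n))\<^sup>2) \<partial>lborel) \<partial>M"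
  let ?i = "\<lambda>k u \<omega>. indicator {t0..t} u *\<^sub>R g u \<omega> - VI k u \<omega>"
  let ?j = "\<lambda>k u \<omega>. indicator {t0..s} u *\<^sub>R g u \<omega> - VJ k u \<omega>"
  \<comment> \<open>Only intervals that start before \<open>s\<close> are kept: truncating a later
    one by \<open>min\<close> would put its right endpoint before its left one.\<close>
  define K where "K k = {j\<in>{..<m k}. \<tau> k j < s}" for k
  define T where "T k = sum_integral (K k) (\<tau> k) (\<lambda>j. min (\<tau> k (Suc j)) s) (\<xi> k)" for k
  \<comment> \<open>Taking \<open>max\<close> at both ends shrinks intervals before \<open>s\<close>
    to the point \<open>s\<close>, so all indices can be kept; the coefficients remain admissible
    since the starting times only increase.\<close>
  define R where "R k = sum_integral {..<m k} (\<lambda>j. max (\<tau> k j) s) (\<lambda>j. max (\<tau> k (Suc j)) s) (\<xi> k)" for k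
  have elT: "elementary (K k) (\<tau> k) (\<lambda>j. min (\<tau> k (Suc j)) s) (\<xi> k)" for k
    using elI[of k] by (auto simp: elementary_def K_def)
  have elR: "elementary {..<m k} (\<lambda>j. max (\<tau> k j) s) (\<lambda>j. max (\<tau> k (Suc j)) s) (\<xi> k)" for k
    unfolding elementary_def
  proof (intro conjI ballI)
    fix j assume j: "j \<in> {..<m k}"
    then have e: "0 \<le> \<tau> k j" "\<tau> k j \<le> \<tau> k (Suc j)" "\<xi> k j \<in> borel_measurable (enlarged (\<tau> k j))"
      "bounded (\<xi> k j ` space M)" using elI[of k] by (auto simp: elementary_def)
    show "\<xi> k j \<in> borel_measurable (enlarged (max (\<tau> k j) s))"
      by (rule measurable_from_subalg[OF enlarged_mono[OF max.cobounded1] e(3)])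
  qed (use elI[of k] in \<open>auto simp: elementary_def intro: max.coboundedI1 max.mono\<close>)
  have split: "SI k \<omega> = T k \<omega> + R k \<omega>" for k \<omega>
  proof -
    have "T k \<omega> = (\<Sum>j<m k. if \<tau> k j < s then \<xi> k j \<omega> *v (w (min (\<tau> k (Suc j)) s) \<omega> - w (\<tau> k j) \<omega>) else 0)"
      unfolding T_def K_def sum_integral_def sum.inter_filter[OF finite_lessThan] ..
    moreover have "\<xi> k j \<omega> *v (w (\<tau> k (Suc j)) \<omega> - w (\<tau> k j) \<omega>) =
        (if \<tau> k j < s then \<xi> k j \<omega> *v (w (min (\<tau> k (Suc j)) s) \<omega> - w (\<tau> k j) \<omega>) else 0) +
        \<xi> k j \<omega> *v (w (max (\<tau> k (Suc j)) s) \<omega> - w (max (\<tau> k j) s) \<omega>)" if "j < m k" for j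
    proof -
      have le: "\<tau> k j \<le> \<tau> k (Suc j)" using elI[of k] that by (simp add: elementary_def)
      show ?thesis
      proof (cases "\<tau> k j < s")
        case True
        then show ?thesis by (auto simp: matrix_vector_right_distrib[symmetric] min_def max_def)
      next
        case False
        then have "max (\<tau> k j) s = \<tau> k j" "max (\<tau> k (Suc j)) s = \<tau> k (Suc j)" using le by auto
        then show ?thesis using False by simp
      qed
    qed
    ultimately show ?thesis
      by (simp add: simple_integral_wrt_def R_def sum_integral_def sum.distrib[symmetric])
  qed
  \<comment> \<open>The sum telescopes to \<open>I - J - R k\<close>, grouped so that each bracket
    tends to zero in mean square.\<close>
  define Z where "Z k \<omega> = (I \<omega> - SI k \<omega>) + (T k \<omega> - SJ k \<omega>) + (SJ k \<omega> - J \<omega>)" for k \<omega>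
  have mT: "T k \<in> borel_measurable M" for k
    unfolding T_def by (rule sum_integral_measurable[OF elT])
  have mZ: "Z k \<in> borel_measurable M" for k
    unfolding Z_def by (intro borel_measurable_add borel_measurable_diff meas mT)
  \<comment> \<open>A zero process as third summand, so that the three-term inequality also serves
    for two terms.\<close>
  define z where "z = (\<lambda>(u::real) (\<omega>::'a). 0 :: real^'p^'n)"
  have TJ: "?N (\<lambda>\<omega>. T k \<omega> - SJ k \<omega>) \<le> 3 * (?D (?i k) + ?D (?j k) + 0)" for k
  proof -
    have V: "sum_value (K k) (\<tau> k) (\<lambda>j. min (\<tau> k (Suc j)) s) (\<xi> k) u \<omega> = indicator {..<s} u *\<^sub>R VI k u \<omega>" for u \<omega>
      unfolding sum_value_def simple_value_def scaleR_sum_right K_def sum.inter_filter[OF finite_lessThan]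
      by (intro sum.cong refl) (auto simp: indicator_def)
    \<comment> \<open>On \<open>[t0, s)\<close> the two sides agree. Elsewhere the left side is
      zero, because both simple processes, the first one truncated at \<open>s\<close>, vanish
      there.\<close>
    have pt: "norm (sum_value (K k) (\<tau> k) (\<lambda>j. min (\<tau> k (Suc j)) s) (\<xi> k) u \<omega> - VJ k u \<omega>) \<le>
        norm ((VI k u \<omega> - indicator {t0..t} u *\<^sub>R g u \<omega>) + ?j k u \<omega> + z u \<omega>)" for u \<omega>
    proof (cases "t0 \<le> u \<and> u < s")
      case True
      then show ?thesis unfolding V using st by (simp add: z_def)
    next
      case False
      then have "VJ k u \<omega> = 0"
        using J by (intro simple_value_outside[of _ t0 s]) (auto simp: ito_approx_def)
      moreover have "u < s \<Longrightarrow> VI k u \<omega> = 0"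
        using False I by (intro simple_value_outside[of _ t0 t]) (auto simp: ito_approx_def)
      ultimately show ?thesis unfolding V by (auto simp: indicator_def)
    qed
    have "?N (\<lambda>\<omega>. T k \<omega> - SJ k \<omega>) = ?D (\<lambda>u \<omega>. sum_value (K k) (\<tau> k) (\<lambda>j. min (\<tau> k (Suc j)) s) (\<xi> k) u \<omega> - VJ k u \<omega>)"
      using elementary_isometry_diff[OF elT[of k] elJ[of k]]
      unfolding simple_integral_eq simple_value_eq T_def by simp
    also have "\<dots> \<le> ?D (\<lambda>u \<omega>. (VI k u \<omega> - indicator {t0..t} u *\<^sub>R g u \<omega>) + ?j k u \<omega> + z u \<omega>)"
      by (intro nn_integral_mono ennreal_leI power_mono pt) simp
    also have "\<dots> \<le> 3 * (?D (\<lambda>u \<omega>. VI k u \<omega> - indicator {t0..t} u *\<^sub>R g u \<omega>) + ?D (?j k) + ?D z)"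
      using measV[of k] measg[of "{t0..t}"] measg[of "{t0..s}"]
      by (intro nn_integral2_add3_sq) (auto simp: split_beta' z_def)
    finally show ?thesis by (simp add: norm_minus_commute z_def)
  qed
  have ZN: "?N (Z k) \<le> 3 * (?N (\<lambda>\<omega>. I \<omega> - SI k \<omega>) + 3 * (?D (?i k) + ?D (?j k) + 0) + ?N (\<lambda>\<omega>. J \<omega> - SJ k \<omega>))" for k
  proof -
    have "?N (Z k) \<le> 3 * (?N (\<lambda>\<omega>. I \<omega> - SI k \<omega>) + ?N (\<lambda>\<omega>. T k \<omega> - SJ k \<omega>) + ?N (\<lambda>\<omega>. SJ k \<omega> - J \<omega>))"
      unfolding Z_def by (intro nn_integral_norm_add3_sq borel_measurable_diff meas mT)
    also have "\<dots> \<le> 3 * (?N (\<lambda>\<omega>. I \<omega> - SI k \<omega>) + 3 * (?D (?i k) + ?D (?j k) + 0) + ?N (\<lambda>\<omega>. J \<omega> - SJ k \<omega>))"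
      using TJ[of k] by (intro mult_left_mono add_mono) (auto simp: norm_minus_commute)
    finally show ?thesis .
  qed
  have "(\<lambda>k. 3 * (?N (\<lambda>\<omega>. I \<omega> - SI k \<omega>) + 3 * (?D (?i k) + ?D (?j k) + 0) + ?N (\<lambda>\<omega>. J \<omega> - SJ k \<omega>)))
      \<longlonglongrightarrow> 3 * (0 + 3 * (0 + 0 + 0) + 0)"
    using I J by (intro tendsto_ennreal_three_times_sum tendsto_const) (simp_all add: ito_approx_def)
  then have lim1: "(\<lambda>k. 3 * (?N (\<lambda>\<omega>. I \<omega> - SI k \<omega>) + 3 * (?D (?i k) + ?D (?j k) + 0) + ?N (\<lambda>\<omega>. J \<omega> - SJ k \<omega>)))
      \<longlonglongrightarrow> 0" by simp
  have lim0: "(\<lambda>k. ?N (Z k)) \<longlonglongrightarrow> 0"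
    by (rule tendsto_sandwich[OF _ _ tendsto_const lim1]) (intro always_eventually allI ZN zero_le)+
  have lim: "(\<lambda>k. \<integral>\<^sup>+\<omega>. ennreal ((Z k \<omega> $ l)\<^sup>2) \<partial>M) \<longlonglongrightarrow> 0"
  proof (rule tendsto_sandwich[OF _ _ tendsto_const lim0])
    show "\<forall>\<^sub>F k in sequentially. (\<integral>\<^sup>+\<omega>. ennreal ((Z k \<omega> $ l)\<^sup>2) \<partial>M) \<le> ?N (Z k)"
      using component_le_norm_cart[of "Z _ _" l]
      by (intro always_eventually allI nn_integral_mono ennreal_leI power2_le_of_abs_le)
  qed auto
  have mZl: "(\<lambda>\<omega>. Z k \<omega> $ l) \<in> borel_measurable M" for k
    by (rule measurable_compose[where g="\<lambda>v. v $ l", OF mZ]) simp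
  \<comment> \<open>The left side does not depend on \<open>k\<close>, while the right side tends to
    zero; hence the left side is zero.\<close>
  have "(LINT \<omega>|M. F \<omega> * (I \<omega> - J \<omega>) $ l) = (LINT \<omega>|M. F \<omega> * Z k \<omega> $ l)" for k
  proof -
    have e: "F \<omega> * Z k \<omega> $ l = F \<omega> * (I \<omega> - J \<omega>) $ l - F \<omega> * R k \<omega> $ l" for \<omega>
      by (simp add: Z_def split algebra_simps)
    have sR: "sq_integrable M (\<lambda>\<omega>. R k \<omega> $ l)" unfolding R_def by (rule sum_integral_sq_integrable[OF elR])
    have "(LINT \<omega>|M. F \<omega> * R k \<omega> $ l) = 0"
      unfolding R_def by (intro sum_integral_orthogonal[OF elR _ F]) auto
    moreover have "(LINT \<omega>|M. F \<omega> * (I \<omega> - J \<omega>) $ l - F \<omega> * R k \<omega> $ l) =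
        (LINT \<omega>|M. F \<omega> * (I \<omega> - J \<omega>) $ l) - (LINT \<omega>|M. F \<omega> * R k \<omega> $ l)"
      by (intro Bochner_Integration.integral_diff sq_integrable_mult[OF F(1)] ito_increment_sq_integrable sR)
    ultimately show ?thesis unfolding e by simp
  qed
  with tendsto_integral_mult_0[OF F(1) mZl lim] have "(\<lambda>k. LINT \<omega>|M. F \<omega> * (I \<omega> - J \<omega>) $ l) \<longlonglongrightarrow> 0"
    by simp
  then show ?thesis by (simp add: LIMSEQ_const_iff)
qed

end

end

section \<open>Integrals over time\<close>

text \<open>Evaluating at the next point of a grid to the right of \<open>s\<close> gives a function
  with countably many time values, hence jointly measurable; right continuity lets the mesh tend to
  zero. Replacing \<open>s\<close> by \<open>max t0 s\<close> extends the process to the whole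
  line.\<close>

lemma borel_measurable_right_continuous:
  fixes f :: "real \<Rightarrow> 'a \<Rightarrow> 'b::{second_countable_topology, metric_space}"
  assumes meas: "\<And>t. t0 \<le> t \<Longrightarrow> f t \<in> borel_measurable M"
    and cont: "\<And>t \<omega>. \<omega> \<in> space M \<Longrightarrow> t0 \<le> t \<Longrightarrow> ((\<lambda>u. f u \<omega>) \<longlongrightarrow> f t \<omega>) (at_right t)"
  shows "(\<lambda>(\<omega>, s). f (max t0 s) \<omega>) \<in> borel_measurable (M \<Otimes>\<^sub>M lborel)"
proof -
  \<comment> \<open>The added 1 makes the grid point strictly larger than \<open>s\<close>, also
    when \<open>s\<close> lies on the grid, as convergence along \<open>at_right s\<close>
    requires.\<close>
  define y where "y n s = (of_int \<lfloor>real (Suc n) * s\<rfloor> + 1) / real (Suc n)" for n s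
  have y: "s < y n s" "y n s \<le> s + inverse (real (Suc n))" for s n
  proof -
    have "real (Suc n) * s < of_int \<lfloor>real (Suc n) * s\<rfloor> + 1" by linarith
    then show "s < y n s" unfolding y_def by (simp add: field_simps)
    have "of_int \<lfloor>real (Suc n) * s\<rfloor> + 1 \<le> real (Suc n) * s + 1" by linarith
    then have "y n s \<le> (real (Suc n) * s + 1) / real (Suc n)"
      unfolding y_def by (intro divide_right_mono) auto
    also have "\<dots> = s + inverse (real (Suc n))" by (simp add: field_simps)
    finally show "y n s \<le> s + inverse (real (Suc n))" .
  qed
  have ylim: "filterlim (\<lambda>n. y n s) (at_right s) sequentially" for s
    unfolding filterlim_at
  proof
    have "(\<lambda>n. s + inverse (real (Suc n))) \<longlonglongrightarrow> s + 0"
      by (intro tendsto_add tendsto_const LIMSEQ_inverse_real_of_nat)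
    then have "(\<lambda>n. s + inverse (real (Suc n))) \<longlonglongrightarrow> s" by simp
    then show "(\<lambda>n. y n s) \<longlonglongrightarrow> s"
      by (rule tendsto_sandwich[OF _ _ tendsto_const, rotated 2])
        (use y(1)[of s] y(2)[of _ s] in \<open>auto intro!: always_eventually less_imp_le\<close>)
    show "\<forall>\<^sub>F n in sequentially. y n s \<in> {s<..} \<and> y n s \<noteq> s"
      using y(1)[of s] by (auto intro!: always_eventually simp: less_imp_neq[symmetric])
  qed
  have lim: "(\<lambda>n. f (max t0 (y n s)) \<omega>) \<longlonglongrightarrow> f (max t0 s) \<omega>" if "\<omega> \<in> space M" for \<omega> s
  proof -
    have "((\<lambda>u. f (max t0 u) \<omega>) \<longlongrightarrow> f (max t0 s) \<omega>) (at_right s)"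
    proof (cases "t0 \<le> s")
      case True
      have "\<forall>\<^sub>F u in at_right s. f u \<omega> = f (max t0 u) \<omega>"
        using True by (auto simp: eventually_at_filter intro!: always_eventually)
      from Lim_transform_eventually[OF cont[OF that True] this]
      show ?thesis using True by simp
    next
      case False
      then have "\<forall>\<^sub>F u in at_right s. u < t0"
        by (intro order_tendstoD(2)[OF tendsto_ident_at]) simp
      then have "\<forall>\<^sub>F u in at_right s. f (max t0 u) \<omega> = f (max t0 s) \<omega>"
        by (rule eventually_mono) (use False in simp)
      then show ?thesis by (rule tendsto_eventually)
    qed
    from filterlim_compose[OF this ylim] show ?thesis .
  qed
  show ?thesis
  proof (rule borel_measurable_LIMSEQ_metric)
    fix n
    have "(\<lambda>z. f (max t0 ((of_int \<lfloor>real (Suc n) * snd z\<rfloor> + 1) / real (Suc n))) (fst z)) \<in> borel_measurable (M \<Otimes>\<^sub>M lborel)"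
      by (rule measurable_compose_countable[where f="\<lambda>i z. f (max t0 ((of_int i + 1) / real (Suc n))) (fst z)"
          and g="\<lambda>z. \<lfloor>real (Suc n) * snd z\<rfloor>"])
        (auto intro!: measurable_compose[OF measurable_fst meas])
    then show "(\<lambda>(\<omega>, s). f (max t0 (y n s)) \<omega>) \<in> borel_measurable (M \<Otimes>\<^sub>M lborel)"
      by (simp add: split_beta' y_def)
  next
    fix z :: "'a \<times> real" assume "z \<in> space (M \<Otimes>\<^sub>M lborel)"
    then show "(\<lambda>n. case z of (\<omega>, s) \<Rightarrow> f (max t0 (y n s)) \<omega>) \<longlonglongrightarrow> (case z of (\<omega>, s) \<Rightarrow> f (max t0 s) \<omega>)"
      using lim by (auto simp: space_pair_measure)
  qed
qed

text \<open>Tonelli. The premise \<open>path\<close> identifies, for each outcome, the Bochner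
  integral over time with the nonnegative one.\<close>

lemma (in prob_space) integral_time_bound:
  fixes f :: "real \<Rightarrow> 'a \<Rightarrow> real"
  assumes f: "(\<lambda>(\<omega>, s). f s \<omega>) \<in> borel_measurable (M \<Otimes>\<^sub>M lborel)"
    and nn: "\<And>s \<omega>. 0 \<le> f s \<omega>" and ab: "a \<le> b"
    and bound: "\<And>s. s \<in> {a..b} \<Longrightarrow> (\<integral>\<^sup>+\<omega>. ennreal (f s \<omega>) \<partial>M) \<le> ennreal B" and B: "0 \<le> B"
    and path: "\<And>\<omega>. \<omega> \<in> space M \<Longrightarrow> set_integrable lborel {a..b} (\<lambda>s. f s \<omega>)"
  shows "integrable M (\<lambda>\<omega>. LINT s:{a..b}|lborel. f s \<omega>)"
    and "(LINT \<omega>|M. (LINT s:{a..b}|lborel. f s \<omega>)) \<le> B * (b - a)"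
proof -
  interpret pair_sigma_finite M "lborel :: real measure" by standard
  let ?g = "\<lambda>\<omega>. LINT s:{a..b}|lborel. f s \<omega>"
  have fm: "(\<lambda>(\<omega>, s). ennreal (indicator {a..b} s * f s \<omega>)) \<in> borel_measurable (M \<Otimes>\<^sub>M lborel)"
    using f unfolding split_beta' by measurable
  have fs: "(\<lambda>(\<omega>, s). indicator {a..b} s * f s \<omega>) \<in> borel_measurable (M \<Otimes>\<^sub>M lborel)"
    using f unfolding split_beta' by measurable
  have g: "?g \<in> borel_measurable M"
    using lborel.borel_measurable_lebesgue_integral[OF fs] by (simp add: set_lebesgue_integral_def)
  have g0: "0 \<le> ?g \<omega>" for \<omega>
    unfolding set_lebesgue_integral_def using nn by simp
  have eq: "(\<integral>\<^sup>+s. ennreal (indicator {a..b} s * f s \<omega>) \<partial>lborel) = ennreal (?g \<omega>)" if "\<omega> \<in> space M" for \<omega>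
    using path[OF that] nn unfolding set_lebesgue_integral_def set_integrable_def
    by (subst nn_integral_eq_integral) auto
  have "(\<integral>\<^sup>+\<omega>. ennreal (?g \<omega>) \<partial>M) = (\<integral>\<^sup>+\<omega>. (\<integral>\<^sup>+s. ennreal (indicator {a..b} s * f s \<omega>) \<partial>lborel) \<partial>M)"
    using eq by (intro nn_integral_cong) simp
  also have "\<dots> = (\<integral>\<^sup>+s. (\<integral>\<^sup>+\<omega>. ennreal (indicator {a..b} s * f s \<omega>) \<partial>M) \<partial>lborel)"
    using Fubini'[OF fm] by simp
  also have "\<dots> \<le> (\<integral>\<^sup>+s. ennreal B * indicator {a..b} s \<partial>lborel)"
    using bound by (intro nn_integral_mono) (auto simp: indicator_def)
  also have "\<dots> = ennreal (B * (b - a))"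
    using ab B by (simp add: nn_integral_cmult_indicator ennreal_mult)
  finally have le: "(\<integral>\<^sup>+\<omega>. ennreal (?g \<omega>) \<partial>M) \<le> ennreal (B * (b - a))" .
  from le_less_trans[OF this ennreal_less_top] show int: "integrable M ?g"
    using g g0 by (intro integrableI_nonneg) auto
  show "(LINT \<omega>|M. ?g \<omega>) \<le> B * (b - a)"
    using le int g0 B ab by (subst (asm) nn_integral_eq_integral) (auto simp: ennreal_le_iff)
qed

text \<open>Cauchy-Schwarz against the constant 1, obtained from the nonnegativity of a
  variance.\<close>

lemma square_set_integral_le:
  fixes f :: "real \<Rightarrow> real"
  assumes ab: "a \<le> b" and f: "set_integrable lborel {a..b} f" and f2: "set_integrable lborel {a..b} (\<lambda>s. (f s)\<^sup>2)"
  shows "(LINT s:{a..b}|lborel. f s)\<^sup>2 \<le> (b - a) * (LINT s:{a..b}|lborel. (f s)\<^sup>2)"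
proof (cases "a = b")
  case True
  have "AE s in lborel. indicator {a..b} s *\<^sub>R f s = 0"
    using AE_lborel_singleton[of a] by eventually_elim (auto simp: True indicator_def)
  then have "(LINT s:{a..b}|lborel. f s) = 0"
    unfolding set_lebesgue_integral_def by (rule integral_eq_zero_AE)
  then show ?thesis using True by simp
next
  case False
  let ?F = "LINT s:{a..b}|lborel. f s" and ?G = "LINT s:{a..b}|lborel. (f s)\<^sup>2"
  \<comment> \<open>\<open>m\<close> is the mean value of \<open>f\<close> on the interval, and the
    inequality is that the integral of \<open>(f - m)^2\<close> is nonnegative. The definition
    divides by \<open>b - a\<close>, so a degenerate interval is a separate case.\<close>
  define m where "m = ?F / (b - a)"
  have mb: "m * (b - a) = ?F" using False by (simp add: m_def)
  have const: "set_integrable lborel {a..b} (\<lambda>_. m\<^sup>2)"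
    by (rule borel_integrable_atLeastAtMost') simp
  have "0 \<le> (LINT s:{a..b}|lborel. (f s - m)\<^sup>2)"
    unfolding set_lebesgue_integral_def by (intro Bochner_Integration.integral_nonneg) auto
  also have "(LINT s:{a..b}|lborel. (f s - m)\<^sup>2) = (LINT s:{a..b}|lborel. (f s)\<^sup>2 + (m\<^sup>2 - (2 * m) * f s))"
    by (simp add: power2_diff algebra_simps)
  also have "\<dots> = ?G + (LINT s:{a..b}|lborel. m\<^sup>2 - (2 * m) * f s)"
    using f f2 const by (intro set_integral_add) auto
  also have "(LINT s:{a..b}|lborel. m\<^sup>2 - (2 * m) * f s) = (LINT s:{a..b}|lborel. m\<^sup>2) - 2 * m * ?F"
    using f const by (subst set_integral_diff) auto
  also have "(LINT s:{a..b}|lborel. m\<^sup>2) = m\<^sup>2 * (b - a)"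
    using ab by (simp add: set_lebesgue_integral_def)
  also have "m\<^sup>2 * (b - a) = m * ?F"
    using mb by (simp add: power2_eq_square mult.assoc)
  finally have "0 \<le> ?G - m * ?F"
    by (simp add: algebra_simps)
  then have "0 \<le> (b - a) * (?G - m * ?F)" using ab by simp
  also have "\<dots> = (b - a) * ?G - ?F\<^sup>2"
  proof -
    have "(b - a) * (m * ?F) = (m * (b - a)) * ?F" by (simp only: ac_simps)
    then show ?thesis unfolding mb by (simp add: right_diff_distrib power2_eq_square)
  qed
  finally show ?thesis by simp
qed

text \<open>The forcing \<open>G\<close> need not be monotone. The bound is linear in
  \<open>G\<close> and its integral, so for a random forcing the expectation can be taken after
  Gronwall has been used on each path.\<close>

lemma gronwall_integral:
  fixes u G :: "real \<Rightarrow> real"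
  assumes ab: "a \<le> T" and u: "continuous_on {a..T} u" and G: "continuous_on {a..T} G"
    and G0: "\<And>t. t \<in> {a..T} \<Longrightarrow> 0 \<le> G t" and \<beta>: "0 \<le> \<beta>"
    and le: "\<And>t. t \<in> {a..T} \<Longrightarrow> u t \<le> G t + \<beta> * integral {a..t} u"
  shows "u T \<le> G T + \<beta> * exp (\<beta> * (T - a)) * integral {a..T} G"
proof -
  \<comment> \<open>The integrating factor is applied to the integral of \<open>u\<close>. The
    derivative of \<open>z\<close> is then at most \<open>G\<close> times the factor minus one,
    which is nonpositive for \<open>t \<ge> a\<close>.\<close>
  define z where "z t = exp (- \<beta> * (t - a)) * integral {a..t} u - integral {a..t} G" for t
  have der: "DERIV (\<lambda>t. integral {a..t} f) t :> f t" if "continuous_on {a..T} f" "a < t" "t < T" for f :: "real \<Rightarrow> real" and t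
    using integral_has_real_derivative[OF that(1), of t] that at_within_Icc_at[of a t T] by simp
  have "z T \<le> z a"
  proof (rule DERIV_nonpos_imp_decreasing_open[OF ab])
    fix t assume t: "a < t" "t < T"
    let ?D = "exp (- \<beta> * (t - a)) * (- \<beta>) * integral {a..t} u + exp (- \<beta> * (t - a)) * u t - G t"
    have "DERIV z t :> ?D"
      unfolding z_def by (rule derivative_eq_intros der[OF u t] der[OF G t] refl)+ (simp add: algebra_simps)
    moreover have "?D \<le> 0"
    proof -
      have "?D = exp (- \<beta> * (t - a)) * (u t - \<beta> * integral {a..t} u) - G t" by (simp add: algebra_simps)
      also have "\<dots> \<le> exp (- \<beta> * (t - a)) * G t - G t"
        using le[of t] t by (intro diff_right_mono mult_left_mono) auto
      also have "\<dots> \<le> 0"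
        using \<beta> t G0[of t] by (simp add: mult_left_le_one_le)
      finally show ?thesis .
    qed
    ultimately show "\<exists>y. DERIV z t :> y \<and> y \<le> 0" by blast
  next
    show "continuous_on {a..T} z"
      unfolding z_def by (intro continuous_intros indefinite_integral_continuous_1 integrable_continuous_real u G)
  qed
  then have "exp (- \<beta> * (T - a)) * integral {a..T} u \<le> integral {a..T} G"
    by (simp add: z_def)
  then have "exp (\<beta> * (T - a)) * (exp (- \<beta> * (T - a)) * integral {a..T} u) \<le> exp (\<beta> * (T - a)) * integral {a..T} G"
    by (intro mult_left_mono) auto
  then have "integral {a..T} u \<le> exp (\<beta> * (T - a)) * integral {a..T} G"
    by (simp add: mult.assoc[symmetric] exp_add[symmetric])
  then have "\<beta> * integral {a..T} u \<le> \<beta> * (exp (\<beta> * (T - a)) * integral {a..T} G)"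
    using \<beta> by (rule mult_left_mono)
  then show ?thesis using le[of T] ab by (simp add: mult.assoc)
qed

lemma matrix_family_bound:
  fixes A :: "'i::finite \<Rightarrow> real^'n^'m"
  obtains a where "0 < a" "\<And>i v. norm (A i *v v) \<le> a * norm v"
proof -
  have "\<exists>K>0. \<forall>v. norm (A i *v v) \<le> norm v * K" for i
    using bounded_linear.pos_bounded[OF matrix_vector_mul_bounded_linear[of "A i"]] by auto
  then obtain K where K: "\<And>i. 0 < K i" "\<And>i v. norm (A i *v v) \<le> norm v * K i" by metis
  show ?thesis
  proof
    show "0 < (\<Sum>i\<in>UNIV. K i)" using K by (intro sum_pos) auto
    show "norm (A i *v v) \<le> (\<Sum>i\<in>UNIV. K i) * norm v" for i v
    proof -
      have "K i \<le> (\<Sum>i\<in>UNIV. K i)" using K(1) by (intro member_le_sum) (auto intro: less_imp_le)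
      then have "norm v * K i \<le> norm v * (\<Sum>i\<in>UNIV. K i)" by (intro mult_left_mono) auto
      then show ?thesis using K(2)[of i v] by (simp add: mult.commute)
    qed
  qed
qed

section \<open>Second moments of the solution\<close>

text \<open>This is the Ito integral read off from the path. The versions \<open>I\<close> supplied
  by \<open>has_ito_integral\<close> are chosen for each time separately and up to null sets; this
  process is defined for all times at once and inherits its continuity from
  \<open>x\<close>.\<close>

definition noise_part :: "('i \<Rightarrow> real^'n^'n) \<Rightarrow> (real \<Rightarrow> 'a \<Rightarrow> 'i) \<Rightarrow> (real \<Rightarrow> 'a \<Rightarrow> real^'n) \<Rightarrow>
    real \<Rightarrow> real^'n \<Rightarrow> real \<Rightarrow> 'a \<Rightarrow> real^'n" where
  "noise_part A r x t0 x0 t \<omega> = x t \<omega> - x0 - (LINT s:{t0..t}|lborel. A (r s \<omega>) *v x s \<omega>)"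

lemma norm_sq_measurable:
  fixes f :: "'a \<Rightarrow> 'b::euclidean_space"
  assumes [measurable]: "f \<in> borel_measurable M"
  shows "(\<lambda>\<omega>. (norm (f \<omega>))\<^sup>2) \<in> borel_measurable M"
  by measurable

text \<open>The path properties hold for every outcome, not just almost every one, so that pathwise
  integrals and joint measurability need no exceptional sets. The original processes will be
  modified on a null set to satisfy this.\<close>

locale regular_paths = prob_space M for M :: "'a measure" +
  fixes t0 :: real and x :: "real \<Rightarrow> 'a \<Rightarrow> real^'n" and r :: "real \<Rightarrow> 'a \<Rightarrow> 'i::finite"
    and A :: "'i \<Rightarrow> real^'n^'n" and x0 :: "real^'n" and a :: real
  assumes x_measurable: "\<And>t. t0 \<le> t \<Longrightarrow> x t \<in> borel_measurable M"
    and x_continuous: "\<And>\<omega>. \<omega> \<in> space M \<Longrightarrow> continuous_on {t0..} (\<lambda>t. x t \<omega>)"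
    and r_measurable: "\<And>t. t0 \<le> t \<Longrightarrow> r t \<in> measurable M (count_space UNIV)"
    and r_right: "\<And>\<omega> t. \<omega> \<in> space M \<Longrightarrow> t0 \<le> t \<Longrightarrow> \<forall>\<^sub>F u in at_right t. r u \<omega> = r t \<omega>"
    and a: "0 < a" "\<And>i v. norm (A i *v v) \<le> a * norm v"
begin

abbreviation noise :: "real \<Rightarrow> 'a \<Rightarrow> real^'n" where
  "noise \<equiv> noise_part A r x t0 x0"

lemma mode_measurable:
  assumes "t0 \<le> t" "\<And>i. f i \<in> measurable M N"
  shows "(\<lambda>\<omega>. f (r t \<omega>) \<omega>) \<in> measurable M N"
  by (rule measurable_compose_countable[where f=f and g="r t", OF assms(2) r_measurable[OF assms(1)]])

lemma mult_x_measurable: "t0 \<le> t \<Longrightarrow> (\<lambda>\<omega>. B *v x t \<omega>) \<in> borel_measurable M" for B :: "real^'n^'m"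
  by (rule measurable_compose[OF x_measurable])
    (assumption, intro borel_measurable_continuous_onI linear_continuous_on matrix_vector_mul_bounded_linear)

lemma x_tendsto_right: "\<omega> \<in> space M \<Longrightarrow> t0 \<le> t \<Longrightarrow> ((\<lambda>u. x u \<omega>) \<longlongrightarrow> x t \<omega>) (at_right t)"
proof -
  assume \<omega>: "\<omega> \<in> space M" and t: "t0 \<le> t"
  then have "((\<lambda>u. x u \<omega>) \<longlongrightarrow> x t \<omega>) (at t within {t0..})"
    using x_continuous[OF \<omega>] by (auto simp: continuous_on_def)
  then show ?thesis
    by (rule tendsto_within_subset) (use t in auto)
qed

lemma mode_tendsto_right:
  assumes "\<omega> \<in> space M" "t0 \<le> t" "\<And>i. ((\<lambda>u. f i u) \<longlongrightarrow> f i t) (at_right t)"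
  shows "((\<lambda>u. f (r u \<omega>) u) \<longlongrightarrow> f (r t \<omega>) t) (at_right t)"
proof (rule Lim_transform_eventually[OF assms(3)])
  show "\<forall>\<^sub>F u in at_right t. f (r t \<omega>) u = f (r u \<omega>) u"
    using r_right[OF assms(1,2)] by eventually_elim simp
qed

lemma Ax_joint: "(\<lambda>(\<omega>, s). A (r (max t0 s) \<omega>) *v x (max t0 s) \<omega>) \<in> borel_measurable (M \<Otimes>\<^sub>M lborel)"
proof (rule borel_measurable_right_continuous[where f="\<lambda>s \<omega>. A (r s \<omega>) *v x s \<omega>"])
  show "(\<lambda>\<omega>. A (r t \<omega>) *v x t \<omega>) \<in> borel_measurable M" if "t0 \<le> t" for t
    by (rule mode_measurable[OF that, where f="\<lambda>i \<omega>. A i *v x t \<omega>"]) (rule mult_x_measurable[OF that])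
  show "((\<lambda>u. A (r u \<omega>) *v x u \<omega>) \<longlongrightarrow> A (r t \<omega>) *v x t \<omega>) (at_right t)" if "\<omega> \<in> space M" "t0 \<le> t" for t \<omega>
    by (rule mode_tendsto_right[OF that, where f="\<lambda>i u. A i *v x u \<omega>"])
      (intro bounded_linear.tendsto[OF matrix_vector_mul_bounded_linear] x_tendsto_right that)
qed

lemma x_continuous_Icc: "\<omega> \<in> space M \<Longrightarrow> t0 \<le> u \<Longrightarrow> continuous_on {u..v} (\<lambda>s. x s \<omega>)"
  using x_continuous[of \<omega>] by (rule continuous_on_subset) auto

lemma set_borel_path:
  fixes f :: "real \<Rightarrow> 'a \<Rightarrow> 'b::{second_countable_topology, real_normed_vector}"
  assumes "(\<lambda>(\<omega>, s). f (max t0 s) \<omega>) \<in> borel_measurable (M \<Otimes>\<^sub>M lborel)" "\<omega> \<in> space M" "t0 \<le> u"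
  shows "set_borel_measurable lborel {u..v} (\<lambda>s. f s \<omega>)"
proof -
  have [measurable]: "(\<lambda>s. f (max t0 s) \<omega>) \<in> borel_measurable lborel"
    using measurable_compose[OF measurable_Pair1'[OF assms(2)] assms(1)] by simp
  have "(\<lambda>s. indicator {u..v} s *\<^sub>R f (max t0 s) \<omega>) \<in> borel_measurable lborel" by measurable
  also have "(\<lambda>s. indicator {u..v} s *\<^sub>R f (max t0 s) \<omega>) = (\<lambda>s. indicator {u..v} s *\<^sub>R f s \<omega>)"
    using assms(3) by (auto simp: fun_eq_iff indicator_def max_def)
  finally show ?thesis unfolding set_borel_measurable_def .
qed

lemma Ax_integrable:
  assumes \<omega>: "\<omega> \<in> space M" and u: "t0 \<le> u"
  shows "set_integrable lborel {u..v} (\<lambda>s. A (r s \<omega>) *v x s \<omega>)"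
proof (rule set_integrable_bound)
  show "set_integrable lborel {u..v} (\<lambda>s. a * norm (x s \<omega>))"
    by (intro borel_integrable_atLeastAtMost' continuous_intros x_continuous_Icc \<omega> u)
  show "set_borel_measurable lborel {u..v} (\<lambda>s. A (r s \<omega>) *v x s \<omega>)"
    by (rule set_borel_path[OF Ax_joint \<omega> u])
  show "AE s in lborel. s \<in> {u..v} \<longrightarrow> norm (A (r s \<omega>) *v x s \<omega>) \<le> norm (a * norm (x s \<omega>))"
    using a by (auto simp: abs_mult)
qed

lemma norm_drift_le:
  assumes \<omega>: "\<omega> \<in> space M" and u: "t0 \<le> u" "u \<le> v"
  shows "(norm (LINT s:{u..v}|lborel. A (r s \<omega>) *v x s \<omega>))\<^sup>2 \<le>
    a\<^sup>2 * (v - u) * (LINT s:{u..v}|lborel. (norm (x s \<omega>))\<^sup>2)"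
proof -
  have cx: "continuous_on {u..v} (\<lambda>s. x s \<omega>)" by (rule x_continuous_Icc[OF \<omega> u(1)])
  have i: "set_integrable lborel {u..v} (\<lambda>s. a * norm (x s \<omega>))"
    by (intro borel_integrable_atLeastAtMost' continuous_intros cx)
  have "norm (LINT s:{u..v}|lborel. A (r s \<omega>) *v x s \<omega>) \<le> (LINT s:{u..v}|lborel. norm (A (r s \<omega>) *v x s \<omega>))"
    by (rule set_integral_norm_bound[OF Ax_integrable[OF \<omega> u(1)]])
  also have "\<dots> \<le> (LINT s:{u..v}|lborel. a * norm (x s \<omega>))"
    by (rule set_integral_mono[OF set_integrable_norm[OF Ax_integrable[OF \<omega> u(1)]] i a(2)])
  finally have "(norm (LINT s:{u..v}|lborel. A (r s \<omega>) *v x s \<omega>))\<^sup>2 \<le> (LINT s:{u..v}|lborel. a * norm (x s \<omega>))\<^sup>2"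
    by (intro power_mono) auto
  also have "\<dots> \<le> (v - u) * (LINT s:{u..v}|lborel. (a * norm (x s \<omega>))\<^sup>2)"
    by (intro square_set_integral_le u i borel_integrable_atLeastAtMost' continuous_intros cx)
  finally show ?thesis by (simp add: power_mult_distrib ac_simps)
qed

lemma drift_combine:
  assumes \<omega>: "\<omega> \<in> space M" and u: "t0 \<le> s" "s \<le> t"
  shows "(LINT s:{t0..t}|lborel. A (r s \<omega>) *v x s \<omega>) =
    (LINT s:{t0..s}|lborel. A (r s \<omega>) *v x s \<omega>) + (LINT s:{s..t}|lborel. A (r s \<omega>) *v x s \<omega>)"
proof -
  have e: "(LINT s:{u..v}|lborel. A (r s \<omega>) *v x s \<omega>) = integral {u..v} (\<lambda>s. A (r s \<omega>) *v x s \<omega>)"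
    if "t0 \<le> u" for u v
    by (rule set_borel_integral_eq_integral(2)[OF Ax_integrable[OF \<omega> that]])
  have "(\<lambda>s. A (r s \<omega>) *v x s \<omega>) integrable_on {t0..t}"
    by (rule set_borel_integral_eq_integral(1)[OF Ax_integrable[OF \<omega> order_refl]])
  from Henstock_Kurzweil_Integration.integral_combine[OF u this]
  show ?thesis using e u by simp
qed

lemma x_increment:
  assumes \<omega>: "\<omega> \<in> space M" and u: "t0 \<le> s" "s \<le> t"
  shows "x t \<omega> = x s \<omega> + (LINT s:{s..t}|lborel. A (r s \<omega>) *v x s \<omega>) + (noise t \<omega> - noise s \<omega>)"
  using drift_combine[OF assms] by (simp add: noise_part_def)

lemma noise_continuous:
  assumes \<omega>: "\<omega> \<in> space M"
  shows "continuous_on {t0..T} (\<lambda>t. noise t \<omega>)"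
proof -
  have "continuous_on {t0..T} (\<lambda>t. integral {t0..t} (\<lambda>s. A (r s \<omega>) *v x s \<omega>))"
    by (rule indefinite_integral_continuous_1[OF set_borel_integral_eq_integral(1)[OF Ax_integrable[OF \<omega> order_refl]]])
  moreover have "(LINT s:{t0..t}|lborel. A (r s \<omega>) *v x s \<omega>) = integral {t0..t} (\<lambda>s. A (r s \<omega>) *v x s \<omega>)" for t
    by (rule set_borel_integral_eq_integral(2)[OF Ax_integrable[OF \<omega> order_refl]])
  ultimately show ?thesis
    unfolding noise_part_def by (intro continuous_intros x_continuous_Icc \<omega>) simp_all
qed

lemma drift_measurable:
  assumes "t0 \<le> u"
  shows "(\<lambda>\<omega>. LINT s:{u..v}|lborel. A (r s \<omega>) *v x s \<omega>) \<in> borel_measurable M"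
proof -
  have "(\<lambda>(\<omega>, s). indicator {u..v} s *\<^sub>R (A (r (max t0 s) \<omega>) *v x (max t0 s) \<omega>)) \<in> borel_measurable (M \<Otimes>\<^sub>M lborel)"
    using Ax_joint unfolding split_beta' by measurable
  from lborel.borel_measurable_lebesgue_integral[OF this]
  have "(\<lambda>\<omega>. LINT s|lborel. indicator {u..v} s *\<^sub>R (A (r (max t0 s) \<omega>) *v x (max t0 s) \<omega>)) \<in> borel_measurable M"
    by simp
  also have "(\<lambda>\<omega>. LINT s|lborel. indicator {u..v} s *\<^sub>R (A (r (max t0 s) \<omega>) *v x (max t0 s) \<omega>)) =
      (\<lambda>\<omega>. LINT s:{u..v}|lborel. A (r s \<omega>) *v x s \<omega>)"
    unfolding set_lebesgue_integral_def using assms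
    by (intro ext Bochner_Integration.integral_cong) (auto simp: indicator_def max_def)
  finally show ?thesis .
qed

lemma noise_measurable:
  assumes t: "t0 \<le> t"
  shows "noise t \<in> borel_measurable M"
proof -
  have "(\<lambda>\<omega>. x t \<omega> - x0 - (LINT s:{t0..t}|lborel. A (r s \<omega>) *v x s \<omega>)) \<in> borel_measurable M"
    by (rule borel_measurable_diff[OF borel_measurable_diff[OF x_measurable[OF t] borel_measurable_const] drift_measurable[OF order_refl]])
  also have "(\<lambda>\<omega>. x t \<omega> - x0 - (LINT s:{t0..t}|lborel. A (r s \<omega>) *v x s \<omega>)) = noise t"
    by (rule ext) (simp only: noise_part_def)
  finally show ?thesis .
qed

lemma noise_joint: "(\<lambda>(\<omega>, s). noise (max t0 s) \<omega>) \<in> borel_measurable (M \<Otimes>\<^sub>M lborel)"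
proof (rule borel_measurable_right_continuous[where f=noise, OF noise_measurable])
  fix t \<omega> assume \<omega>: "\<omega> \<in> space M" and t: "t0 \<le> t"
  have "continuous_on {t..t + 1} (\<lambda>t. noise t \<omega>)"
    by (rule continuous_on_subset[OF noise_continuous[OF \<omega>, of "t + 1"]]) (use t in auto)
  then have "((\<lambda>u. noise u \<omega>) \<longlongrightarrow> noise t \<omega>) (at t within {t..t + 1})"
    by (auto simp: continuous_on_def)
  then show "((\<lambda>u. noise u \<omega>) \<longlongrightarrow> noise t \<omega>) (at_right t)"
    by (simp add: at_within_Icc_at_right)
qed

lemma x_joint: "(\<lambda>(\<omega>, s). x (max t0 s) \<omega>) \<in> borel_measurable (M \<Otimes>\<^sub>M lborel)"
  by (rule borel_measurable_right_continuous[where f=x, OF x_measurable x_tendsto_right])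

end

text \<open>The probabilistic input of the one-step estimate, with the Wiener process itself
  eliminated. In \<open>noise_orthogonal\<close> the mode is taken at the later time
  \<open>t\<close>, which is the form required by the weight \<open>P (r t)\<close>. Integrability
  appears as a premise in the last two laws because second moments are established only inside this
  locale.\<close>

locale switched_paths = regular_paths M t0 x r A x0 a
  for M :: "'a measure" and t0 :: real and x :: "real \<Rightarrow> 'a \<Rightarrow> real^'n" and r :: "real \<Rightarrow> 'a \<Rightarrow> 'i::finite"
    and A :: "'i \<Rightarrow> real^'n^'n" and x0 :: "real^'n" and a :: real +
  fixes c :: real and q :: "real^'i^'i" and p :: "'i \<Rightarrow> 'i \<Rightarrow> real \<Rightarrow> real"
  assumes x_initial: "AE \<omega> in M. x t0 \<omega> = x0"
    and c_nonneg: "0 \<le> c"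
    and noise_bound: "\<And>s t. t0 \<le> s \<Longrightarrow> s \<le> t \<Longrightarrow>
        (\<integral>\<^sup>+\<omega>. ennreal ((norm (noise t \<omega> - noise s \<omega>))\<^sup>2) \<partial>M) \<le> ennreal (c * (t - s))"
    and noise_orthogonal: "\<And>s t j k l. t0 \<le> s \<Longrightarrow> s \<le> t \<Longrightarrow> sq_integrable M (\<lambda>\<omega>. x s \<omega> $ k) \<Longrightarrow>
        (LINT \<omega>|M. (indicator {j} (r t \<omega>) * x s \<omega> $ k) *
          (noise t \<omega> - noise s \<omega>) $ l) = 0"
    and transition: "\<And>t h i j k l. t0 \<le> t \<Longrightarrow> 0 < h \<Longrightarrow> integrable M (\<lambda>\<omega>. x t \<omega> $ k * x t \<omega> $ l) \<Longrightarrow>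
        (LINT \<omega>|M. x t \<omega> $ k * x t \<omega> $ l * (indicator {i} (r t \<omega>) * indicator {j} (r (t + h) \<omega>))) =
        p i j h * (LINT \<omega>|M. x t \<omega> $ k * x t \<omega> $ l * indicator {i} (r t \<omega>))"
    and transition_rate: "\<And>i j. (\<lambda>h. p i j h - ((if j = i then 1 else 0) + q $ i $ j * h)) \<in> o[at_right 0](\<lambda>h. h)"
begin

lemma noise_second_moment:
  assumes "t0 \<le> s" "s \<le> t"
  shows "integrable M (\<lambda>\<omega>. (norm (noise t \<omega> - noise s \<omega>))\<^sup>2)"
    and "(LINT \<omega>|M. (norm (noise t \<omega> - noise s \<omega>))\<^sup>2) \<le> c * (t - s)"
proof -
  have m: "(\<lambda>\<omega>. (norm (noise t \<omega> - noise s \<omega>))\<^sup>2) \<in> borel_measurable M"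
    using assms by (intro norm_sq_measurable borel_measurable_diff noise_measurable) auto
  from le_less_trans[OF noise_bound[OF assms] ennreal_less_top]
  show int: "integrable M (\<lambda>\<omega>. (norm (noise t \<omega> - noise s \<omega>))\<^sup>2)"
    using m by (intro integrableI_nonneg) auto
  show "(LINT \<omega>|M. (norm (noise t \<omega> - noise s \<omega>))\<^sup>2) \<le> c * (t - s)"
    using noise_bound[OF assms] int c_nonneg assms
    by (subst (asm) nn_integral_eq_integral) (auto simp: ennreal_le_iff)
qed

lemma noise_initial: "AE \<omega> in M. noise t0 \<omega> = 0"
proof -
  have "AE s in lborel. indicator {t0..t0} s *\<^sub>R (A (r s \<omega>) *v x s \<omega>) = 0" for \<omega>
    using AE_lborel_singleton[of t0] by eventually_elim (auto simp: indicator_def)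
  then have "(LINT s:{t0..t0}|lborel. A (r s \<omega>) *v x s \<omega>) = 0" for \<omega>
    unfolding set_lebesgue_integral_def by (rule integral_eq_zero_AE)
  then show ?thesis
    using x_initial by (auto simp: noise_part_def)
qed

lemma noise_second_moment0:
  assumes "t0 \<le> t"
  shows "integrable M (\<lambda>\<omega>. (norm (noise t \<omega>))\<^sup>2)" "(LINT \<omega>|M. (norm (noise t \<omega>))\<^sup>2) \<le> c * (t - t0)"
proof -
  have ae: "AE \<omega> in M. (norm (noise t \<omega> - noise t0 \<omega>))\<^sup>2 = (norm (noise t \<omega>))\<^sup>2"
    using noise_initial by eventually_elim simp
  have m: "(\<lambda>\<omega>. (norm (noise t \<omega>))\<^sup>2) \<in> borel_measurable M"
    using assms by (intro norm_sq_measurable noise_measurable) auto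
  have m': "(\<lambda>\<omega>. (norm (noise t \<omega> - noise t0 \<omega>))\<^sup>2) \<in> borel_measurable M"
    using assms by (intro norm_sq_measurable borel_measurable_diff noise_measurable) auto
  show "integrable M (\<lambda>\<omega>. (norm (noise t \<omega>))\<^sup>2)"
    using noise_second_moment(1)[OF order_refl assms] integrable_cong_AE[OF m' m ae] by simp
  show "(LINT \<omega>|M. (norm (noise t \<omega>))\<^sup>2) \<le> c * (t - t0)"
    using noise_second_moment(2)[OF order_refl assms] integral_cong_AE[OF m' m ae] by simp
qed

text \<open>Gronwall for the expectation would presuppose that it is finite. For each path, however,
  \<open>|x|^2\<close> is bounded by the initial value, the squared noise and an integral of
  \<open>|x|^2\<close>; Gronwall removes the integral, and what remains has finite expectation by
  \<open>noise_bound\<close>.\<close>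

lemma x_second_moment:
  assumes T: "t0 \<le> T"
  obtains K where "0 \<le> K" "\<And>t. t0 \<le> t \<Longrightarrow> t \<le> T \<Longrightarrow> integrable M (\<lambda>\<omega>. (norm (x t \<omega>))\<^sup>2)"
    "\<And>t. t0 \<le> t \<Longrightarrow> t \<le> T \<Longrightarrow> (LINT \<omega>|M. (norm (x t \<omega>))\<^sup>2) \<le> K"
proof -
  \<comment> \<open>The 3 comes from splitting the state into initial value, noise and drift, and
    \<open>a^2\<close> times the length of time from Cauchy-Schwarz for the drift. \<open>g\<close>
    will bound the expectation of the forcing \<open>G\<close> uniformly up to
    \<open>T\<close>.\<close>
  define \<beta> where "\<beta> = 3 * a\<^sup>2 * (T - t0)"
  define G where "G s \<omega> = 3 * (norm x0)\<^sup>2 + 3 * (norm (noise s \<omega>))\<^sup>2" for s \<omega>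
  define g where "g = 3 * (norm x0)\<^sup>2 + 3 * (c * (T - t0))"
  define E where "E = \<beta> * exp (\<beta> * (T - t0))"
  have b0: "0 \<le> \<beta>" "0 \<le> g" "0 \<le> E" using T c_nonneg by (auto simp: \<beta>_def g_def E_def)
  have G0: "0 \<le> G s \<omega>" for s \<omega> by (simp add: G_def)
  have Gint: "integrable M (G s)" "(LINT \<omega>|M. G s \<omega>) \<le> g" if "t0 \<le> s" "s \<le> T" for s
  proof -
    show "integrable M (G s)" unfolding G_def using noise_second_moment0(1)[OF that(1)] by simp
    have "(LINT \<omega>|M. G s \<omega>) = 3 * (norm x0)\<^sup>2 + 3 * (LINT \<omega>|M. (norm (noise s \<omega>))\<^sup>2)"
      unfolding G_def using noise_second_moment0(1)[OF that(1)] by (simp add: prob_space)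
    also have "\<dots> \<le> 3 * (norm x0)\<^sup>2 + 3 * (c * (s - t0))"
      using noise_second_moment0(2)[OF that(1)] by simp
    also have "\<dots> \<le> g" unfolding g_def using that c_nonneg by (intro add_left_mono mult_left_mono) auto
    finally show "(LINT \<omega>|M. G s \<omega>) \<le> g" .
  qed
  have main: "integrable M (\<lambda>\<omega>. (norm (x t \<omega>))\<^sup>2) \<and> (LINT \<omega>|M. (norm (x t \<omega>))\<^sup>2) \<le> g + E * (g * (T - t0))"
    if t: "t0 \<le> t" "t \<le> T" for t
  proof -
    let ?I = "\<lambda>\<omega>. LINT s:{t0..t}|lborel. G s \<omega>"
    have Gc: "continuous_on {t0..t} (\<lambda>s. G s \<omega>)" if "\<omega> \<in> space M" for \<omega>
      unfolding G_def by (intro continuous_intros noise_continuous that)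
    have I: "integrable M ?I" "(LINT \<omega>|M. ?I \<omega>) \<le> g * (t - t0)"
    proof -
      let ?G = "\<lambda>s \<omega>. G (max t0 s) \<omega>"
      have e: "?I = (\<lambda>\<omega>. LINT s:{t0..t}|lborel. ?G s \<omega>)"
        by (intro ext set_lebesgue_integral_cong) (auto simp: max_def)
      have 1: "(\<lambda>(\<omega>, s). ?G s \<omega>) \<in> borel_measurable (M \<Otimes>\<^sub>M lborel)"
        using noise_joint unfolding split_beta' G_def by measurable
      have 2: "(\<integral>\<^sup>+\<omega>. ennreal (?G s \<omega>) \<partial>M) \<le> ennreal g" if "s \<in> {t0..t}" for s
        using Gint[of s] that t G0 by (subst nn_integral_eq_integral) (auto intro: ennreal_leI)
      have 3: "set_integrable lborel {t0..t} (\<lambda>s. ?G s \<omega>)" if "\<omega> \<in> space M" for \<omega>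
      proof (rule borel_integrable_atLeastAtMost')
        show "continuous_on {t0..t} (\<lambda>s. ?G s \<omega>)"
          using Gc[OF that] by (rule continuous_on_cong[THEN iffD1, rotated 2]) (auto simp: max_def)
      qed
      show "integrable M ?I" "(LINT \<omega>|M. ?I \<omega>) \<le> g * (t - t0)"
        unfolding e using integral_time_bound[OF 1 _ t(1) 2 b0(2) 3] G0 by auto
    qed
    have pt: "(norm (x t \<omega>))\<^sup>2 \<le> G t \<omega> + E * ?I \<omega>" if \<omega>: "\<omega> \<in> space M" for \<omega>
    proof -
      let ?u = "\<lambda>s. (norm (x s \<omega>))\<^sup>2"
      have u: "continuous_on {t0..t} ?u" by (intro continuous_intros x_continuous_Icc \<omega>) simp
      have le: "?u s \<le> G s \<omega> + \<beta> * integral {t0..s} ?u" if s: "s \<in> {t0..t}" for s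
      proof -
        let ?d = "LINT s:{t0..s}|lborel. A (r s \<omega>) *v x s \<omega>"
        have us: "continuous_on {t0..s} ?u" by (intro continuous_intros x_continuous_Icc \<omega>) simp
        have int: "(LINT s:{t0..s}|lborel. ?u s) = integral {t0..s} ?u"
          by (rule set_borel_integral_eq_integral(2)[OF borel_integrable_atLeastAtMost'[OF us]])
        have nn: "0 \<le> integral {t0..s} ?u"
          by (intro Henstock_Kurzweil_Integration.integral_nonneg integrable_continuous_real us) auto
        have "?u s = (norm (x0 + noise s \<omega> + ?d))\<^sup>2" by (simp add: noise_part_def)
        also have "\<dots> \<le> 3 * ((norm x0)\<^sup>2 + (norm (noise s \<omega>))\<^sup>2 + (norm ?d)\<^sup>2)" by (rule norm_add3_sq)
        also have "\<dots> = G s \<omega> + 3 * (norm ?d)\<^sup>2" by (simp add: G_def)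
        also have "(norm ?d)\<^sup>2 \<le> a\<^sup>2 * (s - t0) * integral {t0..s} ?u"
          using norm_drift_le[OF \<omega> order_refl, of s] s unfolding int by simp
        also have "\<dots> \<le> a\<^sup>2 * (T - t0) * integral {t0..s} ?u"
          using s t nn by (intro mult_right_mono mult_left_mono) auto
        finally show ?thesis by (simp add: \<beta>_def)
      qed
      have "?u t \<le> G t \<omega> + \<beta> * exp (\<beta> * (t - t0)) * integral {t0..t} (\<lambda>s. G s \<omega>)"
        by (rule gronwall_integral[OF t(1) u Gc[OF \<omega>] G0 b0(1) le])
      also have "integral {t0..t} (\<lambda>s. G s \<omega>) = ?I \<omega>"
        by (rule set_borel_integral_eq_integral(2)[symmetric, OF borel_integrable_atLeastAtMost'[OF Gc[OF \<omega>]]])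
      also have "G t \<omega> + \<beta> * exp (\<beta> * (t - t0)) * ?I \<omega> \<le> G t \<omega> + E * ?I \<omega>"
      proof (intro add_left_mono mult_right_mono)
        show "\<beta> * exp (\<beta> * (t - t0)) \<le> E" unfolding E_def using b0 t by (intro mult_left_mono) (auto intro: mult_left_mono)
        show "0 \<le> ?I \<omega>" unfolding set_lebesgue_integral_def using G0 by simp
      qed
      finally show ?thesis .
    qed
    have bd: "integrable M (\<lambda>\<omega>. G t \<omega> + E * ?I \<omega>)" using Gint(1)[OF t] I(1) by simp
    have int: "integrable M (\<lambda>\<omega>. (norm (x t \<omega>))\<^sup>2)"
    proof (rule Bochner_Integration.integrable_bound[OF bd])
      show "AE \<omega> in M. norm ((norm (x t \<omega>))\<^sup>2) \<le> norm (G t \<omega> + E * ?I \<omega>)"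
        using pt by (intro AE_I2) (force intro: order_trans abs_ge_self)
    qed (use x_measurable[OF t(1)] in measurable)
    have "(LINT \<omega>|M. (norm (x t \<omega>))\<^sup>2) \<le> (LINT \<omega>|M. G t \<omega> + E * ?I \<omega>)"
      by (rule integral_mono[OF int bd pt])
    also have "\<dots> = (LINT \<omega>|M. G t \<omega>) + E * (LINT \<omega>|M. ?I \<omega>)"
      using Gint(1)[OF t] I(1) by simp
    also have "\<dots> \<le> g + E * (g * (t - t0))"
      using Gint(2)[OF t] I(2) b0 by (intro add_mono mult_left_mono) auto
    also have "\<dots> \<le> g + E * (g * (T - t0))"
      using b0 t by (intro add_left_mono mult_left_mono) auto
    finally show ?thesis using int by blast
  qed
  show ?thesis
  proof (rule that[of "g + E * (g * (T - t0))"])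
    show "0 \<le> g + E * (g * (T - t0))" using b0 T by simp
  qed (use main in auto)
qed

end

lemma inner_symmetric_matrix:
  fixes B :: "real^'n^'n"
  assumes "transpose B = B"
  shows "u \<bullet> (B *v v) = v \<bullet> (B *v u)"
proof -
  have "u \<bullet> (B *v v) = (u v* B) \<bullet> v" by (rule dot_lmul_matrix[symmetric])
  also have "u v* B = B *v u" using transpose_matrix_vector[of B u] assms by simp
  finally show ?thesis by (simp add: inner_commute)
qed

lemma quadratic_form_sum:
  fixes B :: "real^'n^'n"
  shows "v \<bullet> (B *v u) = (\<Sum>k\<in>UNIV. \<Sum>l\<in>UNIV. B $ k $ l * (v $ k * u $ l))"
  by (simp add: inner_vec_def matrix_vector_mult_def sum_distrib_left ac_simps)

lemma indicator_bounds:
  "\<bar>indicator {i} y :: real\<bar> \<le> 1" "\<bar>indicator {i} y * indicator {j} z :: real\<bar> \<le> 1"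
  by (auto simp: indicator_def)

lemma sum_indicator_mult:
  fixes f :: "'i::finite \<Rightarrow> real"
  shows "(\<Sum>i\<in>UNIV. f i * indicator {i} y) = f y"
proof -
  have "(\<Sum>i\<in>UNIV. f i * indicator {i} y) = (\<Sum>i\<in>UNIV. if i = y then f i else 0)"
    by (intro sum.cong refl) (auto simp: indicator_def)
  then show ?thesis by simp
qed

lemma sum_indicator_mult2:
  fixes f :: "'i::finite \<Rightarrow> 'j::finite \<Rightarrow> real"
  shows "(\<Sum>i\<in>UNIV. \<Sum>j\<in>UNIV. f i j * (indicator {i} y * indicator {j} z)) = f y z"
proof -
  have "(\<Sum>i\<in>UNIV. \<Sum>j\<in>UNIV. f i j * (indicator {i} y * indicator {j} z)) =
      (\<Sum>i\<in>UNIV. (\<Sum>j\<in>UNIV. f i j * indicator {j} z) * indicator {i} y)"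
    by (simp only: sum_distrib_left sum_distrib_right ac_simps)
  then show ?thesis by (simp only: sum_indicator_mult)
qed

section \<open>Second moments of increments and of changes of mode\<close>

context switched_paths begin

lemma x_sq_int: "t0 \<le> t \<Longrightarrow> integrable M (\<lambda>\<omega>. (norm (x t \<omega>))\<^sup>2)"
  using x_second_moment[of t] by blast

lemma x_component_sq_integrable:
  assumes t: "t0 \<le> t"
  shows "sq_integrable M (\<lambda>\<omega>. x t \<omega> $ k)"
proof (rule sq_integrable_bound)
  show "sq_integrable M (\<lambda>\<omega>. norm (x t \<omega>))"
    using x_sq_int[OF t] measurable_compose[OF x_measurable[OF t] borel_measurable_norm]
    by (simp add: sq_integrable_def)
  show "(\<lambda>\<omega>. x t \<omega> $ k) \<in> borel_measurable M"
    by (rule measurable_compose[where g="\<lambda>v. v $ k", OF x_measurable[OF t]]) simp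
qed (simp add: component_le_norm_cart)

lemma path_expectation_bound:
  fixes f :: "real \<Rightarrow> 'a \<Rightarrow> real"
  assumes f: "(\<lambda>(\<omega>, s). f (max t0 s) \<omega>) \<in> borel_measurable (M \<Otimes>\<^sub>M lborel)"
    and nn: "\<And>s \<omega>. 0 \<le> f s \<omega>" and u: "t0 \<le> u" "u \<le> v" and B: "0 \<le> B"
    and bound: "\<And>s. u \<le> s \<Longrightarrow> s \<le> v \<Longrightarrow> integrable M (f s)" "\<And>s. u \<le> s \<Longrightarrow> s \<le> v \<Longrightarrow> (LINT \<omega>|M. f s \<omega>) \<le> B"
    and path: "\<And>\<omega>. \<omega> \<in> space M \<Longrightarrow> set_integrable lborel {u..v} (\<lambda>s. f s \<omega>)"
  shows "integrable M (\<lambda>\<omega>. LINT s:{u..v}|lborel. f s \<omega>)"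
    and "(LINT \<omega>|M. (LINT s:{u..v}|lborel. f s \<omega>)) \<le> B * (v - u)"
proof -
  let ?f = "\<lambda>s \<omega>. f (max t0 s) \<omega>"
  have e: "(\<lambda>\<omega>. LINT s:{u..v}|lborel. f s \<omega>) = (\<lambda>\<omega>. LINT s:{u..v}|lborel. ?f s \<omega>)"
    using u by (intro ext set_lebesgue_integral_cong) (auto simp: max_def)
  have 2: "(\<integral>\<^sup>+\<omega>. ennreal (?f s \<omega>) \<partial>M) \<le> ennreal B" if "s \<in> {u..v}" for s
    using bound[of s] that u nn by (subst nn_integral_eq_integral) (auto intro: ennreal_leI simp: max_def)
  have 3: "set_integrable lborel {u..v} (\<lambda>s. ?f s \<omega>)" if "\<omega> \<in> space M" for \<omega>
  proof -
    have "(\<lambda>s. indicator {u..v} s *\<^sub>R ?f s \<omega>) = (\<lambda>s. indicator {u..v} s *\<^sub>R f s \<omega>)"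
      using u by (auto simp: fun_eq_iff indicator_def max_def)
    then show ?thesis using path[OF that] by (simp add: set_integrable_def)
  qed
  show "integrable M (\<lambda>\<omega>. LINT s:{u..v}|lborel. f s \<omega>)" "(LINT \<omega>|M. (LINT s:{u..v}|lborel. f s \<omega>)) \<le> B * (v - u)"
    unfolding e using integral_time_bound[OF f _ u(2) 2 B 3] nn by auto
qed

lemma drift_second_moment:
  assumes u: "t0 \<le> u" "u \<le> v" and K: "0 \<le> K" "\<And>s. u \<le> s \<Longrightarrow> s \<le> v \<Longrightarrow> (LINT \<omega>|M. (norm (x s \<omega>))\<^sup>2) \<le> K"
  shows "integrable M (\<lambda>\<omega>. (norm (LINT s:{u..v}|lborel. A (r s \<omega>) *v x s \<omega>))\<^sup>2)"
    and "(LINT \<omega>|M. (norm (LINT s:{u..v}|lborel. A (r s \<omega>) *v x s \<omega>))\<^sup>2) \<le> a\<^sup>2 * (v - u)\<^sup>2 * K"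
proof -
  let ?I = "\<lambda>\<omega>. LINT s:{u..v}|lborel. (norm (x s \<omega>))\<^sup>2"
  have 1: "(\<lambda>(\<omega>, s). (norm (x (max t0 s) \<omega>))\<^sup>2) \<in> borel_measurable (M \<Otimes>\<^sub>M lborel)"
    using norm_sq_measurable[OF x_joint] by (simp add: split_beta')
  have 2: "set_integrable lborel {u..v} (\<lambda>s. (norm (x s \<omega>))\<^sup>2)" if "\<omega> \<in> space M" for \<omega>
    using that u by (intro borel_integrable_atLeastAtMost' continuous_intros x_continuous_Icc)
  have 3: "integrable M (\<lambda>\<omega>. (norm (x s \<omega>))\<^sup>2)" if "u \<le> s" for s
    using that u by (intro x_sq_int) simp
  note I = path_expectation_bound[where f="\<lambda>s \<omega>. (norm (x s \<omega>))\<^sup>2", OF 1 _ u K(1) 3 K(2) 2, simplified]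
  have pt: "(norm (LINT s:{u..v}|lborel. A (r s \<omega>) *v x s \<omega>))\<^sup>2 \<le> a\<^sup>2 * (v - u) * ?I \<omega>" if "\<omega> \<in> space M" for \<omega>
    by (rule norm_drift_le[OF that u])
  have bd: "integrable M (\<lambda>\<omega>. a\<^sup>2 * (v - u) * ?I \<omega>)" using I(1) by simp
  show int: "integrable M (\<lambda>\<omega>. (norm (LINT s:{u..v}|lborel. A (r s \<omega>) *v x s \<omega>))\<^sup>2)"
  proof (rule Bochner_Integration.integrable_bound[OF bd])
    show "AE \<omega> in M. norm ((norm (LINT s:{u..v}|lborel. A (r s \<omega>) *v x s \<omega>))\<^sup>2) \<le> norm (a\<^sup>2 * (v - u) * ?I \<omega>)"
      using pt by (intro AE_I2) (force intro: order_trans abs_ge_self)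
  qed (rule norm_sq_measurable[OF drift_measurable[OF u(1)]])
  have "(LINT \<omega>|M. (norm (LINT s:{u..v}|lborel. A (r s \<omega>) *v x s \<omega>))\<^sup>2) \<le> (LINT \<omega>|M. a\<^sup>2 * (v - u) * ?I \<omega>)"
    by (rule integral_mono[OF int bd pt])
  also have "\<dots> \<le> a\<^sup>2 * (v - u) * (K * (v - u))"
    using I(2) u by (simp add: mult_left_mono)
  finally show "(LINT \<omega>|M. (norm (LINT s:{u..v}|lborel. A (r s \<omega>) *v x s \<omega>))\<^sup>2) \<le> a\<^sup>2 * (v - u)\<^sup>2 * K"
    by (simp add: power2_eq_square ac_simps)
qed

lemma x_increment_second_moment:
  assumes u: "t0 \<le> u" "u \<le> v" "v \<le> T" and K: "0 \<le> K" "\<And>s. t0 \<le> s \<Longrightarrow> s \<le> T \<Longrightarrow> (LINT \<omega>|M. (norm (x s \<omega>))\<^sup>2) \<le> K"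
  shows "integrable M (\<lambda>\<omega>. (norm (x v \<omega> - x u \<omega>))\<^sup>2)"
    and "(LINT \<omega>|M. (norm (x v \<omega> - x u \<omega>))\<^sup>2) \<le> (3 * a\<^sup>2 * (T - t0) * K + 3 * c) * (v - u)"
proof -
  let ?d = "\<lambda>\<omega>. LINT s:{u..v}|lborel. A (r s \<omega>) *v x s \<omega>"
  let ?J = "\<lambda>\<omega>. noise v \<omega> - noise u \<omega>"
  have d: "integrable M (\<lambda>\<omega>. (norm (?d \<omega>))\<^sup>2)" "(LINT \<omega>|M. (norm (?d \<omega>))\<^sup>2) \<le> a\<^sup>2 * (v - u)\<^sup>2 * K"
    using drift_second_moment[OF u(1,2) K(1)] K(2) u by auto
  note J = noise_second_moment[OF u(1,2)]
  have pt: "(norm (x v \<omega> - x u \<omega>))\<^sup>2 \<le> 3 * ((norm (?d \<omega>))\<^sup>2 + (norm (?J \<omega>))\<^sup>2)" if "\<omega> \<in> space M" for \<omega>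
    using norm_add3_sq[of "?d \<omega>" "?J \<omega>" 0] x_increment[OF that u(1,2)] by simp
  have bd: "integrable M (\<lambda>\<omega>. 3 * ((norm (?d \<omega>))\<^sup>2 + (norm (?J \<omega>))\<^sup>2))" using d(1) J(1) by simp
  show int: "integrable M (\<lambda>\<omega>. (norm (x v \<omega> - x u \<omega>))\<^sup>2)"
  proof (rule Bochner_Integration.integrable_bound[OF bd])
    show "AE \<omega> in M. norm ((norm (x v \<omega> - x u \<omega>))\<^sup>2) \<le> norm (3 * ((norm (?d \<omega>))\<^sup>2 + (norm (?J \<omega>))\<^sup>2))"
      using pt by (intro AE_I2) (simp add: abs_of_nonneg)
  qed (use u in \<open>intro norm_sq_measurable borel_measurable_diff x_measurable; simp\<close>)
  have "(LINT \<omega>|M. (norm (x v \<omega> - x u \<omega>))\<^sup>2) \<le> (LINT \<omega>|M. 3 * ((norm (?d \<omega>))\<^sup>2 + (norm (?J \<omega>))\<^sup>2))"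
    by (rule integral_mono[OF int bd pt])
  also have "\<dots> = 3 * ((LINT \<omega>|M. (norm (?d \<omega>))\<^sup>2) + (LINT \<omega>|M. (norm (?J \<omega>))\<^sup>2))"
    using d(1) J(1) by simp
  also have "\<dots> \<le> 3 * (a\<^sup>2 * (v - u)\<^sup>2 * K + c * (v - u))"
    using d(2) J(2) by simp
  \<comment> \<open>One of the two factors \<open>v - u\<close> of the drift term is bounded by
    \<open>T - t0\<close>, so that drift and noise combine into a single bound linear in
    \<open>v - u\<close>.\<close>
  also have "\<dots> \<le> 3 * (a\<^sup>2 * ((T - t0) * (v - u)) * K + c * (v - u))"
    using u K(1) unfolding power2_eq_square[of "v - u"]
    by (intro mult_left_mono add_right_mono mult_right_mono) auto
  finally show "(LINT \<omega>|M. (norm (x v \<omega> - x u \<omega>))\<^sup>2) \<le> (3 * a\<^sup>2 * (T - t0) * K + 3 * c) * (v - u)"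
    by (simp add: algebra_simps)
qed

lemma quadratic_integrable:
  assumes t: "t0 \<le> t" and g: "g \<in> borel_measurable M" "\<And>\<omega>. \<bar>g \<omega>\<bar> \<le> 1"
  shows "integrable M (\<lambda>\<omega>. (x t \<omega> \<bullet> (B *v x t \<omega>)) * g \<omega>)"
proof -
  obtain b where b: "\<And>v. norm (B *v v) \<le> norm v * b"
    using bounded_linear.bounded[OF matrix_vector_mul_bounded_linear[of B]] by blast
  show ?thesis
  proof (rule Bochner_Integration.integrable_bound)
    show "integrable M (\<lambda>\<omega>. b * (norm (x t \<omega>))\<^sup>2)" using x_sq_int[OF t] by simp
    show "(\<lambda>\<omega>. (x t \<omega> \<bullet> (B *v x t \<omega>)) * g \<omega>) \<in> borel_measurable M"
      by (intro borel_measurable_times borel_measurable_inner x_measurable mult_x_measurable t g)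
    have "\<bar>(x t \<omega> \<bullet> (B *v x t \<omega>)) * g \<omega>\<bar> \<le> \<bar>b * (norm (x t \<omega>))\<^sup>2\<bar>" for \<omega>
    proof -
      have "\<bar>x t \<omega> \<bullet> (B *v x t \<omega>)\<bar> \<le> norm (x t \<omega>) * norm (B *v x t \<omega>)" by (rule Cauchy_Schwarz_ineq2)
      also have "\<dots> \<le> norm (x t \<omega>) * (norm (x t \<omega>) * b)" by (intro mult_left_mono b) auto
      finally have 1: "\<bar>x t \<omega> \<bullet> (B *v x t \<omega>)\<bar> \<le> b * (norm (x t \<omega>))\<^sup>2" by (simp add: power2_eq_square ac_simps)
      have "\<bar>(x t \<omega> \<bullet> (B *v x t \<omega>)) * g \<omega>\<bar> \<le> \<bar>x t \<omega> \<bullet> (B *v x t \<omega>)\<bar> * 1"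
        unfolding abs_mult by (intro mult_left_mono g) auto
      then show ?thesis using 1 by linarith
    qed
    then show "AE \<omega> in M. norm ((x t \<omega> \<bullet> (B *v x t \<omega>)) * g \<omega>) \<le> norm (b * (norm (x t \<omega>))\<^sup>2)" by simp
  qed
qed

lemma mode_indicator_measurable: "t0 \<le> t \<Longrightarrow> (\<lambda>\<omega>. indicator {i} (r t \<omega>) :: real) \<in> borel_measurable M"
  by (rule measurable_compose[OF r_measurable]) auto

lemma mode_pair_measurable:
  "t0 \<le> t \<Longrightarrow> t0 \<le> s \<Longrightarrow> (\<lambda>\<omega>. indicator {i} (r t \<omega>) * indicator {j} (r s \<omega>) :: real) \<in> borel_measurable M"
  by (intro borel_measurable_times mode_indicator_measurable)

text \<open>The quadratic form is split into monomials in the coordinates of the state, for which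
  the locale provides the transition law.\<close>

lemma transition_quadratic:
  assumes t: "t0 \<le> t" "0 < h"
  shows "(LINT \<omega>|M. (x t \<omega> \<bullet> (B *v x t \<omega>)) * (indicator {i} (r t \<omega>) * indicator {j} (r (t + h) \<omega>))) =
    p i j h * (LINT \<omega>|M. (x t \<omega> \<bullet> (B *v x t \<omega>)) * indicator {i} (r t \<omega>))"
proof -
  have th: "t0 \<le> t + h" using t by simp
  have int: "integrable M (\<lambda>\<omega>. x t \<omega> $ k * x t \<omega> $ l)" for k l
    by (intro sq_integrable_mult x_component_sq_integrable t)
  have intg: "integrable M (\<lambda>\<omega>. x t \<omega> $ k * x t \<omega> $ l * g \<omega>)"
    if "g \<in> borel_measurable M" "\<And>\<omega>. \<bar>g \<omega>\<bar> \<le> (1::real)" for g k l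
  proof (rule Bochner_Integration.integrable_bound[OF int[of k l]])
    show "AE \<omega> in M. norm (x t \<omega> $ k * x t \<omega> $ l * g \<omega>) \<le> norm (x t \<omega> $ k * x t \<omega> $ l)"
      using that(2) by (auto simp: abs_mult mult_left_le)
  qed (intro borel_measurable_times borel_measurable_integrable[OF int] that(1))
  have eq: "(LINT \<omega>|M. (x t \<omega> \<bullet> (B *v x t \<omega>)) * g \<omega>) =
      (\<Sum>k\<in>UNIV. \<Sum>l\<in>UNIV. B $ k $ l * (LINT \<omega>|M. x t \<omega> $ k * x t \<omega> $ l * g \<omega>))"
    if "g \<in> borel_measurable M" "\<And>\<omega>. \<bar>g \<omega>\<bar> \<le> (1::real)" for g
    unfolding quadratic_form_sum sum_distrib_right
    using intg[OF that] by (simp add: mult.assoc)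
  have "(LINT \<omega>|M. (x t \<omega> \<bullet> (B *v x t \<omega>)) * (indicator {i} (r t \<omega>) * indicator {j} (r (t + h) \<omega>))) =
      (\<Sum>k\<in>UNIV. \<Sum>l\<in>UNIV. B $ k $ l * (p i j h * (LINT \<omega>|M. x t \<omega> $ k * x t \<omega> $ l * indicator {i} (r t \<omega>))))"
    using transition[OF t int]
    by (subst eq[OF mode_pair_measurable[OF t(1) th] indicator_bounds(2)]) simp
  also have "\<dots> = p i j h * (\<Sum>k\<in>UNIV. \<Sum>l\<in>UNIV. B $ k $ l * (LINT \<omega>|M. x t \<omega> $ k * x t \<omega> $ l * indicator {i} (r t \<omega>)))"
    by (simp add: sum_distrib_left ac_simps)
  also have "\<dots> = p i j h * (LINT \<omega>|M. (x t \<omega> \<bullet> (B *v x t \<omega>)) * indicator {i} (r t \<omega>))"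
    by (subst eq[OF mode_indicator_measurable[OF t(1)] indicator_bounds(1)]) simp
  finally show ?thesis .
qed

text \<open>Only the modes at the two times are compared: an excursion that has returned by time
  \<open>s\<close> is not counted. This suffices, since the drift at time \<open>s\<close> depends
  on the mode at that time alone.\<close>

definition jump :: "real \<Rightarrow> real \<Rightarrow> 'a \<Rightarrow> real" where
  "jump t s \<omega> = (if r s \<omega> = r t \<omega> then 0 else 1)"

lemma jump_eq: "jump t s \<omega> = (\<Sum>i\<in>UNIV. \<Sum>j\<in>UNIV - {i}. indicator {i} (r t \<omega>) * indicator {j} (r s \<omega>))"
proof -
  have "(\<Sum>i\<in>UNIV. \<Sum>j\<in>UNIV - {i}. indicator {i} (r t \<omega>) * indicator {j} (r s \<omega>)) =
      (\<Sum>i\<in>UNIV. if i = r t \<omega> then (\<Sum>j\<in>UNIV - {i}. indicator {j} (r s \<omega>)) else (0::real))"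
    by (intro sum.cong refl) (auto simp: indicator_def)
  also have "\<dots> = (\<Sum>j\<in>UNIV - {r t \<omega>}. indicator {j} (r s \<omega>))"
    by (subst sum.delta) auto
  also have "\<dots> = (\<Sum>j\<in>UNIV - {r t \<omega>}. if j = r s \<omega> then 1 else (0::real))"
    by (intro sum.cong refl) (auto simp: indicator_def)
  also have "\<dots> = jump t s \<omega>"
    by (subst sum.delta) (auto simp: jump_def)
  finally show ?thesis by simp
qed

lemma jump_bounds: "0 \<le> jump t s \<omega>" "\<bar>jump t s \<omega>\<bar> \<le> 1"
  by (auto simp: jump_def)

lemma jump_measurable: "t0 \<le> t \<Longrightarrow> t0 \<le> s \<Longrightarrow> jump t s \<in> borel_measurable M"
  unfolding jump_eq[abs_def]
  by (intro borel_measurable_sum borel_measurable_times mode_indicator_measurable)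

lemma jump_joint:
  assumes "t0 \<le> t"
  shows "(\<lambda>(\<omega>, s). jump t (max t0 s) \<omega>) \<in> borel_measurable (M \<Otimes>\<^sub>M lborel)"
proof (rule borel_measurable_right_continuous[where f="jump t", OF jump_measurable[OF assms]])
  fix s \<omega> assume "\<omega> \<in> space M" "t0 \<le> s"
  from r_right[OF this] have "\<forall>\<^sub>F u in at_right s. jump t u \<omega> = jump t s \<omega>"
    by eventually_elim (simp add: jump_def)
  then show "((\<lambda>u. jump t u \<omega>) \<longlongrightarrow> jump t s \<omega>) (at_right s)" by (rule tendsto_eventually)
qed

text \<open>The summand 1, added for each pair, absorbs the error term of the transition
  probability, which is at most \<open>h\<close> for small \<open>h\<close>.\<close>

definition rate_sum :: real where
  "rate_sum = (\<Sum>i\<in>UNIV. \<Sum>j\<in>UNIV - {i}. \<bar>q $ i $ j\<bar> + 1)"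

lemma norm_sq_quadratic: "(norm v)\<^sup>2 = v \<bullet> (mat 1 *v v)" for v :: "real^'n"
  by (simp add: power2_norm_eq_inner)

text \<open>The weight \<open>|x t|^2\<close> is known at time \<open>t\<close> and passes through
  the conditional law of the later mode. The product is thus \<open>O(h)\<close> with second moments
  only; separating the two factors by Cauchy-Schwarz would call for a fourth moment.\<close>

lemma jump_second_moment:
  assumes t: "t0 \<le> t" "0 \<le> h" and K: "(LINT \<omega>|M. (norm (x t \<omega>))\<^sup>2) \<le> K"
    and p: "\<And>i j. 0 < h \<Longrightarrow> \<bar>p i j h - ((if j = i then 1 else 0) + q $ i $ j * h)\<bar> \<le> h"
  shows "integrable M (\<lambda>\<omega>. (norm (x t \<omega>))\<^sup>2 * jump t (t + h) \<omega>)"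
    and "(LINT \<omega>|M. (norm (x t \<omega>))\<^sup>2 * jump t (t + h) \<omega>) \<le> rate_sum * h * K"
proof -
  have th: "t0 \<le> t + h" using t by simp
  show "integrable M (\<lambda>\<omega>. (norm (x t \<omega>))\<^sup>2 * jump t (t + h) \<omega>)"
    unfolding norm_sq_quadratic
    by (intro quadratic_integrable t jump_measurable th jump_bounds)
  show "(LINT \<omega>|M. (norm (x t \<omega>))\<^sup>2 * jump t (t + h) \<omega>) \<le> rate_sum * h * K"
  proof (cases "h = 0")
    case True
    then show ?thesis by (simp add: jump_def)
  next
    case False
    then have h: "0 < h" using t by simp
    have int: "integrable M (\<lambda>\<omega>. (norm (x t \<omega>))\<^sup>2 * (indicator {i} (r t \<omega>) * indicator {j} (r (t + h) \<omega>)))" for i j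
      unfolding norm_sq_quadratic
      by (rule quadratic_integrable[OF t(1) mode_pair_measurable[OF t(1) th] indicator_bounds(2)])
    have m: "0 \<le> (LINT \<omega>|M. (norm (x t \<omega>))\<^sup>2 * indicator {i} (r t \<omega>))"
      "(LINT \<omega>|M. (norm (x t \<omega>))\<^sup>2 * indicator {i} (r t \<omega>)) \<le> K" for i
    proof -
      show "0 \<le> (LINT \<omega>|M. (norm (x t \<omega>))\<^sup>2 * indicator {i} (r t \<omega>))" by simp
      have "(LINT \<omega>|M. (norm (x t \<omega>))\<^sup>2 * indicator {i} (r t \<omega>)) \<le> (LINT \<omega>|M. (norm (x t \<omega>))\<^sup>2)"
      proof (rule integral_mono[OF _ x_sq_int[OF t(1)]])
        show "integrable M (\<lambda>\<omega>. (norm (x t \<omega>))\<^sup>2 * indicator {i} (r t \<omega>))"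
          unfolding norm_sq_quadratic
          by (rule quadratic_integrable[OF t(1) mode_indicator_measurable[OF t(1)] indicator_bounds(1)])
      qed (auto simp: indicator_def)
      then show "(LINT \<omega>|M. (norm (x t \<omega>))\<^sup>2 * indicator {i} (r t \<omega>)) \<le> K" using K by simp
    qed
    have "(LINT \<omega>|M. (norm (x t \<omega>))\<^sup>2 * jump t (t + h) \<omega>) =
        (\<Sum>i\<in>UNIV. \<Sum>j\<in>UNIV - {i}. (LINT \<omega>|M. (norm (x t \<omega>))\<^sup>2 * (indicator {i} (r t \<omega>) * indicator {j} (r (t + h) \<omega>))))"
      unfolding jump_eq sum_distrib_left using int by simp
    also have "\<dots> = (\<Sum>i\<in>UNIV. \<Sum>j\<in>UNIV - {i}. p i j h * (LINT \<omega>|M. (norm (x t \<omega>))\<^sup>2 * indicator {i} (r t \<omega>)))"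
      unfolding norm_sq_quadratic by (simp only: transition_quadratic[OF t(1) h])
    also have "\<dots> \<le> (\<Sum>i\<in>UNIV. \<Sum>j\<in>UNIV - {i}. (\<bar>q $ i $ j\<bar> + 1) * h * K)"
    proof (intro sum_mono)
      fix i j :: 'i assume "j \<in> UNIV - {i}"
      then have "p i j h \<le> q $ i $ j * h + h" using p[OF h, of i j] by auto
      also have "\<dots> \<le> (\<bar>q $ i $ j\<bar> + 1) * h" using h by (simp add: distrib_right mult_right_mono)
      finally show "p i j h * (LINT \<omega>|M. (norm (x t \<omega>))\<^sup>2 * indicator {i} (r t \<omega>)) \<le> (\<bar>q $ i $ j\<bar> + 1) * h * K"
        using m[of i] h by (intro mult_mono) auto
    qed
    also have "\<dots> = rate_sum * h * K"
      by (simp add: rate_sum_def sum_distrib_right)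
    finally show ?thesis .
  qed
qed

end

section \<open>Decay of the Lyapunov function\<close>

text \<open>The interval is divided into equal steps, short enough for \<open>step\<close> to apply;
  one such partition suffices.\<close>

lemma discrete_gronwall:
  fixes \<phi> :: "real \<Rightarrow> real"
  assumes t0: "t0 \<le> T" and lam: "0 < \<kappa>" and D: "0 \<le> D" and \<phi>0: "0 \<le> \<phi> t0" and \<delta>: "0 < \<delta>"
    and step: "\<And>t h. t0 \<le> t \<Longrightarrow> 0 < h \<Longrightarrow> h < \<delta> \<Longrightarrow> t + h \<le> T \<Longrightarrow> \<phi> (t + h) \<le> (1 - \<kappa> * h) * \<phi> t + h * D"
  shows "\<phi> T \<le> exp (- \<kappa> * (T - t0)) * \<phi> t0 + D / \<kappa>"
proof (cases "t0 = T")
  case True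
  then show ?thesis using lam D by simp
next
  case False
  define L where "L = T - t0"
  have L: "0 < L" using t0 False by (simp add: L_def)
  \<comment> \<open>The bound \<open>1 / \<kappa>\<close> keeps \<open>1 - \<kappa> * h\<close>
    nonnegative, so that the induction hypothesis may be multiplied by it.\<close>
  define \<mu> where "\<mu> = min \<delta> (1 / \<kappa>)"
  have md: "0 < \<mu>" "\<mu> \<le> \<delta>" "\<mu> \<le> 1 / \<kappa>" using \<delta> lam by (simp_all add: \<mu>_def)
  obtain n :: nat where n: "L / \<mu> < n" using reals_Archimedean2 by blast
  have n0: "0 < real n" using n L md(1) by (meson divide_pos_pos less_trans)
  define h where "h = L / n"
  have h: "0 < h" using L n0 by (simp add: h_def)
  have hm: "h < \<mu>" using n n0 md(1) unfolding h_def by (simp add: divide_less_eq mult.commute)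
  then have h1: "h < \<delta>" using md by simp
  have "\<kappa> * h \<le> \<kappa> * (1 / \<kappa>)" using hm md lam by (intro mult_left_mono) auto
  then have h2: "0 \<le> 1 - \<kappa> * h" using lam by simp
  have nh: "real n * h = L" using n0 by (simp add: h_def)
  \<comment> \<open>\<open>D / \<kappa>\<close> is the fixed point of the recursion, which is why it
    reproduces itself in the induction.\<close>
  have it: "k \<le> n \<Longrightarrow> \<phi> (t0 + real k * h) \<le> (1 - \<kappa> * h) ^ k * \<phi> t0 + D / \<kappa>" for k
  proof (induction k)
    case 0
    show ?case using D lam by simp
  next
    case (Suc k)
    have "real (Suc k) * h \<le> L" using Suc.prems h unfolding nh[symmetric] by (intro mult_right_mono) auto
    then have T: "t0 + real k * h + h \<le> T" by (simp add: L_def distrib_right)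
    have "t0 + real (Suc k) * h = t0 + real k * h + h" by (simp add: algebra_simps)
    then have "\<phi> (t0 + real (Suc k) * h) = \<phi> (t0 + real k * h + h)" by (rule arg_cong)
    also have "\<dots> \<le> (1 - \<kappa> * h) * \<phi> (t0 + real k * h) + h * D"
      using h by (intro step h h1 T) simp
    also have "\<dots> \<le> (1 - \<kappa> * h) * ((1 - \<kappa> * h) ^ k * \<phi> t0 + D / \<kappa>) + h * D"
      using Suc h2 by (intro add_right_mono mult_left_mono) auto
    also have "\<dots> = (1 - \<kappa> * h) ^ Suc k * \<phi> t0 + D / \<kappa>"
      using lam by (simp add: field_simps)
    finally show ?case .
  qed
  have "(1 - \<kappa> * h) ^ n \<le> exp (- \<kappa> * h) ^ n"
    using h2 exp_ge_add_one_self[of "- \<kappa> * h"] by (intro power_mono) auto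
  also have "\<dots> = exp (- \<kappa> * L)"
    unfolding nh[symmetric] by (simp add: exp_of_nat_mult[symmetric] ac_simps)
  finally have "(1 - \<kappa> * h) ^ n * \<phi> t0 \<le> exp (- \<kappa> * L) * \<phi> t0"
    using \<phi>0 by (rule mult_right_mono)
  then show ?thesis using it[of n] by (simp add: nh L_def)
qed

section \<open>The one-step inequality and its limit for vanishing mesh\<close>

context switched_paths begin

lemma transition_rate_uniform:
  assumes "0 < \<eta>"
  obtains \<delta> where "0 < \<delta>"
    "\<And>i j h. 0 < h \<Longrightarrow> h < \<delta> \<Longrightarrow> \<bar>p i j h - ((if j = i then 1 else 0) + q $ i $ j * h)\<bar> \<le> \<eta> * h"
proof -
  have "\<forall>\<^sub>F h in at_right 0. \<forall>i j. norm (p i j h - ((if j = i then 1 else 0) + q $ i $ j * h)) \<le> \<eta> * norm h"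
    by (intro eventually_all_finite landau_o.smallD[OF transition_rate assms])
  then obtain \<delta> where "0 < \<delta>" "\<And>h. 0 < h \<Longrightarrow> h < \<delta> \<Longrightarrow>
      \<forall>i j. norm (p i j h - ((if j = i then 1 else 0) + q $ i $ j * h)) \<le> \<eta> * norm h"
    by (auto simp: eventually_at_right_field)
  then show ?thesis by (intro that[of \<delta>]) auto
qed

lemma mode_quadratic_integrable:
  assumes t: "t0 \<le> t" "t0 \<le> s"
  shows "integrable M (\<lambda>\<omega>. x t \<omega> \<bullet> (Q (r t \<omega>) (r s \<omega>) *v x t \<omega>))"
proof -
  have "integrable M (\<lambda>\<omega>. \<Sum>i\<in>UNIV. \<Sum>j\<in>UNIV.
      (x t \<omega> \<bullet> (Q i j *v x t \<omega>)) * (indicator {i} (r t \<omega>) * indicator {j} (r s \<omega>)))"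
    by (intro Bochner_Integration.integrable_sum
      quadratic_integrable[OF t(1) mode_pair_measurable[OF t] indicator_bounds(2)])
  then show ?thesis by (simp only: sum_indicator_mult2)
qed

definition energy :: "('i \<Rightarrow> real^'n^'n) \<Rightarrow> real \<Rightarrow> real" where
  "energy P t = (LINT \<omega>|M. x t \<omega> \<bullet> (P (r t \<omega>) *v x t \<omega>))"

context
  fixes P :: "'i \<Rightarrow> real^'n^'n" and \<kappa> \<beta> :: real
  assumes \<beta>: "0 < \<beta>" "\<And>i v. norm (P i *v v) \<le> \<beta> * norm v"
    and P_sym: "\<And>i. transpose (P i) = P i"
    and P_nonneg: "\<And>i v. 0 \<le> v \<bullet> (P i *v v)"
    and \<kappa>: "0 < \<kappa>"
    and lyapunov: "\<And>i v. 2 * (v \<bullet> (P i *v (A i *v v))) + (\<Sum>j\<in>UNIV. q $ i $ j * (v \<bullet> (P j *v v))) \<le>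
        - \<kappa> * (v \<bullet> (P i *v v))"
begin

lemma P_inner: "\<bar>u \<bullet> (P i *v v)\<bar> \<le> \<beta> * (norm u * norm v)"
proof -
  have "\<bar>u \<bullet> (P i *v v)\<bar> \<le> norm u * norm (P i *v v)" by (rule Cauchy_Schwarz_ineq2)
  also have "\<dots> \<le> norm u * (\<beta> * norm v)" by (intro mult_left_mono \<beta>) auto
  finally show ?thesis by (simp add: ac_simps)
qed

lemma P_quadratic: "v \<bullet> (P i *v v) \<le> \<beta> * (norm v)\<^sup>2"
  using P_inner[of v i v] by (simp add: power2_eq_square)

lemma energy_sum:
  assumes t: "t0 \<le> t"
  shows "energy P t = (\<Sum>i\<in>UNIV. LINT \<omega>|M. (x t \<omega> \<bullet> (P i *v x t \<omega>)) * indicator {i} (r t \<omega>))"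
proof -
  have "energy P t = (LINT \<omega>|M. (\<Sum>i\<in>UNIV. (x t \<omega> \<bullet> (P i *v x t \<omega>)) * indicator {i} (r t \<omega>)))"
    unfolding energy_def by (simp only: sum_indicator_mult)
  also have "\<dots> = (\<Sum>i\<in>UNIV. LINT \<omega>|M. (x t \<omega> \<bullet> (P i *v x t \<omega>)) * indicator {i} (r t \<omega>))"
    by (intro Bochner_Integration.integral_sum quadratic_integrable[OF t mode_indicator_measurable[OF t] indicator_bounds(1)])
  finally show ?thesis .
qed

lemma mode_quadratic_expectation:
  assumes t: "t0 \<le> t" "0 < h"
  shows "(LINT \<omega>|M. x t \<omega> \<bullet> (P (r (t + h) \<omega>) *v x t \<omega>)) =
    (\<Sum>i\<in>UNIV. \<Sum>j\<in>UNIV. p i j h * (LINT \<omega>|M. (x t \<omega> \<bullet> (P j *v x t \<omega>)) * indicator {i} (r t \<omega>)))"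
proof -
  have th: "t0 \<le> t + h" using t by simp
  have "(LINT \<omega>|M. x t \<omega> \<bullet> (P (r (t + h) \<omega>) *v x t \<omega>)) =
      (LINT \<omega>|M. (\<Sum>i\<in>UNIV. \<Sum>j\<in>UNIV. (x t \<omega> \<bullet> (P j *v x t \<omega>)) * (indicator {i} (r t \<omega>) * indicator {j} (r (t + h) \<omega>))))"
    by (simp only: sum_indicator_mult2)
  also have "\<dots> = (\<Sum>i\<in>UNIV. \<Sum>j\<in>UNIV. (LINT \<omega>|M. (x t \<omega> \<bullet> (P j *v x t \<omega>)) * (indicator {i} (r t \<omega>) * indicator {j} (r (t + h) \<omega>))))"
    using quadratic_integrable[OF t(1) mode_pair_measurable[OF t(1) th] indicator_bounds(2)] by simp
  finally show ?thesis by (simp only: transition_quadratic[OF t])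
qed

text \<open>Summing over the indicators of the modes at \<open>t'\<close> replaces the random matrix
  by constant entries. What remains are products of the form treated by
  \<open>noise_orthogonal\<close>, with the later mode as part of the bounded factor.\<close>

lemma noise_cross_term:
  assumes t: "t0 \<le> t" "t \<le> t'"
  shows "integrable M (\<lambda>\<omega>. x t \<omega> \<bullet> (P (r t' \<omega>) *v (noise t' \<omega> - noise t \<omega>)))"
    and "(LINT \<omega>|M. x t \<omega> \<bullet> (P (r t' \<omega>) *v (noise t' \<omega> - noise t \<omega>))) = 0"
proof -
  let ?J = "\<lambda>\<omega>. noise t' \<omega> - noise t \<omega>"
  have t': "t0 \<le> t'" using t by simp
  have Jm: "?J \<in> borel_measurable M"
    using t by (intro borel_measurable_diff noise_measurable) auto
  have J: "sq_integrable M (\<lambda>\<omega>. ?J \<omega> $ l)" for l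
  proof (rule sq_integrable_bound)
    show "sq_integrable M (\<lambda>\<omega>. norm (?J \<omega>))"
      using noise_second_moment(1)[OF t] measurable_compose[OF Jm borel_measurable_norm]
      by (simp add: sq_integrable_def)
    show "(\<lambda>\<omega>. ?J \<omega> $ l) \<in> borel_measurable M"
      by (rule measurable_compose[where g="\<lambda>v. v $ l", OF Jm]) simp
  qed (simp only: component_le_norm_cart abs_norm_cancel)
  have sq: "sq_integrable M (\<lambda>\<omega>. indicator {j} (r t' \<omega>) * x t \<omega> $ k)" for j k
    by (rule sq_integrable_bdd_mult[OF x_component_sq_integrable[OF t(1)] mode_indicator_measurable[OF t'] indicator_bounds(1)])
  have eq: "x t \<omega> \<bullet> (P (r t' \<omega>) *v ?J \<omega>) =
      (\<Sum>j\<in>UNIV. \<Sum>k\<in>UNIV. \<Sum>l\<in>UNIV. P j $ k $ l * ((indicator {j} (r t' \<omega>) * x t \<omega> $ k) * ?J \<omega> $ l))" for \<omega>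
    using sum_indicator_mult[of "\<lambda>j. x t \<omega> \<bullet> (P j *v ?J \<omega>)" "r t' \<omega>"]
    unfolding quadratic_form_sum by (simp only: sum_distrib_left sum_distrib_right ac_simps)
  have int: "integrable M (\<lambda>\<omega>. (indicator {j} (r t' \<omega>) * x t \<omega> $ k) * ?J \<omega> $ l)" for j k l
    by (rule sq_integrable_mult[OF sq J])
  show "integrable M (\<lambda>\<omega>. x t \<omega> \<bullet> (P (r t' \<omega>) *v ?J \<omega>))"
    unfolding eq using int by (intro Bochner_Integration.integrable_sum integrable_mult_right)
  have "(LINT \<omega>|M. x t \<omega> \<bullet> (P (r t' \<omega>) *v ?J \<omega>)) =
      (\<Sum>j\<in>UNIV. \<Sum>k\<in>UNIV. \<Sum>l\<in>UNIV. P j $ k $ l * (LINT \<omega>|M. (indicator {j} (r t' \<omega>) * x t \<omega> $ k) * ?J \<omega> $ l))"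
    unfolding eq using int by (simp only: Bochner_Integration.integral_sum Bochner_Integration.integrable_sum
        integrable_mult_right integral_mult_right_zero)
  also have "\<dots> = 0"
    by (simp only: noise_orthogonal[OF t x_component_sq_integrable[OF t(1)]]) simp
  finally show "(LINT \<omega>|M. x t \<omega> \<bullet> (P (r t' \<omega>) *v ?J \<omega>)) = 0" .
qed

text \<open>Here \<open>v\<close> is the state, \<open>i\<close> the old and \<open>j\<close> the
  new mode, \<open>d\<close> and \<open>J\<close> the increments by drift and noise, and
  \<open>e\<close> the error of freezing the drift. The terms of order \<open>h\<close> that must
  combine with the generator, and the linear noise term whose expectation vanishes, are kept
  exactly; everything quadratic in the increments is estimated.\<close>

lemma quadratic_expansion:
  assumes d: "d = h *\<^sub>R (A i *v v) + e" and h: "0 \<le> h"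
  shows "(v + d + J) \<bullet> (P j *v (v + d + J)) \<le>
    v \<bullet> (P j *v v) + 2 * h * (v \<bullet> (P i *v (A i *v v))) + 4 * h * \<beta> * a * ((norm v)\<^sup>2 * (if j = i then 0 else 1))
    + 2 * \<beta> * (norm v * norm e) + 2 * (v \<bullet> (P j *v J)) + 2 * \<beta> * (norm d)\<^sup>2 + 2 * \<beta> * (norm J)\<^sup>2"
proof -
  have "(v + d + J) \<bullet> (P j *v (v + d + J)) = v \<bullet> (P j *v v) + 2 * (v \<bullet> (P j *v d)) + 2 * (v \<bullet> (P j *v J))
      + (d + J) \<bullet> (P j *v (d + J))"
    using inner_symmetric_matrix[OF P_sym, of d j v] inner_symmetric_matrix[OF P_sym, of J j v]
    by (simp add: matrix_vector_right_distrib inner_add_left inner_add_right)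
  moreover have "(d + J) \<bullet> (P j *v (d + J)) \<le> 2 * \<beta> * (norm d)\<^sup>2 + 2 * \<beta> * (norm J)\<^sup>2"
  proof -
    have "(norm (d + J))\<^sup>2 \<le> (norm d + norm J)\<^sup>2" by (intro power_mono norm_triangle_ineq) auto
    also have "\<dots> \<le> 2 * (norm d)\<^sup>2 + 2 * (norm J)\<^sup>2"
    proof -
      have "0 \<le> (norm d - norm J)\<^sup>2" by simp
      then show ?thesis by (simp add: power2_eq_square algebra_simps)
    qed
    finally have "\<beta> * (norm (d + J))\<^sup>2 \<le> \<beta> * (2 * (norm d)\<^sup>2 + 2 * (norm J)\<^sup>2)"
      using \<beta>(1) by (intro mult_left_mono) auto
    then show ?thesis using P_quadratic[of "d + J" j] by (simp add: distrib_left ac_simps)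
  qed
  moreover have "2 * (v \<bullet> (P j *v d)) \<le> 2 * h * (v \<bullet> (P i *v (A i *v v))) + 4 * h * \<beta> * a * ((norm v)\<^sup>2 * (if j = i then 0 else 1))
      + 2 * \<beta> * (norm v * norm e)"
  proof -
    have e: "v \<bullet> (P j *v e) \<le> \<beta> * (norm v * norm e)" using P_inner[of v j e] by simp
    \<comment> \<open>In the cross term with the drift the new matrix \<open>P j\<close> may be
      exchanged for the old \<open>P i\<close>: this costs something only after a change of mode,
      and that event contributes another factor \<open>h\<close> in expectation.\<close>
    have "v \<bullet> (P j *v (A i *v v)) \<le> v \<bullet> (P i *v (A i *v v)) + 2 * \<beta> * a * ((norm v)\<^sup>2 * (if j = i then 0 else 1))"
    proof (cases "j = i")
      case False
      have b: "\<bar>v \<bullet> (P k *v (A i *v v))\<bar> \<le> \<beta> * a * (norm v)\<^sup>2" for k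
      proof -
        have "\<bar>v \<bullet> (P k *v (A i *v v))\<bar> \<le> \<beta> * (norm v * norm (A i *v v))" by (rule P_inner)
        also have "\<dots> \<le> \<beta> * (norm v * (a * norm v))" using \<beta> by (intro mult_left_mono a) auto
        finally show ?thesis by (simp add: power2_eq_square ac_simps)
      qed
      show ?thesis using b[of j] b[of i] False by simp
    qed simp
    then have "h * (v \<bullet> (P j *v (A i *v v))) \<le> h * (v \<bullet> (P i *v (A i *v v)) + 2 * \<beta> * a * ((norm v)\<^sup>2 * (if j = i then 0 else 1)))"
      using h by (rule mult_left_mono)
    then show ?thesis
      unfolding d using e by (simp add: matrix_vector_right_distrib matrix_vector_mult_scaleR inner_add_right distrib_left)
  qed
  ultimately show ?thesis by simp
qed

text \<open>Replacing \<open>p i j h\<close> by its expansion turns the first integral into the old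
  energy plus \<open>h\<close> times the generator term. Together with the drift term this is
  \<open>h\<close> times the expectation of the left side of \<open>lyapunov\<close>, so the
  inequality can be applied for each outcome under the integral.\<close>

lemma energy_rate:
  assumes t: "t0 \<le> t" "0 < h" and K: "(LINT \<omega>|M. (norm (x t \<omega>))\<^sup>2) \<le> K"
    and rate: "\<And>i j. \<bar>p i j h - ((if j = i then 1 else 0) + q $ i $ j * h)\<bar> \<le> \<eta> * h" and \<eta>: "0 \<le> \<eta>"
  shows "(LINT \<omega>|M. x t \<omega> \<bullet> (P (r (t + h) \<omega>) *v x t \<omega>)) +
      2 * h * (LINT \<omega>|M. x t \<omega> \<bullet> (P (r t \<omega>) *v (A (r t \<omega>) *v x t \<omega>)))
    \<le> (1 - \<kappa> * h) * energy P t + h * (\<eta> * (real CARD('i) * (\<beta> * K)))"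
proof -
  \<comment> \<open>The mode known at \<open>t\<close> and the matrix index are kept apart:
    \<open>i\<close> is the current mode, \<open>j\<close> the mode whose matrix will weigh the
    state after the transition.\<close>
  define m where "m i j = (LINT \<omega>|M. (x t \<omega> \<bullet> (P j *v x t \<omega>)) * indicator {i} (r t \<omega>))" for i j
  define D where "D = (LINT \<omega>|M. x t \<omega> \<bullet> (P (r t \<omega>) *v (A (r t \<omega>) *v x t \<omega>)))"
  note mint = quadratic_integrable[OF t(1) mode_indicator_measurable[OF t(1)] indicator_bounds(1)]
  have m0: "0 \<le> m i j" for i j
    unfolding m_def by (intro Bochner_Integration.integral_nonneg mult_nonneg_nonneg P_nonneg) simp
  have int1: "integrable M (\<lambda>\<omega>. x t \<omega> \<bullet> (B *v x t \<omega>))" for B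
    using mode_quadratic_integrable[OF t(1) t(1), of "\<lambda>_ _. B"] by simp
  have msum: "(\<Sum>i\<in>UNIV. m i j) \<le> \<beta> * K" for j
  proof -
    have "(\<Sum>i\<in>UNIV. m i j) = (LINT \<omega>|M. (\<Sum>i\<in>UNIV. (x t \<omega> \<bullet> (P j *v x t \<omega>)) * indicator {i} (r t \<omega>)))"
      unfolding m_def by (rule Bochner_Integration.integral_sum[OF mint, symmetric])
    also have "\<dots> = (LINT \<omega>|M. x t \<omega> \<bullet> (P j *v x t \<omega>))"
      by (simp only: sum_indicator_mult)
    also have "\<dots> \<le> (LINT \<omega>|M. \<beta> * (norm (x t \<omega>))\<^sup>2)"
      using x_sq_int[OF t(1)] by (intro integral_mono int1 P_quadratic) auto
    also have "\<dots> \<le> \<beta> * K" using K \<beta>(1) by simp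
    finally show ?thesis .
  qed
  have qsum: "(\<Sum>i\<in>UNIV. \<Sum>j\<in>UNIV. q $ i $ j * m i j) =
      (LINT \<omega>|M. (\<Sum>j\<in>UNIV. q $ r t \<omega> $ j * (x t \<omega> \<bullet> (P j *v x t \<omega>))))"
    and qint: "integrable M (\<lambda>\<omega>. \<Sum>j\<in>UNIV. q $ r t \<omega> $ j * (x t \<omega> \<bullet> (P j *v x t \<omega>)))"
  proof -
    have e: "(\<Sum>j\<in>UNIV. q $ r t \<omega> $ j * (x t \<omega> \<bullet> (P j *v x t \<omega>))) =
        (\<Sum>i\<in>UNIV. \<Sum>j\<in>UNIV. q $ i $ j * ((x t \<omega> \<bullet> (P j *v x t \<omega>)) * indicator {i} (r t \<omega>)))" for \<omega>
      using sum_indicator_mult[of "\<lambda>i. \<Sum>j\<in>UNIV. q $ i $ j * (x t \<omega> \<bullet> (P j *v x t \<omega>))" "r t \<omega>"]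
      by (simp only: sum_distrib_right mult.assoc)
    show "integrable M (\<lambda>\<omega>. \<Sum>j\<in>UNIV. q $ r t \<omega> $ j * (x t \<omega> \<bullet> (P j *v x t \<omega>)))"
      unfolding e by (intro Bochner_Integration.integrable_sum integrable_mult_right mint)
    show "(\<Sum>i\<in>UNIV. \<Sum>j\<in>UNIV. q $ i $ j * m i j) =
      (LINT \<omega>|M. (\<Sum>j\<in>UNIV. q $ r t \<omega> $ j * (x t \<omega> \<bullet> (P j *v x t \<omega>))))"
      unfolding e m_def by (simp only: Bochner_Integration.integral_sum Bochner_Integration.integrable_sum
          integrable_mult_right mint integral_mult_right_zero)
  qed
  have Dint: "integrable M (\<lambda>\<omega>. x t \<omega> \<bullet> (P (r t \<omega>) *v (A (r t \<omega>) *v x t \<omega>)))"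
    using mode_quadratic_integrable[OF t(1) t(1), of "\<lambda>i _. P i ** A i"] by (simp add: matrix_vector_mul_assoc)
  have Eint: "integrable M (\<lambda>\<omega>. x t \<omega> \<bullet> (P (r t \<omega>) *v x t \<omega>))"
    using mode_quadratic_integrable[OF t(1) t(1), of "\<lambda>i _. P i"] by simp
  have lyap: "2 * D + (\<Sum>i\<in>UNIV. \<Sum>j\<in>UNIV. q $ i $ j * m i j) \<le> - \<kappa> * energy P t"
  proof -
    have "2 * D + (\<Sum>i\<in>UNIV. \<Sum>j\<in>UNIV. q $ i $ j * m i j) =
        (LINT \<omega>|M. 2 * (x t \<omega> \<bullet> (P (r t \<omega>) *v (A (r t \<omega>) *v x t \<omega>))) +
          (\<Sum>j\<in>UNIV. q $ r t \<omega> $ j * (x t \<omega> \<bullet> (P j *v x t \<omega>))))"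
      unfolding D_def qsum using Dint qint by simp
    also have "\<dots> \<le> (LINT \<omega>|M. - \<kappa> * (x t \<omega> \<bullet> (P (r t \<omega>) *v x t \<omega>)))"
      using Dint qint Eint
      by (intro integral_mono lyapunov Bochner_Integration.integrable_add integrable_mult_right) auto
    finally show ?thesis by (simp add: energy_def)
  qed
  have "(LINT \<omega>|M. x t \<omega> \<bullet> (P (r (t + h) \<omega>) *v x t \<omega>)) = (\<Sum>i\<in>UNIV. \<Sum>j\<in>UNIV. p i j h * m i j)"
    unfolding m_def by (rule mode_quadratic_expectation[OF t])
  also have "\<dots> \<le> (\<Sum>i\<in>UNIV. \<Sum>j\<in>UNIV. (if j = i then m i j else 0) + h * (q $ i $ j * m i j) + \<eta> * h * m i j)"
  proof (intro sum_mono)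
    fix i j
    have "p i j h \<le> (if j = i then 1 else 0) + q $ i $ j * h + \<eta> * h" using rate[of i j] by linarith
    then have "p i j h * m i j \<le> ((if j = i then 1 else 0) + q $ i $ j * h + \<eta> * h) * m i j"
      using m0 by (rule mult_right_mono)
    then show "p i j h * m i j \<le> (if j = i then m i j else 0) + h * (q $ i $ j * m i j) + \<eta> * h * m i j"
      by (simp add: algebra_simps split: if_splits)
  qed
  also have "\<dots> = (\<Sum>i\<in>UNIV. m i i) + h * (\<Sum>i\<in>UNIV. \<Sum>j\<in>UNIV. q $ i $ j * m i j) + \<eta> * h * (\<Sum>i\<in>UNIV. \<Sum>j\<in>UNIV. m i j)"
    by (simp add: sum.distrib sum_distrib_left)
  also have "(\<Sum>i\<in>UNIV. m i i) = energy P t"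
    unfolding m_def by (rule energy_sum[OF t(1), symmetric])
  also have "(\<Sum>i\<in>UNIV. \<Sum>j\<in>UNIV. m i j) = (\<Sum>j\<in>UNIV. \<Sum>i\<in>UNIV. m i j)" by (rule sum.swap)
  finally have "(LINT \<omega>|M. x t \<omega> \<bullet> (P (r (t + h) \<omega>) *v x t \<omega>)) \<le>
      energy P t + h * (\<Sum>i\<in>UNIV. \<Sum>j\<in>UNIV. q $ i $ j * m i j) + \<eta> * h * (\<Sum>j\<in>UNIV. \<Sum>i\<in>UNIV. m i j)" .
  moreover have "\<eta> * h * (\<Sum>j\<in>UNIV. \<Sum>i\<in>UNIV. m i j) \<le> \<eta> * h * (\<Sum>j\<in>(UNIV::'i set). \<beta> * K)"
    using \<eta> t by (intro mult_left_mono sum_mono msum) auto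
  moreover have "h * (2 * D + (\<Sum>i\<in>UNIV. \<Sum>j\<in>UNIV. q $ i $ j * m i j)) \<le> h * (- \<kappa> * energy P t)"
    using t by (intro mult_left_mono lyap) auto
  ultimately show ?thesis
    unfolding D_def[symmetric] by (simp add: algebra_simps)
qed

text \<open>Freezing the drift at time \<open>t\<close> is wrong for two reasons: the state moves,
  by \<open>O(h^(1/2))\<close> in mean square, and the mode may change, which costs
  \<open>O(h)\<close> in expectation. The rate is required for every \<open>h' \<le> h\<close>
  because the mode may differ at any intermediate time. The majorant \<open>F\<close> is the time
  integral of the pointwise estimate \<open>g\<close>.\<close>

lemma remainder_bound:
  assumes t: "t0 \<le> t" "0 < h" "t + h \<le> T" and K: "0 \<le> K" "\<And>s. t0 \<le> s \<Longrightarrow> s \<le> T \<Longrightarrow> (LINT \<omega>|M. (norm (x s \<omega>))\<^sup>2) \<le> K"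
    and rate: "\<And>h' i j. 0 < h' \<Longrightarrow> h' \<le> h \<Longrightarrow> \<bar>p i j h' - ((if j = i then 1 else 0) + q $ i $ j * h')\<bar> \<le> h'"
    and \<epsilon>: "0 < \<epsilon>"
  obtains F where "integrable M F"
    "(LINT \<omega>|M. F \<omega>) \<le> h * (a * (\<epsilon> * K + (3 * a\<^sup>2 * (T - t0) * K + 3 * c) * h / \<epsilon>) + 2 * a * (rate_sum * h * K))"
    "\<And>\<omega>. \<omega> \<in> space M \<Longrightarrow> norm (x t \<omega>) *
      norm ((LINT s:{t..t + h}|lborel. A (r s \<omega>) *v x s \<omega>) - h *\<^sub>R (A (r t \<omega>) *v x t \<omega>)) \<le> F \<omega>"
proof -
  define L where "L = 3 * a\<^sup>2 * (T - t0) * K + 3 * c"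
  \<comment> \<open>The first part is Young's inequality for the product of \<open>|x t|\<close> and
    the movement of the state. Its weight \<open>\<epsilon>\<close> stays free, to be fixed before
    \<open>h\<close> tends to zero. The second part, with factor \<open>2 * a\<close>, bounds the
    two drift values separately when the modes differ.\<close>
  define g where "g s \<omega> = a * (\<epsilon> * (norm (x t \<omega>))\<^sup>2 + (norm (x s \<omega> - x t \<omega>))\<^sup>2 / \<epsilon>) + 2 * a * ((norm (x t \<omega>))\<^sup>2 * jump t s \<omega>)" for s \<omega>
  define B where "B = a * (\<epsilon> * K + L * h / \<epsilon>) + 2 * a * (rate_sum * h * K)"
  have a0: "0 \<le> a" using a(1) by simp
  have L0: "0 \<le> L" unfolding L_def using t K(1) c_nonneg by (intro add_nonneg_nonneg mult_nonneg_nonneg) auto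
  have rs: "0 \<le> rate_sum" unfolding rate_sum_def by (intro sum_nonneg) auto
  have B0: "0 \<le> B" unfolding B_def using a0 L0 rs t K(1) \<epsilon> by (intro add_nonneg_nonneg mult_nonneg_nonneg) auto
  have g0: "0 \<le> g s \<omega>" for s \<omega>
    unfolding g_def using a0 \<epsilon> jump_bounds by (intro add_nonneg_nonneg mult_nonneg_nonneg) auto
  have gj: "(\<lambda>(\<omega>, s). g (max t0 s) \<omega>) \<in> borel_measurable (M \<Otimes>\<^sub>M lborel)"
  proof -
    have [measurable]: "(\<lambda>z. x t (fst z)) \<in> borel_measurable (M \<Otimes>\<^sub>M lborel)"
      by (rule measurable_compose[OF measurable_fst x_measurable[OF t(1)]])
    have [measurable]: "(\<lambda>z. x (max t0 (snd z)) (fst z)) \<in> borel_measurable (M \<Otimes>\<^sub>M lborel)"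
      "(\<lambda>z. jump t (max t0 (snd z)) (fst z)) \<in> borel_measurable (M \<Otimes>\<^sub>M lborel)"
      using x_joint jump_joint[OF t(1)] by (simp_all add: split_beta')
    show ?thesis unfolding split_beta' g_def by measurable
  qed
  have gi: "integrable M (g s)" "(LINT \<omega>|M. g s \<omega>) \<le> B" if s: "t \<le> s" "s \<le> t + h" for s
  proof -
    have sT: "s \<le> T" using s t by simp
    note X = x_increment_second_moment[OF t(1) s(1) sT K, folded L_def]
    have tK: "(LINT \<omega>|M. (norm (x t \<omega>))\<^sup>2) \<le> K" using t by (intro K) auto
    have Y: "integrable M (\<lambda>\<omega>. (norm (x t \<omega>))\<^sup>2 * jump t s \<omega>)"
      "(LINT \<omega>|M. (norm (x t \<omega>))\<^sup>2 * jump t s \<omega>) \<le> rate_sum * (s - t) * K"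
      using jump_second_moment[OF t(1) _ tK, of "s - t"] rate[of "s - t"] s by simp_all
    note Z = x_sq_int[OF t(1)]
    show "integrable M (g s)" unfolding g_def using X(1) Y(1) Z by simp
    have "(LINT \<omega>|M. g s \<omega>) = a * (\<epsilon> * (LINT \<omega>|M. (norm (x t \<omega>))\<^sup>2) + (LINT \<omega>|M. (norm (x s \<omega> - x t \<omega>))\<^sup>2) / \<epsilon>)
        + 2 * a * (LINT \<omega>|M. (norm (x t \<omega>))\<^sup>2 * jump t s \<omega>)"
      unfolding g_def using X(1) Y(1) Z by simp
    also have "\<dots> \<le> a * (\<epsilon> * K + L * (s - t) / \<epsilon>) + 2 * a * (rate_sum * (s - t) * K)"
      using X(2) Y(2) tK a0 \<epsilon> by (intro add_mono mult_left_mono divide_right_mono) auto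
    also have "\<dots> \<le> B"
      unfolding B_def using s a0 \<epsilon> L0 rs K(1)
      by (intro add_mono mult_left_mono divide_right_mono mult_right_mono) auto
    finally show "(LINT \<omega>|M. g s \<omega>) \<le> B" .
  qed
  have gp: "set_integrable lborel {t..t + h} (\<lambda>s. g s \<omega>)" if \<omega>: "\<omega> \<in> space M" for \<omega>
  proof -
    have 1: "set_integrable lborel {t..t + h} (\<lambda>s. a * (\<epsilon> * (norm (x t \<omega>))\<^sup>2 + (norm (x s \<omega> - x t \<omega>))\<^sup>2 / \<epsilon>))"
      using \<epsilon> by (intro borel_integrable_atLeastAtMost' continuous_intros x_continuous_Icc \<omega> t(1)) auto
    have 2: "set_integrable lborel {t..t + h} (\<lambda>s. jump t s \<omega>)"
    proof (rule set_integrable_bound)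
      show "set_integrable lborel {t..t + h} (\<lambda>_. 1::real)" by (rule borel_integrable_atLeastAtMost') simp
      show "set_borel_measurable lborel {t..t + h} (\<lambda>s. jump t s \<omega>)"
        by (rule set_borel_path[OF jump_joint[OF t(1)] \<omega> t(1)])
      show "AE s in lborel. s \<in> {t..t + h} \<longrightarrow> norm (jump t s \<omega>) \<le> norm (1::real)"
        using jump_bounds by simp
    qed
    have "set_integrable lborel {t..t + h} (\<lambda>s. 2 * a * ((norm (x t \<omega>))\<^sup>2 * jump t s \<omega>))"
      by (intro set_integrable_mult_right 2)
    then show ?thesis
      unfolding g_def by (rule set_integral_add(1)[OF 1])
  qed
  have tv: "t \<le> t + h" using t by simp
  note F = path_expectation_bound[where f=g, OF gj g0 t(1) tv B0 gi gp]
  have pt: "norm (x t \<omega>) * norm ((LINT s:{t..t + h}|lborel. A (r s \<omega>) *v x s \<omega>) - h *\<^sub>R (A (r t \<omega>) *v x t \<omega>)) \<le>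
      (LINT s:{t..t + h}|lborel. g s \<omega>)" if \<omega>: "\<omega> \<in> space M" for \<omega>
  proof -
    let ?v = "A (r t \<omega>) *v x t \<omega>"
    have ci: "set_integrable lborel {t..t + h} (\<lambda>_. ?v)" by (rule borel_integrable_atLeastAtMost') simp
    have di: "set_integrable lborel {t..t + h} (\<lambda>s. A (r s \<omega>) *v x s \<omega> - ?v)"
      by (rule set_integral_diff(1)[OF Ax_integrable[OF \<omega> t(1)] ci])
    have "h *\<^sub>R ?v = (LINT s:{t..t + h}|lborel. ?v)"
      using t by (simp add: set_lebesgue_integral_def)
    then have "(LINT s:{t..t + h}|lborel. A (r s \<omega>) *v x s \<omega>) - h *\<^sub>R ?v = (LINT s:{t..t + h}|lborel. A (r s \<omega>) *v x s \<omega> - ?v)"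
      using set_integral_diff(2)[OF Ax_integrable[OF \<omega> t(1)] ci] by simp
    then have "norm (x t \<omega>) * norm ((LINT s:{t..t + h}|lborel. A (r s \<omega>) *v x s \<omega>) - h *\<^sub>R ?v) \<le>
        norm (x t \<omega>) * (LINT s:{t..t + h}|lborel. norm (A (r s \<omega>) *v x s \<omega> - ?v))"
      using set_integral_norm_bound[OF di] by (simp add: mult_left_mono)
    also have "\<dots> = (LINT s:{t..t + h}|lborel. norm (x t \<omega>) * norm (A (r s \<omega>) *v x s \<omega> - ?v))"
      by simp
    also have "\<dots> \<le> (LINT s:{t..t + h}|lborel. g s \<omega>)"
    proof (rule set_integral_mono[OF _ gp[OF \<omega>]])
      show "set_integrable lborel {t..t + h} (\<lambda>s. norm (x t \<omega>) * norm (A (r s \<omega>) *v x s \<omega> - ?v))"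
        using set_integrable_norm[OF di] by simp
      fix s assume "s \<in> {t..t + h}"
      have young: "u * v \<le> \<epsilon> * u\<^sup>2 + v\<^sup>2 / \<epsilon>" if "0 \<le> u" "0 \<le> v" for u v :: real
      proof -
        have "0 \<le> (\<epsilon> * u - v)\<^sup>2 / \<epsilon>" using \<epsilon> by simp
        also have "\<dots> = \<epsilon> * u\<^sup>2 + v\<^sup>2 / \<epsilon> - 2 * (u * v)"
          using \<epsilon> by (simp add: power2_diff field_simps power2_eq_square)
        finally show ?thesis using mult_nonneg_nonneg[OF that] by linarith
      qed
      have "norm (A (r s \<omega>) *v x s \<omega> - ?v) \<le> a * norm (x s \<omega> - x t \<omega>) + 2 * a * (norm (x t \<omega>) * jump t s \<omega>)"
      proof (cases "r s \<omega> = r t \<omega>")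
        case True
        then show ?thesis
          using a(2)[of "r t \<omega>" "x s \<omega> - x t \<omega>"] by (simp add: matrix_vector_mult_diff_distrib jump_def)
      next
        case False
        have "norm (A (r s \<omega>) *v x s \<omega> - ?v) \<le> norm (A (r s \<omega>) *v x s \<omega>) + norm ?v" by (rule norm_triangle_ineq4)
        also have "\<dots> \<le> a * norm (x s \<omega>) + a * norm (x t \<omega>)" by (intro add_mono a)
        also have "\<dots> \<le> a * (norm (x s \<omega> - x t \<omega>) + norm (x t \<omega>)) + a * norm (x t \<omega>)"
          using norm_triangle_ineq[of "x s \<omega> - x t \<omega>" "x t \<omega>"] a0 by (intro add_right_mono mult_left_mono) auto
        finally show ?thesis using False by (simp add: jump_def algebra_simps)
      qed
      then have "norm (x t \<omega>) * norm (A (r s \<omega>) *v x s \<omega> - ?v) \<le>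
          norm (x t \<omega>) * (a * norm (x s \<omega> - x t \<omega>) + 2 * a * (norm (x t \<omega>) * jump t s \<omega>))"
        by (intro mult_left_mono) auto
      also have "\<dots> = a * (norm (x t \<omega>) * norm (x s \<omega> - x t \<omega>)) + 2 * a * ((norm (x t \<omega>))\<^sup>2 * jump t s \<omega>)"
        by (simp add: power2_eq_square algebra_simps)
      also have "\<dots> \<le> g s \<omega>"
        unfolding g_def by (intro add_right_mono mult_left_mono young a0) auto
      finally show "norm (x t \<omega>) * norm (A (r s \<omega>) *v x s \<omega> - ?v) \<le> g s \<omega>" .
    qed
    finally show ?thesis .
  qed
  show ?thesis
    by (rule that[OF F(1) _ pt]) (use F(2) in \<open>simp_all add: B_def L_def mult.commute\<close>)
qed

text \<open>The term \<open>2 * \<beta> * c\<close> is the second moment of the noise increment per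
  unit time, weighted by \<open>P\<close>. Every other term of the bracket becomes small when first
  \<open>\<eta>\<close> and \<open>\<epsilon>\<close>, then \<open>h\<close>, are chosen small for
  fixed \<open>T\<close> and \<open>K\<close>.\<close>

lemma energy_step:
  assumes t: "t0 \<le> t" "0 < h" "t + h \<le> T" and K: "0 \<le> K" "\<And>s. t0 \<le> s \<Longrightarrow> s \<le> T \<Longrightarrow> (LINT \<omega>|M. (norm (x s \<omega>))\<^sup>2) \<le> K"
    and rate: "\<And>h' i j. 0 < h' \<Longrightarrow> h' \<le> h \<Longrightarrow> \<bar>p i j h' - ((if j = i then 1 else 0) + q $ i $ j * h')\<bar> \<le> \<eta> * h'"
    and \<eta>: "0 \<le> \<eta>" "\<eta> \<le> 1" and \<epsilon>: "0 < \<epsilon>"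
  shows "energy P (t + h) \<le> (1 - \<kappa> * h) * energy P t + h * (2 * \<beta> * c +
    (\<eta> * (real CARD('i) * (\<beta> * K)) + 4 * \<beta> * a * (rate_sum * h * K) +
     2 * \<beta> * (a * (\<epsilon> * K + (3 * a\<^sup>2 * (T - t0) * K + 3 * c) * h / \<epsilon>) + 2 * a * (rate_sum * h * K)) + 2 * \<beta> * (a\<^sup>2 * h * K)))"
proof -
  have th: "t0 \<le> t + h" "t \<le> t + h" using t by auto
  have rate1: "\<bar>p i j h' - ((if j = i then 1 else 0) + q $ i $ j * h')\<bar> \<le> h'" if "0 < h'" "h' \<le> h" for i j h'
    using rate[OF that, of i j] mult_right_mono[OF \<eta>(2), of h'] that by linarith
  obtain F where F: "integrable M F"
    "(LINT \<omega>|M. F \<omega>) \<le> h * (a * (\<epsilon> * K + (3 * a\<^sup>2 * (T - t0) * K + 3 * c) * h / \<epsilon>) + 2 * a * (rate_sum * h * K))"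
    "\<And>\<omega>. \<omega> \<in> space M \<Longrightarrow> norm (x t \<omega>) *
      norm ((LINT s:{t..t + h}|lborel. A (r s \<omega>) *v x s \<omega>) - h *\<^sub>R (A (r t \<omega>) *v x t \<omega>)) \<le> F \<omega>"
    by (rule remainder_bound[OF t K rate1 \<epsilon>]) (assumption | rule that)+
  define d where "d \<omega> = (LINT s:{t..t + h}|lborel. A (r s \<omega>) *v x s \<omega>)" for \<omega>
  define J where "J \<omega> = noise (t + h) \<omega> - noise t \<omega>" for \<omega>
  have tK: "(LINT \<omega>|M. (norm (x t \<omega>))\<^sup>2) \<le> K" using t by (intro K) auto
  have d: "integrable M (\<lambda>\<omega>. (norm (d \<omega>))\<^sup>2)" "(LINT \<omega>|M. (norm (d \<omega>))\<^sup>2) \<le> a\<^sup>2 * h\<^sup>2 * K"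
    unfolding d_def using drift_second_moment[OF t(1) th(2) K(1)] K(2) t by auto
  have J: "integrable M (\<lambda>\<omega>. (norm (J \<omega>))\<^sup>2)" "(LINT \<omega>|M. (norm (J \<omega>))\<^sup>2) \<le> c * h"
    unfolding J_def using noise_second_moment[OF t(1) th(2)] by auto
  have XJ: "integrable M (\<lambda>\<omega>. x t \<omega> \<bullet> (P (r (t + h) \<omega>) *v J \<omega>))"
    "(LINT \<omega>|M. x t \<omega> \<bullet> (P (r (t + h) \<omega>) *v J \<omega>)) = 0"
    unfolding J_def using noise_cross_term[OF t(1) th(2)] by auto
  have j: "integrable M (\<lambda>\<omega>. (norm (x t \<omega>))\<^sup>2 * jump t (t + h) \<omega>)"
    "(LINT \<omega>|M. (norm (x t \<omega>))\<^sup>2 * jump t (t + h) \<omega>) \<le> rate_sum * h * K"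
    using jump_second_moment[OF t(1) _ tK, of h] rate1[of h] t by auto
  have m0: "integrable M (\<lambda>\<omega>. x t \<omega> \<bullet> (P (r (t + h) \<omega>) *v x t \<omega>))"
    using mode_quadratic_integrable[OF t(1) th(1), of "\<lambda>_ j. P j"] by simp
  have m1: "integrable M (\<lambda>\<omega>. x t \<omega> \<bullet> (P (r t \<omega>) *v (A (r t \<omega>) *v x t \<omega>)))"
    using mode_quadratic_integrable[OF t(1) t(1), of "\<lambda>i _. P i ** A i"] by (simp add: matrix_vector_mul_assoc)
  have e1: "integrable M (\<lambda>\<omega>. x (t + h) \<omega> \<bullet> (P (r (t + h) \<omega>) *v x (t + h) \<omega>))"
    using mode_quadratic_integrable[OF th(1) th(1), of "\<lambda>_ j. P j"] by simp
  let ?U = "\<lambda>\<omega>. x t \<omega> \<bullet> (P (r (t + h) \<omega>) *v x t \<omega>) + 2 * h * (x t \<omega> \<bullet> (P (r t \<omega>) *v (A (r t \<omega>) *v x t \<omega>)))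
    + 4 * h * \<beta> * a * ((norm (x t \<omega>))\<^sup>2 * jump t (t + h) \<omega>) + 2 * \<beta> * F \<omega>
    + 2 * (x t \<omega> \<bullet> (P (r (t + h) \<omega>) *v J \<omega>)) + 2 * \<beta> * (norm (d \<omega>))\<^sup>2 + 2 * \<beta> * (norm (J \<omega>))\<^sup>2"
  have pt: "x (t + h) \<omega> \<bullet> (P (r (t + h) \<omega>) *v x (t + h) \<omega>) \<le> ?U \<omega>" if \<omega>: "\<omega> \<in> space M" for \<omega>
  proof -
    let ?e = "d \<omega> - h *\<^sub>R (A (r t \<omega>) *v x t \<omega>)"
    have x: "x (t + h) \<omega> = x t \<omega> + d \<omega> + J \<omega>"
      unfolding d_def J_def by (rule x_increment[OF \<omega> t(1) th(2)])
    have "2 * \<beta> * (norm (x t \<omega>) * norm ?e) \<le> 2 * \<beta> * F \<omega>"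
      using F(3)[OF \<omega>] \<beta>(1) unfolding d_def by (intro mult_left_mono) auto
    moreover have "jump t (t + h) \<omega> = (if r (t + h) \<omega> = r t \<omega> then 0 else 1)" by (simp add: jump_def)
    ultimately show ?thesis
      using quadratic_expansion[of "d \<omega>" h "r t \<omega>" "x t \<omega>" ?e "J \<omega>" "r (t + h) \<omega>"] t(2)
      unfolding x by simp
  qed
  have U: "integrable M ?U"
    using m0 m1 j(1) F(1) XJ(1) d(1) J(1) by simp
  have "energy P (t + h) \<le> (LINT \<omega>|M. ?U \<omega>)"
    unfolding energy_def by (rule integral_mono[OF e1 U pt])
  also have "\<dots> = ((LINT \<omega>|M. x t \<omega> \<bullet> (P (r (t + h) \<omega>) *v x t \<omega>)) +
      2 * h * (LINT \<omega>|M. x t \<omega> \<bullet> (P (r t \<omega>) *v (A (r t \<omega>) *v x t \<omega>))))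
    + 4 * h * \<beta> * a * (LINT \<omega>|M. (norm (x t \<omega>))\<^sup>2 * jump t (t + h) \<omega>) + 2 * \<beta> * (LINT \<omega>|M. F \<omega>)
    + 2 * \<beta> * (LINT \<omega>|M. (norm (d \<omega>))\<^sup>2) + 2 * \<beta> * (LINT \<omega>|M. (norm (J \<omega>))\<^sup>2)"
    using m0 m1 j(1) F(1) XJ d(1) J(1) by simp
  also have "\<dots> \<le> ((1 - \<kappa> * h) * energy P t + h * (\<eta> * (real CARD('i) * (\<beta> * K))))
    + 4 * h * \<beta> * a * (rate_sum * h * K)
    + 2 * \<beta> * (h * (a * (\<epsilon> * K + (3 * a\<^sup>2 * (T - t0) * K + 3 * c) * h / \<epsilon>) + 2 * a * (rate_sum * h * K)))
    + 2 * \<beta> * (a\<^sup>2 * h\<^sup>2 * K) + 2 * \<beta> * (c * h)"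
    by (rule add_mono[OF add_mono[OF add_mono[OF add_mono[OF
          energy_rate[OF t(1,2) tK rate[OF t(2) order_refl] \<eta>(1)] mult_left_mono[OF j(2)]]
          mult_left_mono[OF F(2)]] mult_left_mono[OF d(2)]] mult_left_mono[OF J(2)]])
      (use \<beta>(1) a(1) t(2) in auto)
  finally show ?thesis by (simp add: power2_eq_square distrib_left ac_simps)
qed

text \<open>\<open>K\<close> is obtained for the fixed horizon \<open>T\<close>, and all errors
  involving it fall below an arbitrary \<open>\<gamma>\<close> by refining the partition. The
  surviving constant \<open>2 * \<beta> * c / \<kappa>\<close> is therefore independent of
  \<open>T\<close>.\<close>

lemma energy_decay:
  assumes T: "t0 \<le> T"
  shows "energy P T \<le> exp (- \<kappa> * (T - t0)) * energy P t0 + 2 * \<beta> * c / \<kappa>"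
proof (rule field_le_epsilon)
  fix \<gamma> :: real assume \<gamma>: "0 < \<gamma>"
  obtain K where K: "0 \<le> K" "\<And>s. t0 \<le> s \<Longrightarrow> s \<le> T \<Longrightarrow> (LINT \<omega>|M. (norm (x s \<omega>))\<^sup>2) \<le> K"
    using x_second_moment[OF T] by metis
  define C1 where "C1 = real CARD('i) * (\<beta> * K)"
  define C2 where "C2 = 4 * \<beta> * a * (rate_sum * K) + 2 * \<beta> * (2 * a * (rate_sum * K)) + 2 * \<beta> * (a\<^sup>2 * K)"
  define C3 where "C3 = 2 * \<beta> * a * K"
  define C4 where "C4 = 2 * \<beta> * a * (3 * a\<^sup>2 * (T - t0) * K + 3 * c)"
  have rs: "0 \<le> rate_sum" unfolding rate_sum_def by (intro sum_nonneg) auto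
  have C0: "0 \<le> C1" "0 \<le> C2" "0 \<le> C3" "0 \<le> C4"
    unfolding C1_def C2_def C3_def C4_def using K(1) \<beta>(1) a(1) rs c_nonneg T
    by (auto intro!: add_nonneg_nonneg mult_nonneg_nonneg)
  \<comment> \<open>There are four groups of errors, each kept below \<open>g\<close>; the sum is
    divided by \<open>\<kappa>\<close> in \<open>discrete_gronwall\<close>, which leaves
    \<open>\<gamma>\<close>.\<close>
  define g where "g = \<gamma> * \<kappa> / 4"
  have g: "0 < g" using \<gamma> \<kappa> by (simp add: g_def)
  have small: "\<exists>\<delta>>0. \<forall>y. 0 \<le> y \<longrightarrow> y \<le> \<delta> \<longrightarrow> C * y \<le> g" if "0 \<le> C" for C
  proof (intro exI[of _ "g / (C + 1)"] conjI allI impI)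
    show "0 < g / (C + 1)" using g that by simp
    fix y assume y: "0 \<le> y" "y \<le> g / (C + 1)"
    have "C * y \<le> (C + 1) * y" using y by (simp add: distrib_right)
    also have "\<dots> \<le> (C + 1) * (g / (C + 1))" using y that by (intro mult_left_mono) auto
    finally show "C * y \<le> g" using that by simp
  qed
  obtain \<eta>' where \<eta>': "0 < \<eta>'" "\<And>y. 0 \<le> y \<Longrightarrow> y \<le> \<eta>' \<Longrightarrow> C1 * y \<le> g" using small[OF C0(1)] by blast
  \<comment> \<open>The Young weight is fixed here, before the step size: the remaining error
    \<open>C4 / \<epsilon> * h\<close> can be made small only for a given
    \<open>\<epsilon>\<close>.\<close>
  obtain \<epsilon> where \<epsilon>: "0 < \<epsilon>" "C3 * \<epsilon> \<le> g" using small[OF C0(3)] by (meson less_imp_le order_refl)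
  obtain \<delta>2 where \<delta>2: "0 < \<delta>2" "\<And>y. 0 \<le> y \<Longrightarrow> y \<le> \<delta>2 \<Longrightarrow> C2 * y \<le> g" using small[OF C0(2)] by blast
  have "0 \<le> C4 / \<epsilon>" using C0 \<epsilon> by simp
  then obtain \<delta>4 where \<delta>4: "0 < \<delta>4" "\<And>y. 0 \<le> y \<Longrightarrow> y \<le> \<delta>4 \<Longrightarrow> C4 / \<epsilon> * y \<le> g" using small by blast
  define \<eta> where "\<eta> = min \<eta>' 1"
  have \<eta>: "0 < \<eta>" "\<eta> \<le> 1" "C1 * \<eta> \<le> g" using \<eta>' by (auto simp: \<eta>_def)
  obtain \<delta>1 where \<delta>1: "0 < \<delta>1"
    "\<And>i j h. 0 < h \<Longrightarrow> h < \<delta>1 \<Longrightarrow> \<bar>p i j h - ((if j = i then 1 else 0) + q $ i $ j * h)\<bar> \<le> \<eta> * h"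
    using transition_rate_uniform[OF \<eta>(1)] by blast
  define \<delta> where "\<delta> = min \<delta>1 (min \<delta>2 \<delta>4)"
  have \<delta>: "0 < \<delta>" using \<delta>1 \<delta>2 \<delta>4 by (simp add: \<delta>_def)
  have "energy P T \<le> exp (- \<kappa> * (T - t0)) * energy P t0 + (2 * \<beta> * c + 4 * g) / \<kappa>"
  proof (rule discrete_gronwall[where \<phi>="energy P", OF T \<kappa> _ _ \<delta>])
    show "0 \<le> 2 * \<beta> * c + 4 * g" using \<beta>(1) c_nonneg g by simp
    show "0 \<le> energy P t0" unfolding energy_def by (intro Bochner_Integration.integral_nonneg P_nonneg)
    fix t h assume t: "t0 \<le> t" "0 < h" "h < \<delta>" "t + h \<le> T"
    have hb: "h < \<delta>1" "h \<le> \<delta>2" "h \<le> \<delta>4" using t(3) by (auto simp: \<delta>_def)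
    let ?E = "\<eta> * (real CARD('i) * (\<beta> * K)) + 4 * \<beta> * a * (rate_sum * h * K) +
     2 * \<beta> * (a * (\<epsilon> * K + (3 * a\<^sup>2 * (T - t0) * K + 3 * c) * h / \<epsilon>) + 2 * a * (rate_sum * h * K)) + 2 * \<beta> * (a\<^sup>2 * h * K)"
    have step: "energy P (t + h) \<le> (1 - \<kappa> * h) * energy P t + h * (2 * \<beta> * c + ?E)"
      using \<delta>1(2) hb \<eta> by (intro energy_step[OF t(1,2,4) K _ _ _ \<epsilon>(1)]) auto
    have "?E = C1 * \<eta> + C2 * h + C3 * \<epsilon> + C4 / \<epsilon> * h"
      unfolding C1_def C2_def C3_def C4_def by (simp add: distrib_left distrib_right ac_simps add_divide_distrib)
    also have "\<dots> \<le> g + g + g + g"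
      using \<eta>(3) \<epsilon>(2) \<delta>2(2)[of h] \<delta>4(2)[of h] hb t(2) by (intro add_mono) auto
    finally have "h * (2 * \<beta> * c + ?E) \<le> h * (2 * \<beta> * c + 4 * g)"
      using t(2) by (intro mult_left_mono) auto
    then show "energy P (t + h) \<le> (1 - \<kappa> * h) * energy P t + h * (2 * \<beta> * c + 4 * g)"
      using step by linarith
  qed
  also have "(2 * \<beta> * c + 4 * g) / \<kappa> = 2 * \<beta> * c / \<kappa> + \<gamma>"
    using \<kappa> by (simp add: g_def add_divide_distrib)
  finally show "energy P T \<le> exp (- \<kappa> * (T - t0)) * energy P t0 + 2 * \<beta> * c / \<kappa> + \<gamma>" by simp
qed

end

end

section \<open>Mean-square ultimate boundedness\<close>

text \<open>The minimum on the unit sphere is attained by compactness and is positive; homogeneity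
  extends the bound to all vectors.\<close>

lemma quadratic_form_lower_bound:
  fixes B :: "real^'n^'n"
  assumes "\<And>v. v \<noteq> 0 \<Longrightarrow> 0 < v \<bullet> (B *v v)"
  obtains \<alpha> where "0 < \<alpha>" "\<And>v. \<alpha> * (norm v)\<^sup>2 \<le> v \<bullet> (B *v v)"
proof -
  let ?f = "\<lambda>v. v \<bullet> (B *v v)"
  have "sphere (0::real^'n) 1 \<noteq> {}" by (simp add: sphere_eq_empty)
  moreover have "continuous_on (sphere 0 1) ?f"
    by (intro continuous_intros linear_continuous_on matrix_vector_mul_bounded_linear)
  ultimately have "\<exists>u\<in>sphere 0 1. \<forall>v\<in>sphere 0 1. ?f u \<le> ?f v"
    by (rule continuous_attains_inf[OF compact_sphere])
  then obtain u where u: "u \<in> sphere 0 1" "\<And>v. v \<in> sphere 0 1 \<Longrightarrow> ?f u \<le> ?f v"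
    by blast
  show ?thesis
  proof (rule that[of "?f u"])
    have "u \<noteq> 0" using u(1) by auto
    then show "0 < ?f u" by (rule assms)
    fix v :: "real^'n"
    show "?f u * (norm v)\<^sup>2 \<le> ?f v"
    proof (cases "v = 0")
      case False
      define z where "z = inverse (norm v) *\<^sub>R v"
      have "?f u \<le> ?f z" using False by (intro u(2)) (simp add: z_def)
      then have "?f u * (norm v)\<^sup>2 \<le> ?f z * (norm v)\<^sup>2" by (intro mult_right_mono) auto
      also have "?f z = inverse ((norm v)\<^sup>2) * ?f v"
        by (simp add: z_def matrix_vector_mult_scaleR power2_eq_square)
      also have "inverse ((norm v)\<^sup>2) * ?f v * (norm v)\<^sup>2 = ?f v" using False by simp
      finally show ?thesis .
    qed simp
  qed
qed

lemma quadratic_family_lower_bound: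
  fixes B :: "'i::finite \<Rightarrow> real^'n^'n"
  assumes "\<And>i v. v \<noteq> 0 \<Longrightarrow> 0 < v \<bullet> (B i *v v)"
  obtains \<alpha> where "0 < \<alpha>" "\<And>i v. \<alpha> * (norm v)\<^sup>2 \<le> v \<bullet> (B i *v v)"
proof -
  have "\<exists>\<alpha>>0. \<forall>v. \<alpha> * (norm v)\<^sup>2 \<le> v \<bullet> (B i *v v)" for i
    by (rule quadratic_form_lower_bound[of "B i"]) (use assms in auto)
  then obtain \<alpha> where \<alpha>: "\<And>i. 0 < \<alpha> i" "\<And>i v. \<alpha> i * (norm v)\<^sup>2 \<le> v \<bullet> (B i *v v)" by metis
  show ?thesis
  proof (rule that[of "Min (range \<alpha>)"])
    show "0 < Min (range \<alpha>)" using \<alpha>(1) by simp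
    fix i :: 'i and v :: "real^'n"
    have "Min (range \<alpha>) \<le> \<alpha> i" by simp
    then have "Min (range \<alpha>) * (norm v)\<^sup>2 \<le> \<alpha> i * (norm v)\<^sup>2" by (intro mult_right_mono) auto
    then show "Min (range \<alpha>) * (norm v)\<^sup>2 \<le> v \<bullet> (B i *v v)" using \<alpha>(2)[of i v] by linarith
  qed
qed

lemma lyapunov_quadratic:
  fixes A :: "real^'n^'n" and P :: "'i::finite \<Rightarrow> real^'n^'n"
  assumes "\<And>i. transpose (P i) = P i"
  shows "v \<bullet> ((transpose A ** P i + P i ** A + (\<Sum>j\<in>UNIV. q $ i $ j *\<^sub>R P j)) *v v) =
    2 * (v \<bullet> (P i *v (A *v v))) + (\<Sum>j\<in>UNIV. q $ i $ j * (v \<bullet> (P j *v v)))"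
proof -
  have "v \<bullet> (transpose A *v (P i *v v)) = (v v* transpose A) \<bullet> (P i *v v)" by (rule dot_lmul_matrix[symmetric])
  also have "v v* transpose A = A *v v" by (rule vector_transpose_matrix)
  also have "(A *v v) \<bullet> (P i *v v) = v \<bullet> (P i *v (A *v v))" by (rule inner_symmetric_matrix[OF assms])
  finally have 1: "v \<bullet> ((transpose A ** P i) *v v) = v \<bullet> (P i *v (A *v v))" by (simp add: matrix_vector_mul_assoc)
  have sum: "(\<Sum>j\<in>S. q $ i $ j *\<^sub>R P j) *v v = (\<Sum>j\<in>S. q $ i $ j *\<^sub>R (P j *v v))" if "finite S" for S
    using that by (induction S rule: finite_induct)
      (simp_all add: matrix_vector_mult_add_rdistrib scaleR_matrix_vector_assoc)
  show ?thesis
    using 1 by (simp add: matrix_vector_mult_add_rdistrib inner_add_right inner_sum_right sum matrix_vector_mul_assoc)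
qed

section \<open>From the given solution to regular paths\<close>

context markov_noise begin

lemma null_history:
  assumes "N \<in> null_sets M"
  shows "N \<in> sets (history M t0 w r t)"
proof -
  let ?G = "{w u -` B \<inter> space M | u B. 0 \<le> u \<and> u \<le> t \<and> B \<in> sets borel} \<union>
      {r u -` {i} \<inter> space M | u i. t0 \<le> u \<and> u \<le> t} \<union> null_sets M"
  have "null_sets M \<subseteq> Pow (space M)" using sets.space_closed[of M] by blast
  then have "?G \<subseteq> Pow (space M)" by blast
  then show ?thesis
    unfolding history_def using assms by (simp add: sets_measure_of sigma_sets.Basic)
qed

lemma history_sub: "subalgebra M (history M t0 w r t)"
  using history_enlarged[OF order_refl[of t]] subalgebra_enlarged[of t] by (auto simp: subalgebra_def)

text \<open>The modified processes \<open>x'\<close> and \<open>r'\<close> are shown to satisfy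
  \<open>switched_paths\<close>. Their noise agrees with the chosen Ito integrals almost surely at
  each single time only, but that is enough: the conditions on the noise concern two times at once
  and are stated through integrals over the outcomes.\<close>

lemma second_moment_decay:
  fixes A :: "'i \<Rightarrow> real^'n^'n" and W :: "'i \<Rightarrow> real^'p^'n"
  assumes sde: "switched_sde_solution M w t0 r A W x0 x"
    and paths: "AE \<omega> in M. \<forall>t\<ge>t0. \<forall>\<^sub>F u in at_right t. r u \<omega> = r t \<omega>"
    and rate: "\<And>i j. (\<lambda>h. p i j h - ((if j = i then 1 else 0) + q $ i $ j * h)) \<in> o[at_right 0](\<lambda>h. h)"
    and Wm: "\<And>i. norm (W i) \<le> b"
    and \<beta>: "0 < \<beta>" "\<And>i v. norm (P i *v v) \<le> \<beta> * norm v"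
    and P_sym: "\<And>i. transpose (P i) = P i"
    and \<alpha>: "0 < \<alpha>" "\<And>i v. \<alpha> * (norm v)\<^sup>2 \<le> v \<bullet> (P i *v v)"
    and \<kappa>: "0 < \<kappa>"
    and lyapunov: "\<And>i v. 2 * (v \<bullet> (P i *v (A i *v v))) + (\<Sum>j\<in>UNIV. q $ i $ j * (v \<bullet> (P j *v v))) \<le>
        - \<kappa> * (v \<bullet> (P i *v v))"
  obtains E where "\<And>T. t0 \<le> T \<Longrightarrow> (\<integral>\<^sup>+\<omega>. ennreal (x T \<omega> \<bullet> x T \<omega>) \<partial>M) \<le>
      ennreal ((exp (- \<kappa> * (T - t0)) * E + 2 * \<beta> * (9 * b\<^sup>2) / \<kappa>) / \<alpha>)"
proof -
  have "AE \<omega> in M. continuous_on {t0..} (\<lambda>t. x t \<omega>) \<and> (\<forall>t\<ge>t0. \<forall>\<^sub>F u in at_right t. r u \<omega> = r t \<omega>)"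
    using sde paths unfolding switched_sde_solution_def by auto
  from AE_E3[OF this] obtain N where N:
    "\<And>\<omega>. \<omega> \<in> space M - N \<Longrightarrow> continuous_on {t0..} (\<lambda>t. x t \<omega>) \<and> (\<forall>t\<ge>t0. \<forall>\<^sub>F u in at_right t. r u \<omega> = r t \<omega>)"
    and null: "N \<in> null_sets M" by blast
  have aeN: "AE \<omega> in M. \<omega> \<notin> N" by (rule AE_not_in[OF null])
  \<comment> \<open>Changing the processes on a null set preserves adaptedness, since the history contains the null sets,
    and makes the path properties hold everywhere.\<close>
  define x' where "x' t \<omega> = (if \<omega> \<in> N then 0 else x t \<omega>)" for t \<omega>
  define r' where "r' t \<omega> = (if \<omega> \<in> N then undefined else r t \<omega>)" for t \<omega>
  \<comment> \<open>The modified mode and \<open>max t0 s\<close> make the integrand jointly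
    measurable on the whole line; outside \<open>N\<close> and for \<open>s \<ge> t0\<close> it is
    still \<open>W (r s \<omega>)\<close>.\<close>
  define g where "g s \<omega> = W (r' (max t0 s) \<omega>)" for s \<omega>
  have x'_history: "x' t \<in> borel_measurable (history M t0 w r t)" if "t0 \<le> t" for t
    unfolding x'_def[abs_def]
  proof (rule measurable_If_set)
    show "x t \<in> borel_measurable (history M t0 w r t)"
      using sde that by (simp add: switched_sde_solution_def)
    show "N \<inter> space (history M t0 w r t) \<in> sets (history M t0 w r t)"
      using null_history[OF null] by (rule sets.Int[OF _ sets.top])
  qed simp
  have x'M: "x' t \<in> borel_measurable M" if "t0 \<le> t" for t
    by (rule measurable_from_subalg[OF history_sub x'_history[OF that]])
  have r'_enlarged: "r' t \<in> measurable (enlarged s) (count_space UNIV)" if "t0 \<le> t" for t s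
    unfolding r'_def[abs_def]
  proof (rule measurable_If_set)
    show "r t \<in> measurable (enlarged s) (count_space UNIV)" by (rule r_enlarged[OF that])
    show "N \<inter> space (enlarged s) \<in> sets (enlarged s)"
      using null_enlarged[OF null] by (rule sets.Int[OF _ sets.top])
  qed simp
  have r'M: "r' t \<in> measurable M (count_space UNIV)" if "t0 \<le> t" for t
    by (rule measurable_from_subalg[OF subalgebra_enlarged r'_enlarged[OF that]])
  obtain a where a: "0 < a" "\<And>i v. norm (A i *v v) \<le> a * norm v"
    using matrix_family_bound[of A] by blast
  interpret R: regular_paths M t0 x' r' A x0 a
  proof
    show "x' t \<in> borel_measurable M" if "t0 \<le> t" for t by (rule x'M[OF that])
    show "r' t \<in> measurable M (count_space UNIV)" if "t0 \<le> t" for t by (rule r'M[OF that])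
    show "continuous_on {t0..} (\<lambda>t. x' t \<omega>)" if "\<omega> \<in> space M" for \<omega>
      using N[of \<omega>] that by (cases "\<omega> \<in> N") (simp_all add: x'_def)
    show "\<forall>\<^sub>F u in at_right t. r' u \<omega> = r' t \<omega>" if "\<omega> \<in> space M" "t0 \<le> t" for t \<omega>
      using N[of \<omega>] that by (cases "\<omega> \<in> N") (simp_all add: r'_def)
  qed (fact a)+
  have gj: "(\<lambda>(\<omega>, s). g s \<omega>) \<in> borel_measurable (M \<Otimes>\<^sub>M lborel)"
    unfolding g_def
  proof (rule borel_measurable_right_continuous[where f="\<lambda>s \<omega>. W (r' s \<omega>)"])
    show "(\<lambda>\<omega>. W (r' t \<omega>)) \<in> borel_measurable M" if "t0 \<le> t" for t
      by (rule R.mode_measurable[OF that, where f="\<lambda>i _. W i"]) simp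
    show "((\<lambda>u. W (r' u \<omega>)) \<longlongrightarrow> W (r' t \<omega>)) (at_right t)" if "\<omega> \<in> space M" "t0 \<le> t" for t \<omega>
      by (rule R.mode_tendsto_right[OF that, where f="\<lambda>i _. W i"]) simp
  qed
  have gb: "norm (g s \<omega>) \<le> b" for s \<omega> unfolding g_def by (rule Wm)
  have "\<exists>I m \<tau> \<xi>. ito_approx t g I m \<tau> \<xi> \<and> (AE \<omega> in M. R.noise t \<omega> = I \<omega>)" if t: "t0 \<le> t" for t
  proof -
    obtain I where I: "has_ito_integral M (history M t0 w r) w t0 t (\<lambda>s \<omega>. W (r s \<omega>)) I"
      and eq: "AE \<omega> in M. x t \<omega> = x0 + (LINT s:{t0..t}|lborel. A (r s \<omega>) *v x s \<omega>) + I \<omega>"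
      using sde t unfolding switched_sde_solution_def by blast
    from I obtain m \<tau> \<xi> where Im: "I \<in> borel_measurable M"
      and sp: "\<And>k::nat. simple_process M (history M t0 w r) t0 t (m k) (\<tau> k) (\<xi> k)"
      and l1: "(\<lambda>k. \<integral>\<^sup>+\<omega>. (\<integral>\<^sup>+s\<in>{t0..t}. ennreal ((norm (W (r s \<omega>) - simple_value (m k) (\<tau> k) (\<xi> k) s \<omega>))\<^sup>2) \<partial>lborel) \<partial>M) \<longlonglongrightarrow> 0"
      and l2: "(\<lambda>k. \<integral>\<^sup>+\<omega>. ennreal ((norm (I \<omega> - simple_integral_wrt w (m k) (\<tau> k) (\<xi> k) \<omega>))\<^sup>2) \<partial>M) \<longlonglongrightarrow> 0"
      unfolding has_ito_integral_def by blast
    \<comment> \<open>Restricting the time integral amounts to cutting off the integrand, as the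
      simple processes vanish outside \<open>[t0, t)\<close>. The modification of the mode affects
      only outcomes in \<open>N\<close>.\<close>
    have "(\<integral>\<^sup>+\<omega>. (\<integral>\<^sup>+s\<in>{t0..t}. ennreal ((norm (W (r s \<omega>) - simple_value (m k) (\<tau> k) (\<xi> k) s \<omega>))\<^sup>2) \<partial>lborel) \<partial>M) =
        (\<integral>\<^sup>+\<omega>. (\<integral>\<^sup>+s. ennreal ((norm (indicator {t0..t} s *\<^sub>R g s \<omega> - simple_value (m k) (\<tau> k) (\<xi> k) s \<omega>))\<^sup>2) \<partial>lborel) \<partial>M)" for k
    proof (rule nn_integral_cong_AE)
      show "AE \<omega> in M. (\<integral>\<^sup>+s\<in>{t0..t}. ennreal ((norm (W (r s \<omega>) - simple_value (m k) (\<tau> k) (\<xi> k) s \<omega>))\<^sup>2) \<partial>lborel) =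
         (\<integral>\<^sup>+s. ennreal ((norm (indicator {t0..t} s *\<^sub>R g s \<omega> - simple_value (m k) (\<tau> k) (\<xi> k) s \<omega>))\<^sup>2) \<partial>lborel)"
        using aeN
      proof eventually_elim
        fix \<omega> assume \<omega>: "\<omega> \<notin> N"
        show "(\<integral>\<^sup>+s\<in>{t0..t}. ennreal ((norm (W (r s \<omega>) - simple_value (m k) (\<tau> k) (\<xi> k) s \<omega>))\<^sup>2) \<partial>lborel) =
         (\<integral>\<^sup>+s. ennreal ((norm (indicator {t0..t} s *\<^sub>R g s \<omega> - simple_value (m k) (\<tau> k) (\<xi> k) s \<omega>))\<^sup>2) \<partial>lborel)"
        proof (intro nn_integral_cong)
          fix s
          show "ennreal ((norm (W (r s \<omega>) - simple_value (m k) (\<tau> k) (\<xi> k) s \<omega>))\<^sup>2) * indicator {t0..t} s =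
              ennreal ((norm (indicator {t0..t} s *\<^sub>R g s \<omega> - simple_value (m k) (\<tau> k) (\<xi> k) s \<omega>))\<^sup>2)"
          proof (cases "s \<in> {t0..t}")
            case True
            then show ?thesis using \<omega> by (simp add: g_def r'_def max_def)
          next
            case False
            then have "simple_value (m k) (\<tau> k) (\<xi> k) s \<omega> = 0"
              by (intro simple_value_outside[OF sp]) auto
            then show ?thesis using False by simp
          qed
        qed
      qed
    qed
    then have "ito_approx t g I m \<tau> \<xi>"
      unfolding ito_approx_def using Im sp l1 l2 by simp
    moreover have "AE \<omega> in M. R.noise t \<omega> = I \<omega>"
      using aeN eq by eventually_elim (simp add: noise_part_def x'_def r'_def)
    ultimately show ?thesis by blast
  qed
  then obtain I m \<tau> \<xi> where ito: "\<And>t. t0 \<le> t \<Longrightarrow> ito_approx t g (I t) (m t) (\<tau> t) (\<xi> t)"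
    and noise: "\<And>t. t0 \<le> t \<Longrightarrow> AE \<omega> in M. R.noise t \<omega> = I t \<omega>" by metis
  \<comment> \<open>The variance rate \<open>9 * b^2\<close> is that of
    \<open>ito_increment_bound\<close>, with \<open>b\<close> a bound for the norms of the noise
    matrices.\<close>
  interpret S: switched_paths M t0 x' r' A x0 a "9 * b\<^sup>2" q p
  proof
    show "AE \<omega> in M. x' t0 \<omega> = x0"
    proof -
      have "AE \<omega> in M. x t0 \<omega> = x0" using sde by (simp add: switched_sde_solution_def)
      with aeN show ?thesis by eventually_elim (simp add: x'_def)
    qed
    show "0 \<le> 9 * b\<^sup>2" by simp
    show "(\<lambda>h. p i j h - ((if j = i then 1 else 0) + q $ i $ j * h)) \<in> o[at_right 0](\<lambda>h. h)" for i j
      by (rule rate)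
    show "(\<integral>\<^sup>+\<omega>. ennreal ((norm (R.noise t \<omega> - R.noise s \<omega>))\<^sup>2) \<partial>M) \<le> ennreal (9 * b\<^sup>2 * (t - s))"
      if st: "t0 \<le> s" "s \<le> t" for s t
    proof -
      have t: "t0 \<le> t" using st by simp
      have "AE \<omega> in M. ennreal ((norm (R.noise t \<omega> - R.noise s \<omega>))\<^sup>2) = ennreal ((norm (I t \<omega> - I s \<omega>))\<^sup>2)"
        using noise[OF t] noise[OF st(1)] by eventually_elim simp
      then have "(\<integral>\<^sup>+\<omega>. ennreal ((norm (R.noise t \<omega> - R.noise s \<omega>))\<^sup>2) \<partial>M) = (\<integral>\<^sup>+\<omega>. ennreal ((norm (I t \<omega> - I s \<omega>))\<^sup>2) \<partial>M)"
        by (rule nn_integral_cong_AE)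
      also have "\<dots> \<le> ennreal (9 * b\<^sup>2 * (t - s))"
        by (rule ito_increment_bound[OF st gj gb ito[OF t] ito[OF st(1)]])
      finally show ?thesis .
    qed
    show "(LINT \<omega>|M. (indicator {j} (r' t \<omega>) * x' s \<omega> $ k) * (R.noise t \<omega> - R.noise s \<omega>) $ l) = 0"
      if st: "t0 \<le> s" "s \<le> t" and sq: "sq_integrable M (\<lambda>\<omega>. x' s \<omega> $ k)" for s t j k l
    proof -
      have t: "t0 \<le> t" using st by simp
      have x's: "(\<lambda>\<omega>. x' s \<omega> $ k) \<in> borel_measurable (enlarged s)"
        by (rule measurable_compose[where g="\<lambda>v. v $ k", OF measurable_from_subalg[OF history_enlarged[OF order_refl] x'_history[OF st(1)]]]) simp
      have ind: "(\<lambda>\<omega>. indicator {j} (r' t \<omega>) :: real) \<in> borel_measurable (enlarged s)"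
        by (rule measurable_compose[OF r'_enlarged[OF t]]) simp
      \<comment> \<open>The mode is taken at \<open>t\<close>, after \<open>s\<close>; the product
        is nevertheless known in \<open>enlarged s\<close>, which contains the whole path of the
        chain.\<close>
      have F: "(\<lambda>\<omega>. indicator {j} (r' t \<omega>) * x' s \<omega> $ k) \<in> borel_measurable (enlarged s)"
        by (rule borel_measurable_times[OF ind x's])
      have FM: "(\<lambda>\<omega>. indicator {j} (r' t \<omega>) * x' s \<omega> $ k) \<in> borel_measurable M"
        by (rule measurable_from_subalg[OF subalgebra_enlarged F])
      have Fsq: "sq_integrable M (\<lambda>\<omega>. indicator {j} (r' t \<omega>) * x' s \<omega> $ k)"
        by (rule sq_integrable_bound[OF sq FM]) (simp add: indicator_def)
      have nl: "(\<lambda>\<omega>. (R.noise t \<omega> - R.noise s \<omega>) $ l) \<in> borel_measurable M"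
        by (rule measurable_compose[where g="\<lambda>v. v $ l", OF borel_measurable_diff[OF R.noise_measurable[OF t] R.noise_measurable[OF st(1)]]]) simp
      have Il: "(\<lambda>\<omega>. (I t \<omega> - I s \<omega>) $ l) \<in> borel_measurable M"
        using ito_increment_sq_integrable[OF st gj gb ito[OF t] ito[OF st(1)], of l] by (simp add: sq_integrable_def)
      have "(LINT \<omega>|M. (indicator {j} (r' t \<omega>) * x' s \<omega> $ k) * (R.noise t \<omega> - R.noise s \<omega>) $ l) =
          (LINT \<omega>|M. (indicator {j} (r' t \<omega>) * x' s \<omega> $ k) * (I t \<omega> - I s \<omega>) $ l)"
      proof (rule integral_cong_AE[OF borel_measurable_times[OF FM nl] borel_measurable_times[OF FM Il]])
        show "AE \<omega> in M. (indicator {j} (r' t \<omega>) * x' s \<omega> $ k) * (R.noise t \<omega> - R.noise s \<omega>) $ l =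
            (indicator {j} (r' t \<omega>) * x' s \<omega> $ k) * (I t \<omega> - I s \<omega>) $ l"
          using noise[OF t] noise[OF st(1)] by eventually_elim simp
      qed
      also have "\<dots> = 0"
        by (rule ito_increment_orthogonal[OF st gj gb ito[OF t] ito[OF st(1)] Fsq F])
      finally show ?thesis .
    qed
    show "(LINT \<omega>|M. x' t \<omega> $ k * x' t \<omega> $ l * (indicator {i} (r' t \<omega>) * indicator {j} (r' (t + h) \<omega>))) =
        p i j h * (LINT \<omega>|M. x' t \<omega> $ k * x' t \<omega> $ l * indicator {i} (r' t \<omega>))"
      if t: "t0 \<le> t" "0 < h" and int: "integrable M (\<lambda>\<omega>. x' t \<omega> $ k * x' t \<omega> $ l)" for t h i j k l
    proof -
      let ?f = "\<lambda>\<omega>. x' t \<omega> $ k * x' t \<omega> $ l"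
      have th: "t0 \<le> t + h" using t by simp
      have comp: "(\<lambda>\<omega>. x' t \<omega> $ k) \<in> borel_measurable (history M t0 w r t)" for k
        by (rule measurable_compose[where g="\<lambda>v. v $ k", OF x'_history[OF t(1)]]) simp
      have f: "?f \<in> borel_measurable (history M t0 w r t)"
        by (rule borel_measurable_times[OF comp comp])
      have fM: "?f \<in> borel_measurable M" by (rule measurable_from_subalg[OF history_sub f])
      have im: "(\<lambda>\<omega>. indicator {i} (\<rho> \<omega>) :: real) \<in> borel_measurable M"
        if "\<rho> \<in> measurable M (count_space UNIV)" for i and \<rho> :: "'a \<Rightarrow> 'i"
        by (rule measurable_compose[OF that]) simp
      have "(LINT \<omega>|M. ?f \<omega> * (indicator {i} (r' t \<omega>) * indicator {j} (r' (t + h) \<omega>))) =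
          (LINT \<omega>|M. ?f \<omega> * (indicator {i} (r t \<omega>) * indicator {j} (r (t + h) \<omega>)))"
      proof (rule integral_cong_AE[OF
            borel_measurable_times[OF fM borel_measurable_times[OF im[OF r'M[OF t(1)]] im[OF r'M[OF th]]]]
            borel_measurable_times[OF fM borel_measurable_times[OF im[OF r_measurable[OF t(1)]] im[OF r_measurable[OF th]]]]])
        show "AE \<omega> in M. ?f \<omega> * (indicator {i} (r' t \<omega>) * indicator {j} (r' (t + h) \<omega>)) =
            ?f \<omega> * (indicator {i} (r t \<omega>) * indicator {j} (r (t + h) \<omega>))"
          using aeN by eventually_elim (simp add: r'_def)
      qed
      also have "\<dots> = p i j h * (LINT \<omega>|M. ?f \<omega> * indicator {i} (r t \<omega>))"
        by (rule transition_integral[OF t f int])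
      also have "(LINT \<omega>|M. ?f \<omega> * indicator {i} (r t \<omega>)) = (LINT \<omega>|M. ?f \<omega> * indicator {i} (r' t \<omega>))"
      proof (rule integral_cong_AE[OF borel_measurable_times[OF fM im[OF r_measurable[OF t(1)]]]
            borel_measurable_times[OF fM im[OF r'M[OF t(1)]]]])
        show "AE \<omega> in M. ?f \<omega> * indicator {i} (r t \<omega>) = ?f \<omega> * indicator {i} (r' t \<omega>)"
          using aeN by eventually_elim (simp add: r'_def)
      qed
      finally show ?thesis .
    qed
  qed
  have Pnn: "0 \<le> v \<bullet> (P i *v v)" for i v
    using \<alpha>(2)[of v i] \<alpha>(1) by (meson less_imp_le mult_nonneg_nonneg order_trans zero_le_power2)
  show ?thesis
  proof (rule that)
    fix T assume T: "t0 \<le> T"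
    have ei: "integrable M (\<lambda>\<omega>. x' T \<omega> \<bullet> (P (r' T \<omega>) *v x' T \<omega>))"
      using S.mode_quadratic_integrable[OF T T, of "\<lambda>i _. P i"] by simp
    have "\<alpha> * (LINT \<omega>|M. (norm (x' T \<omega>))\<^sup>2) = (LINT \<omega>|M. \<alpha> * (norm (x' T \<omega>))\<^sup>2)" by simp
    also have "\<dots> \<le> S.energy P T"
      unfolding S.energy_def using S.x_sq_int[OF T] by (intro integral_mono ei \<alpha>(2)) auto
    also have "\<dots> \<le> exp (- \<kappa> * (T - t0)) * S.energy P t0 + 2 * \<beta> * (9 * b\<^sup>2) / \<kappa>"
      by (rule S.energy_decay[OF \<beta> P_sym Pnn \<kappa> lyapunov T])
    finally have le: "(LINT \<omega>|M. (norm (x' T \<omega>))\<^sup>2) \<le>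
        (exp (- \<kappa> * (T - t0)) * S.energy P t0 + 2 * \<beta> * (9 * b\<^sup>2) / \<kappa>) / \<alpha>"
      using \<alpha>(1) by (simp add: pos_le_divide_eq mult.commute)
    have "AE \<omega> in M. ennreal (x T \<omega> \<bullet> x T \<omega>) = ennreal ((norm (x' T \<omega>))\<^sup>2)"
      using aeN by eventually_elim (simp add: x'_def power2_norm_eq_inner)
    then have "(\<integral>\<^sup>+\<omega>. ennreal (x T \<omega> \<bullet> x T \<omega>) \<partial>M) = (\<integral>\<^sup>+\<omega>. ennreal ((norm (x' T \<omega>))\<^sup>2) \<partial>M)"
      by (rule nn_integral_cong_AE)
    also have "\<dots> = ennreal (LINT \<omega>|M. (norm (x' T \<omega>))\<^sup>2)"
      using S.x_sq_int[OF T] by (intro nn_integral_eq_integral) auto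
    also have "\<dots> \<le> ennreal ((exp (- \<kappa> * (T - t0)) * S.energy P t0 + 2 * \<beta> * (9 * b\<^sup>2) / \<kappa>) / \<alpha>)"
      using le by (rule ennreal_leI)
    finally show "(\<integral>\<^sup>+\<omega>. ennreal (x T \<omega> \<bullet> x T \<omega>) \<partial>M) \<le>
        ennreal ((exp (- \<kappa> * (T - t0)) * S.energy P t0 + 2 * \<beta> * (9 * b\<^sup>2) / \<kappa>) / \<alpha>)" .
  qed
qed

end

theorem proposition1:
  fixes \<Omega> :: "'a measure"
    and w :: "real \<Rightarrow> 'a \<Rightarrow> real ^ 'p"
    and t0 :: real
    and q :: "real ^ 'i ^ 'i"
    and A :: "'i::finite \<Rightarrow> real ^ 'n ^ 'n"
    and B :: "'i \<Rightarrow> real ^ 'm ^ 'n"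
    and C :: "'i \<Rightarrow> real ^ 'n ^ 'p"
    and D :: "'i \<Rightarrow> real ^ 'p ^ 'p"
    and K :: "'i \<Rightarrow> real ^ 'p ^ 'm"
  defines "A_cl \<equiv> closed_loop_matrix A B K C"
    and "W \<equiv> noise_matrix B K D"
  assumes "prob_space \<Omega>"
    and "wiener_process \<Omega> w"
    and "t0 \<ge> 0"
    and "generator_matrix q"
    and "\<exists>P. (\<forall>i. pos_def (P i)) \<and>
           (\<forall>i. neg_def (transpose (A_cl i) ** P i + P i ** A_cl i
                  + (\<Sum>j\<in>UNIV. q $ i $ j *\<^sub>R P j)))"
  shows "ubs_mean_square \<Omega> w t0 q A_cl W"
proof -
  obtain P where P: "\<And>i. pos_def (P i)"
    and Q: "\<And>i. neg_def (transpose (A_cl i) ** P i + P i ** A_cl i + (\<Sum>j\<in>UNIV. q $ i $ j *\<^sub>R P j))"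
    using assms(7) by blast
  have P_sym: "transpose (P i) = P i" for i using P by (simp add: pos_def_def)
  have P_pos: "0 < v \<bullet> (P i *v v)" if "v \<noteq> 0" for i v using P that by (simp add: pos_def_def)
  obtain \<alpha> where \<alpha>: "0 < \<alpha>" "\<And>i v. \<alpha> * (norm v)\<^sup>2 \<le> v \<bullet> (P i *v v)"
    using quadratic_family_lower_bound[of P, OF P_pos] by blast
  obtain \<beta> where \<beta>: "0 < \<beta>" "\<And>i v. norm (P i *v v) \<le> \<beta> * norm v"
    using matrix_family_bound[of P] by blast
  let ?S = "\<lambda>i. transpose (A_cl i) ** P i + P i ** A_cl i + (\<Sum>j\<in>UNIV. q $ i $ j *\<^sub>R P j)"
  let ?L = "\<lambda>i v. 2 * (v \<bullet> (P i *v (A_cl i *v v))) + (\<Sum>j\<in>UNIV. q $ i $ j * (v \<bullet> (P j *v v)))"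
  have S: "v \<bullet> (?S i *v v) = ?L i v" for i v
    by (rule lyapunov_quadratic[OF P_sym])
  have minus: "(- B) *v v = - (B *v v)" for B :: "real^'n^'n" and v
    by (simp add: matrix_vector_mult_def vec_eq_iff sum_negf)
  have neg: "v \<bullet> (- ?S i *v v) = - ?L i v" for i v
    by (simp only: minus inner_minus_right S)
  \<comment> \<open>The sign is reversed so that the compactness bound for positive forms also gives
    a uniform margin \<open>\<mu>\<close> of negativity.\<close>
  have Q_pos: "0 < v \<bullet> (- ?S i *v v)" if "v \<noteq> 0" for i v
  proof -
    have "v \<bullet> (?S i *v v) < 0" using Q[of i] that unfolding neg_def_def by blast
    then show ?thesis by (simp only: minus inner_minus_right neg_0_less_iff_less)
  qed
  obtain \<mu> where \<mu>: "0 < \<mu>" "\<And>i v. \<mu> * (norm v)\<^sup>2 \<le> v \<bullet> (- ?S i *v v)"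
    using quadratic_family_lower_bound[of "\<lambda>i. - ?S i", OF Q_pos] by blast
  \<comment> \<open>The Lyapunov expression is at most \<open>- \<mu> |v|^2\<close>, and
    \<open>v \<bullet> (P i *v v)\<close> is at most \<open>\<beta> |v|^2\<close>; the quotient is
    the decay rate in terms of \<open>P\<close> itself.\<close>
  define \<kappa> where "\<kappa> = \<mu> / \<beta>"
  have \<kappa>: "0 < \<kappa>" using \<mu> \<beta> by (simp add: \<kappa>_def)
  have lyapunov: "2 * (v \<bullet> (P i *v (A_cl i *v v))) + (\<Sum>j\<in>UNIV. q $ i $ j * (v \<bullet> (P j *v v))) \<le>
      - \<kappa> * (v \<bullet> (P i *v v))" for i v
  proof -
    have "v \<bullet> (P i *v v) \<le> norm v * norm (P i *v v)" by (rule norm_cauchy_schwarz)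
    also have "\<dots> \<le> norm v * (\<beta> * norm v)" by (intro mult_left_mono \<beta>) auto
    finally have "\<kappa> * (v \<bullet> (P i *v v)) \<le> \<kappa> * (\<beta> * (norm v)\<^sup>2)"
      using \<kappa> by (intro mult_left_mono) (auto simp: power2_eq_square ac_simps)
    also have "\<dots> = \<mu> * (norm v)\<^sup>2" using \<beta>(1) by (simp add: \<kappa>_def)
    finally show ?thesis using \<mu>(2)[of v i] unfolding neg by simp
  qed
  define b where "b = (\<Sum>i\<in>UNIV. norm (W i))"
  have b: "norm (W i) \<le> b" for i
    unfolding b_def by (rule member_le_sum) auto
  \<comment> \<open>This is the limit of the moment bound for large times. It is fixed before any
    solution is considered, which makes the bound uniform in the initial condition; the final
    constant is \<open>c + 1\<close>, where the 1 leaves room for the transient and ensures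
    positivity.\<close>
  define c where "c = 2 * \<beta> * (9 * b\<^sup>2) / \<kappa> / \<alpha>"
  have c: "0 \<le> c" using \<beta> \<kappa> \<alpha> by (simp add: c_def)
  have "Limsup at_top (\<lambda>t. \<integral>\<^sup>+\<omega>. ennreal (x t \<omega> \<bullet> x t \<omega>) \<partial>\<Omega>) \<le> ennreal (c + 1)"
    if mc: "markov_chain \<Omega> t0 r0 q r" and ind: "independent_processes \<Omega> t0 w r"
      and sde: "switched_sde_solution \<Omega> w t0 r A_cl W x0 x" for x0 r0 r x
  proof -
    obtain p where p: "\<And>t h i j. t0 \<le> t \<Longrightarrow> 0 < h \<Longrightarrow> \<P>(\<omega> in \<Omega>. r t \<omega> = i) > 0 \<Longrightarrow>
        \<P>(\<omega> in \<Omega>. r (t + h) \<omega> = j \<bar> r t \<omega> = i) = p i j h"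
      and rate: "\<And>i j. (\<lambda>h. p i j h - ((if j = i then 1 else 0) + q $ i $ j * h)) \<in> o[at_right 0](\<lambda>h. h)"
      using mc unfolding markov_chain_def by blast
    interpret prob_space \<Omega> by fact
    interpret markov_noise \<Omega> w t0 r p
    proof
      show "r t \<in> measurable \<Omega> (count_space UNIV)" if "t0 \<le> t" for t
        using mc that by (simp add: markov_chain_def)
      show "\<P>(\<omega> in \<Omega>. r t \<omega> = j \<bar> r s \<omega> = i \<and> (\<forall>u\<in>S. r u \<omega> = \<sigma> u)) = \<P>(\<omega> in \<Omega>. r t \<omega> = j \<bar> r s \<omega> = i)"
        if "t0 \<le> s" "s < t" "finite S" "S \<subseteq> {t0..<s}" "\<P>(\<omega> in \<Omega>. r s \<omega> = i \<and> (\<forall>u\<in>S. r u \<omega> = \<sigma> u)) > 0"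
        for s t i j S \<sigma>
        using mc that unfolding markov_chain_def by blast
    qed (use assms ind p in auto)
    have paths: "AE \<omega> in \<Omega>. \<forall>t\<ge>t0. \<forall>\<^sub>F u in at_right t. r u \<omega> = r t \<omega>"
      using mc unfolding markov_chain_def by auto
    \<comment> \<open>\<open>E\<close> depends on the solution and its initial condition, but it is
      multiplied by a decaying exponential, so this part eventually drops below 1.\<close>
    obtain E where E: "\<And>T. t0 \<le> T \<Longrightarrow> (\<integral>\<^sup>+\<omega>. ennreal (x T \<omega> \<bullet> x T \<omega>) \<partial>\<Omega>) \<le>
        ennreal ((exp (- \<kappa> * (T - t0)) * E + 2 * \<beta> * (9 * b\<^sup>2) / \<kappa>) / \<alpha>)"
      using second_moment_decay[OF sde paths rate b \<beta> P_sym \<alpha> \<kappa> lyapunov] by blast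
    have "filterlim (\<lambda>T. - t0 + T) at_top at_top"
      by (rule filterlim_tendsto_add_at_top[OF tendsto_const filterlim_ident])
    then have "filterlim (\<lambda>T. - \<kappa> * (- t0 + T)) at_bot at_top"
      using \<kappa> by (intro filterlim_tendsto_neg_mult_at_bot[OF tendsto_const]) auto
    then have "filterlim (\<lambda>T. - \<kappa> * (T - t0)) at_bot at_top" by simp
    then have "((\<lambda>T. exp (- \<kappa> * (T - t0)) * E / \<alpha>) \<longlongrightarrow> 0 * E / \<alpha>) at_top"
      using \<alpha>(1) by (intro tendsto_intros filterlim_compose[OF exp_at_bot]) auto
    then have "((\<lambda>T. exp (- \<kappa> * (T - t0)) * E / \<alpha>) \<longlongrightarrow> 0) at_top" by simp
    then have "\<forall>\<^sub>F T in at_top. exp (- \<kappa> * (T - t0)) * E / \<alpha> < 1"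
      by (rule order_tendstoD(2)) simp
    then have "\<forall>\<^sub>F T in at_top. (\<integral>\<^sup>+\<omega>. ennreal (x T \<omega> \<bullet> x T \<omega>) \<partial>\<Omega>) \<le> ennreal (c + 1)"
      using eventually_ge_at_top[of t0]
    proof eventually_elim
      fix T assume T: "exp (- \<kappa> * (T - t0)) * E / \<alpha> < 1" "t0 \<le> T"
      have "(exp (- \<kappa> * (T - t0)) * E + 2 * \<beta> * (9 * b\<^sup>2) / \<kappa>) / \<alpha> \<le> c + 1"
        using T(1) by (simp add: c_def add_divide_distrib)
      then show "(\<integral>\<^sup>+\<omega>. ennreal (x T \<omega> \<bullet> x T \<omega>) \<partial>\<Omega>) \<le> ennreal (c + 1)"
        using E[OF T(2)] ennreal_leI order_trans by blast
    qed
    then show ?thesis by (rule Limsup_bounded)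
  qed
  then show ?thesis
    unfolding ubs_mean_square_def using c by (intro exI[of _ "c + 1"]) auto
qed

end
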